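(* Let $n\ge 1$ be an integer, let $q$ be a prime power, and let $T$ be an $n$-vertex bypass transition graph. Then the graph $G(n,q,T)$ is Hamilton connected unless it is a cycle.
   Context: $GL(n,q)$ is the group of invertible $n\times n$ matrices over the finite field $\mathbb{F}_q$, and $[n]=\{1,\dots,n\}$. Fix a generator $\alpha$ of the multiplicative group of $\mathbb{F}_q$. A transition graph is a directed graph $T$ (without loops) on the vertex set $[n]$, with edge set $E(T)$. A transition graph $T$ on $[n]$ is a bypass transition graph if either $n=1$, or $n\ge 2$ and (i) there exist an edge $(i,n)$ and an edge $(n,j)$ of $T$ for some $i,j\in[n-1]$, and (ii) the graph $T-n$ obtained by removing the vertex $n$ from $T$ is a bypass transition graph on $[n-1]$. For distinct $x,y\in[n]$ let $A_{xy}$ be the $n\times n$ matrix with entry $1$ at position $(i,j)$ if $i=j$ or ($i=y$ and $j=x$), and $0$ elsewhere (left multiplication by $A_{xy}$ adds row $x$ to row $y$). For $x\in[n]$ let $M_x$ be the diagonal matrix with $\alpha$ at position $(x,x)$ and $1$ at the other diagonal positions. Define $\mathrm{ops}(T)=\{A_{ij},A_{ij}^{-1}:(i,j)\in E(T)\}\cup\{M_i,M_i^{-1}:i\in[n]\}$ if $q>2$, and $\mathrm{ops}(T)=\{A_{ij},A_{ij}^{-1}:(i,j)\in E(T)\}$ if $q=2$. $G(n,q,T)$ is the undirected simple graph with vertex set $GL(n,q)$ and edges $\{X,SX\}$ for $X\in GL(n,q)$, $S\in\mathrm{ops}(T)$ (the Cayley graph with generators acting on the left). A graph is Hamilton connected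 if for any two distinct vertices there is a Hamilton path between them (so the one-vertex graph is Hamilton connected). *)

theory Defs
  imports
    "Jordan_Normal_Form.Determinant"
    "Graph_Theory.Pair_Digraph"
    "Graph_Theory.Vertex_Walk"
    "HOL-Library.Cardinality"
begin

text \<open>
  Matrix indices in the library start at 0, so the vertex set \<open>[n]\<close> is represented by \<open>{..<n}\<close>;
  the vertex called \<open>n\<close> in the mathematical text is \<open>n - 1\<close> here. Undirected simple graphs are
  represented as symmetric loop-free digraphs (locale \<^locale>\<open>pair_graph\<close>).
\<close>

definition transition_graph :: "nat \<Rightarrow> nat pair_pre_digraph \<Rightarrow> bool" where
  "transition_graph n T \<longleftrightarrow> pair_digraph T \<and> pverts T = {..<n}"

definition pair_del_vert :: "'v pair_pre_digraph \<Rightarrow> 'v \<Rightarrow> 'v pair_pre_digraph" where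
  "pair_del_vert G v =
     \<lparr>pverts = pverts G - {v}, parcs = {e \<in> parcs G. fst e \<noteq> v \<and> snd e \<noteq> v}\<rparr>"

lemma with_proj_pair_del_vert:
  "with_proj (pair_del_vert G v) = pre_digraph.del_vert (with_proj G) v"
  by (simp add: with_proj_def pair_del_vert_def pre_digraph.del_vert_def)

fun bypass_transition_graph :: "nat \<Rightarrow> nat pair_pre_digraph \<Rightarrow> bool" where
  "bypass_transition_graph 0 T \<longleftrightarrow> False"
| "bypass_transition_graph (Suc 0) T \<longleftrightarrow> transition_graph (Suc 0) T"
| "bypass_transition_graph (Suc (Suc m)) T \<longleftrightarrow>
     transition_graph (Suc (Suc m)) T \<and>
     (\<exists>i < Suc m. (i, Suc m) \<in> parcs T) \<and>
     (\<exists>j < Suc m. (Suc m, j) \<in> parcs T) \<and>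
     bypass_transition_graph (Suc m) (pair_del_vert T (Suc m))"

definition mult_generator :: "'a::field \<Rightarrow> bool" where
  "mult_generator \<alpha> \<longleftrightarrow> range (\<lambda>k::nat. \<alpha> ^ k) = - {0}"

definition GL :: "'a::field itself \<Rightarrow> nat \<Rightarrow> 'a mat monoid" where
  "GL ty n = units_of (ring_mat ty n ())"

text \<open>
  \<^term>\<open>addrow_mat n a k l\<close> adds \<open>a\<close> times row \<open>l\<close> to row \<open>k\<close>; hence the argument order
  below.
\<close>

definition A_mat :: "nat \<Rightarrow> nat \<Rightarrow> nat \<Rightarrow> 'a::field mat" where
  "A_mat n x y = addrow_mat n 1 y x"

definition M_mat :: "nat \<Rightarrow> 'a::field \<Rightarrow> nat \<Rightarrow> 'a mat" where
  "M_mat n \<alpha> x = multrow_mat n x \<alpha>"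

definition op_gens :: "nat \<Rightarrow> 'a::{field,finite} \<Rightarrow> nat pair_pre_digraph \<Rightarrow> 'a mat set" where
  "op_gens n \<alpha> T =
     {A_mat n i j | i j. (i, j) \<in> parcs T} \<union>
     (if CARD('a) > 2 then {M_mat n \<alpha> i | i. i < n} else {})"

definition ops :: "nat \<Rightarrow> 'a::{field,finite} \<Rightarrow> nat pair_pre_digraph \<Rightarrow> 'a mat set" where
  "ops n \<alpha> T = op_gens n \<alpha> T \<union> (\<lambda>S. inv\<^bsub>GL TYPE('a) n\<^esub> S) ` op_gens n \<alpha> T"

definition GL_graph ::
    "nat \<Rightarrow> 'a::{field,finite} \<Rightarrow> nat pair_pre_digraph \<Rightarrow> 'a mat pair_pre_digraph" where
  "GL_graph n \<alpha> T =
     \<lparr>pverts = carrier (GL TYPE('a) n),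
      parcs = (\<Union>X \<in> carrier (GL TYPE('a) n). \<Union>S \<in> ops n \<alpha> T. {(X, S * X), (S * X, X)})\<rparr>"

definition Hamilton_path :: "'v pair_pre_digraph \<Rightarrow> 'v \<Rightarrow> 'v list \<Rightarrow> 'v \<Rightarrow> bool" where
  "Hamilton_path G u p v \<longleftrightarrow>
     vpath p (with_proj G) \<and> hd p = u \<and> last p = v \<and> set p = pverts G"

definition Hamilton_connected :: "'v pair_pre_digraph \<Rightarrow> bool" where
  "Hamilton_connected G \<longleftrightarrow>
     (\<forall>u \<in> pverts G. \<forall>v \<in> pverts G. u \<noteq> v \<longrightarrow> (\<exists>p. Hamilton_path G u p v))"

definition is_cycle_graph :: "'v pair_pre_digraph \<Rightarrow> bool" where
  "is_cycle_graph G \<longleftrightarrow>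
     (\<exists>vs. distinct vs \<and> 3 \<le> length vs \<and> pverts G = set vs \<and>
        parcs G = set (vwalk_arcs (vs @ [hd vs])) \<union> (set (vwalk_arcs (vs @ [hd vs])))\<inverse>)"

end

theory Submission
  imports Defs "HOL-Algebra.Multiplicative_Group" "HOL-Library.Product_Plus"
    "HOL-Number_Theory.Residues"
begin

text \<open>
  Let \<open>K \<le> L\<close> be subgroups of the general linear group such that the Cayley graph restricted to \<open>K\<close>
  is Hamilton connected, and let \<open>s\<close> be a generator in \<open>L\<close>. If \<open>L = K \<union> K s K\<close>, then left
  multiplication by \<open>s\<close> joins any two right cosets of \<open>K\<close> in \<open>L\<close>, and Hamilton paths of the cosets
  can be concatenated to Hamilton paths of \<open>L\<close> (for two end points in the same coset, its Hamilton path is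
  cut between two vertices with exits to different cosets, and a path through all other cosets is inserted).
  A generator normalising \<open>K\<close> extends \<open>K\<close> in a similar way by a cyclic walk through the cosets.
  The first argument serves the two steps from \<open>GL\<^sub>r \<times> GL\<^sub>1\<close> to the block triangular group and from there
  to \<open>GL\<^sub>r\<^sub>+\<^sub>1\<close>; the second one serves the step from \<open>GL\<^sub>r\<close> to \<open>GL\<^sub>r \<times> GL\<^sub>1\<close>. So the bypass
  condition gives an induction on the size \<open>r\<close> of the upper left corner, starting from size \<open>2\<close> if
  \<open>q > 2\<close> and from size \<open>3\<close> if \<open>q = 2\<close>.

  The case \<open>n = 2\<close> with odd \<open>q\<close> is delicate: the torus of diagonal matrices is bipartite then, with the parity
  of the discrete logarithm of the determinant as its colouring. For \<open>q \<ge> 7\<close>, the cosets of the triangular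
  group are laced by walking along the tori at \<open>t\<^sub>0 + \<alpha>\<^sup>j d\<close>, and end points of the wrong parity are
  handled by cutting the Hamilton path of one coset into pieces. The remaining small groups
  (\<open>q = 3\<close>, \<open>q = 5\<close>, and the affine group of order \<open>24\<close> for \<open>q = 2\<close>) are settled by explicit paths.
\<close>

section \<open>Hamilton paths in unions of vertex sets\<close>

text \<open>For odd \<open>q\<close> a torus is a balanced bipartite graph, so its Hamilton paths
  join vertices of opposite colour only, while the additive generators keep the determinant and
  hence the colour. Lacing a coset from torus to torus therefore needs additive steps whose
  quadratic characters alternate. Points in geometric progression with a non-square ratio have such
  differences; this is the reason for walking along t_0 + \<alpha>^j d. A coset of the triangular
  group consists of q tori, an odd number, so a path through it flips the colour as well, and a
  chain through all q + 1 cosets flips it an even number of times. End points that do not fit this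
  count require a cut. The bound q >= 7 enters twice: \<alpha>^2 has at least three powers, so a
  vertex of given colour with an edge to a given coset can avoid two forbidden tori; and there are
  at least 8 cosets, one more than the seven that a choice may have to avoid. For
  \<open>q = 2\<close> the start at size 3 is forced: GL_2 is a hexagon, and the step to the block
  triangular group finds its three parallel links with the single coefficient 1 only from r = 3
  on.\<close>

definition hpath :: "('v \<Rightarrow> 'v \<Rightarrow> bool) \<Rightarrow> 'v set \<Rightarrow> 'v \<Rightarrow> 'v list \<Rightarrow> 'v \<Rightarrow> bool" where
  "hpath E S x p y \<longleftrightarrow>
     p \<noteq> [] \<and> hd p = x \<and> last p = y \<and> distinct p \<and> set p = S \<and> successively E p"

definition hconn :: "('v \<Rightarrow> 'v \<Rightarrow> bool) \<Rightarrow> 'v set \<Rightarrow> bool" where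
  "hconn E S \<longleftrightarrow> (\<forall>x\<in>S. \<forall>y\<in>S. x \<noteq> y \<longrightarrow> (\<exists>p. hpath E S x p y))"

lemma hconnD: "hconn E S \<Longrightarrow> x \<in> S \<Longrightarrow> y \<in> S \<Longrightarrow> x \<noteq> y \<Longrightarrow> \<exists>p. hpath E S x p y"
  by (auto simp: hconn_def)

lemma hpath_single: "hpath E {x} x [x] x"
  by (auto simp: hpath_def)

lemma hpath_append:
  assumes "hpath E S x p a" "hpath E S' b q z" "E a b" "S \<inter> S' = {}"
  shows "hpath E (S \<union> S') x (p @ q) z"
  using assms by (auto simp: hpath_def successively_append_iff)

lemma hpath_rev:
  assumes "symp E" "hpath E S x p y"
  shows "hpath E S y (rev p) x"
proof -
  have "successively (\<lambda>x y. E y x) p"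
    using assms by (auto simp: hpath_def intro: successively_mono dest: sympD)
  then show ?thesis
    using assms by (auto simp: hpath_def hd_rev last_rev)
qed

lemma hpath_mono:
  assumes "hpath E S x p y" "\<And>x y. x \<in> S \<Longrightarrow> y \<in> S \<Longrightarrow> E x y \<Longrightarrow> E' x y"
  shows "hpath E' S x p y"
  using assms by (auto simp: hpath_def intro: successively_mono)

lemma hpath_image:
  assumes "hpath E S x p y" "inj_on f S"
    "\<And>x y. x \<in> S \<Longrightarrow> y \<in> S \<Longrightarrow> E x y \<Longrightarrow> E' (f x) (f y)"
  shows "hpath E' (f ` S) (f x) (map f p) (f y)"
proof -
  have "successively (\<lambda>x y. E' (f x) (f y)) p"
    using assms by (auto simp: hpath_def intro: successively_mono)
  then show ?thesis
    using assms by (auto simp: hpath_def hd_map last_map distinct_map successively_map)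
qed

lemma hpath_split:
  assumes "hpath E S x (p @ q) y" "p \<noteq> []" "q \<noteq> []"
  shows "hpath E (set p) x p (last p)" "hpath E (set q) (hd q) q y" "E (last p) (hd q)"
    "set p \<inter> set q = {}" "S = set p \<union> set q"
  using assms by (auto simp: hpath_def successively_append_iff)

lemma hconn_image:
  assumes "hconn E S" "inj_on f S"
    "\<And>x y. x \<in> S \<Longrightarrow> y \<in> S \<Longrightarrow> E x y \<Longrightarrow> E' (f x) (f y)"
  shows "hconn E' (f ` S)"
  unfolding hconn_def
proof (intro ballI impI)
  fix x y assume "x \<in> f ` S" "y \<in> f ` S" "x \<noteq> y"
  then obtain a b where "a \<in> S" "b \<in> S" "x = f a" "y = f b" "a \<noteq> b" by auto
  then show "\<exists>p. hpath E' (f ` S) x p y"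
    using hconnD[OF assms(1), of a b] hpath_image[OF _ assms(2), of E a _ b E'] assms(3) by blast
qed

text \<open>A function that is not constant on a list changes between two neighbours. Applied to the
  map that names the piece entered from each vertex, it finds an edge whose ends leave to different
  pieces, which is the place to cut a path.\<close>

lemma exists_step:
  assumes "x \<in> set p" "y \<in> set p" "f x \<noteq> f y"
  shows "\<exists>p1 a b p2. p = p1 @ a # b # p2 \<and> f a \<noteq> f b"
  using assms
proof (induction p arbitrary: x y)
  case Nil
  then show ?case by simp
next
  case (Cons c p)
  show ?case
  proof (cases "\<exists>x\<in>set p. \<exists>y\<in>set p. f x \<noteq> f y")
    case True
    then obtain p1 a b p2 where "p = p1 @ a # b # p2" "f a \<noteq> f b" using Cons.IH by blast
    then have "c # p = (c # p1) @ a # b # p2" by simp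
    then show ?thesis using \<open>f a \<noteq> f b\<close> by blast
  next
    case False
    then obtain d p' where p: "p = d # p'" using Cons.prems by (cases p) auto
    have "f c \<noteq> f d" using Cons.prems False p by (metis list.set_intros(1) set_ConsD)
    then have "c # p = [] @ c # d # p'" "f c \<noteq> f d" using p by auto
    then show ?thesis by blast
  qed
qed

text \<open>The detour by which further pieces are absorbed without moving the end points.\<close>

lemma hpath_insert:
  assumes "hpath E S x (p1 @ a # b # p2) y" "hpath E S' a' q b'" "E a a'" "E b' b" "S \<inter> S' = {}"
  shows "\<exists>p. hpath E (S \<union> S') x p y"
proof -
  from hpath_split[of E S x "p1 @ [a]" "b # p2" y] assms(1)
  have s: "hpath E (set (p1 @ [a])) x (p1 @ [a]) a" "hpath E (set (b # p2)) b (b # p2) y"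
    "set (p1 @ [a]) \<inter> set (b # p2) = {}" "S = set (p1 @ [a]) \<union> set (b # p2)" by simp_all
  have "hpath E (set (p1 @ [a]) \<union> S') x ((p1 @ [a]) @ q) b'"
    by (rule hpath_append[OF s(1) assms(2)]) (use assms s in auto)
  then have "hpath E ((set (p1 @ [a]) \<union> S') \<union> set (b # p2)) x (((p1 @ [a]) @ q) @ (b # p2)) y"
    by (rule hpath_append[OF _ s(2)]) (use assms s in auto)
  moreover have "(set (p1 @ [a]) \<union> S') \<union> set (b # p2) = S \<union> S'" using s(4) by blast
  ultimately show ?thesis by metis
qed

text \<open>\<open>hconn\<close> gives nothing for equal end points, so each link has to start away
  from the entry vertex \<open>x\<close>; its other end has to differ from \<open>z\<close> because
  the next piece may be the last one.\<close>

lemma hconn_chain: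
  assumes disj: "\<And>i j. i \<in> I \<Longrightarrow> j \<in> I \<Longrightarrow> i \<noteq> j \<Longrightarrow> V i \<inter> V j = {}"
    and hc: "\<And>i. i \<in> I \<Longrightarrow> hconn E (V i)"
    and link: "\<And>i j a b. i \<in> I \<Longrightarrow> j \<in> I \<Longrightarrow> i \<noteq> j \<Longrightarrow>
                 \<exists>x\<in>V i. \<exists>y\<in>V j. E x y \<and> x \<noteq> a \<and> y \<noteq> b"
  shows "distinct is \<Longrightarrow> set is \<subseteq> I \<Longrightarrow> 2 \<le> length is \<Longrightarrow> x \<in> V (hd is) \<Longrightarrow> z \<in> V (last is)
    \<Longrightarrow> \<exists>p. hpath E (\<Union>(V ` set is)) x p z"
proof (induction "is" arbitrary: x)
  case Nil
  then show ?case by simp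
next
  case (Cons i "is")
  then obtain j js where js: "is = j # js" by (cases "is") auto
  have ij: "i \<in> I" "j \<in> I" "i \<noteq> j" using Cons.prems js by auto
  obtain a b where ab: "a \<in> V i" "b \<in> V j" "E a b" "a \<noteq> x" "b \<noteq> z"
    using link[OF ij, of x z] by blast
  obtain p where p: "hpath E (V i) x p a"
    using hconnD[OF hc[OF ij(1)], of x a] Cons.prems ab by auto
  have "\<exists>q. hpath E (\<Union>(V ` set is)) b q z"
  proof (cases "js = []")
    case True
    then show ?thesis using hconnD[OF hc[OF ij(2)], of b z] Cons.prems ab js by auto
  next
    case False
    then have "2 \<le> length is" using js by (cases js) auto
    then show ?thesis using Cons.IH[of b] Cons.prems ab js by auto
  qed
  then obtain q where q: "hpath E (\<Union>(V ` set is)) b q z" by blast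
  have "V i \<inter> V k = {}" if "k \<in> set is" for k
    using disj[of i k] that Cons.prems by auto
  then have "V i \<inter> \<Union>(V ` set is) = {}" by blast
  from hpath_append[OF p q ab(3) this] show ?case by auto
qed

text \<open>\<open>link\<close> settles end points in different pieces. For end points in one piece
  \<open>V i\<close>, \<open>exit\<close> gives every vertex of the piece an edge to another piece,
  and not always to the same one. So some edge of a Hamilton path of \<open>V i\<close> has exits to
  different pieces at its two ends, and a chain through all other pieces replaces it.\<close>

lemma hconn_join:
  assumes fin: "finite I" and card: "3 \<le> card I"
    and disj: "\<And>i j. i \<in> I \<Longrightarrow> j \<in> I \<Longrightarrow> i \<noteq> j \<Longrightarrow> V i \<inter> V j = {}"
    and symE: "symp E"
    and hc: "\<And>i. i \<in> I \<Longrightarrow> hconn E (V i)"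
    and link: "\<And>i j a b. i \<in> I \<Longrightarrow> j \<in> I \<Longrightarrow> i \<noteq> j \<Longrightarrow>
                 \<exists>x\<in>V i. \<exists>y\<in>V j. E x y \<and> x \<noteq> a \<and> y \<noteq> b"
    and exit: "\<And>i. i \<in> I \<Longrightarrow> \<exists>f \<pi>.
       (\<forall>x\<in>V i. E x (f x) \<and> f x \<in> V (\<pi> x) \<and> \<pi> x \<in> I \<and> \<pi> x \<noteq> i) \<and> (\<exists>x\<in>V i. \<exists>y\<in>V i. \<pi> x \<noteq> \<pi> y)"
  shows "hconn E (\<Union>(V ` I))"
  unfolding hconn_def
proof (intro ballI impI)
  fix u v assume "u \<in> \<Union>(V ` I)" "v \<in> \<Union>(V ` I)" and uv: "u \<noteq> v"
  then obtain i j where i: "i \<in> I" "u \<in> V i" and j: "j \<in> I" "v \<in> V j" by auto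
  note chain = hconn_chain[of I V E, OF disj hc link]
  show "\<exists>p. hpath E (\<Union>(V ` I)) u p v"
  proof (cases "i = j")
    case False
    obtain js where js: "set js = I - {i, j}" "distinct js"
      using finite_distinct_list[of "I - {i, j}"] fin by blast
    have "set (i # js @ [j]) = I" using js i j by auto
    then show ?thesis
      using chain[of "i # js @ [j]" u v] js i j False by auto
  next
    case True
    obtain p where p: "hpath E (V i) u p v"
      using hconnD[OF hc[OF i(1)], of u v] i j True uv by auto
    obtain f \<pi> where f: "\<And>x. x \<in> V i \<Longrightarrow> E x (f x) \<and> f x \<in> V (\<pi> x) \<and> \<pi> x \<in> I \<and> \<pi> x \<noteq> i"
      and "\<exists>x\<in>V i. \<exists>y\<in>V i. \<pi> x \<noteq> \<pi> y" using exit[OF i(1)] by blast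
    then obtain p1 a b p2 where ab: "p = p1 @ a # b # p2" "\<pi> a \<noteq> \<pi> b"
      using exists_step[of _ p _ \<pi>] p unfolding hpath_def by metis
    have abV: "a \<in> V i" "b \<in> V i" using p ab unfolding hpath_def by auto
    obtain js where js: "set js = I - {i, \<pi> a, \<pi> b}" "distinct js"
      using finite_distinct_list[of "I - {i, \<pi> a, \<pi> b}"] fin by blast
    let ?is = "\<pi> a # js @ [\<pi> b]"
    have set: "set ?is = I - {i}" using js f[OF abV(1)] f[OF abV(2)] by auto
    obtain q where q: "hpath E (\<Union>(V ` set ?is)) (f a) q (f b)"
      using chain[of ?is "f a" "f b"] set js f[OF abV(1)] f[OF abV(2)] ab by auto
    have dis: "V i \<inter> \<Union>(V ` set ?is) = {}" unfolding set using disj i by blast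
    have "\<exists>p. hpath E (V i \<union> \<Union>(V ` set ?is)) u p v"
      by (rule hpath_insert[OF _ q _ _ dis, of u p1 a b p2 v])
        (use p ab f[OF abV(1)] f[OF abV(2)] symE in \<open>auto dest: sympD\<close>)
    moreover have "V i \<union> \<Union>(V ` set ?is) = \<Union>(V ` I)" unfolding set using i by auto
    ultimately show ?thesis by metis
  qed
qed

text \<open>Each of the two injective maps excludes at most one element of \<open>D\<close>, so a
  third element survives.\<close>

lemma avoid_two:
  assumes "3 \<le> card D" "inj_on f D" "inj_on g D"
  shows "\<exists>d\<in>D. f d \<noteq> \<alpha> \<and> g d \<noteq> \<beta>"
proof (rule ccontr)
  assume "\<not> ?thesis"
  then have D: "D = {d \<in> D. f d = \<alpha>} \<union> {d \<in> D. g d = \<beta>}" by blast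
  have fin: "finite D" using assms(1) card_ge_0_finite[of D] by linarith
  have "card {d \<in> D. f d = \<alpha>} \<le> 1" "card {d \<in> D. g d = \<beta>} \<le> 1"
    using assms(2,3) fin by (auto simp: card_le_Suc0_iff_eq inj_on_def)
  moreover have "card D = card ({d \<in> D. f d = \<alpha>} \<union> {d \<in> D. g d = \<beta>})"
    by (rule arg_cong[OF D])
  ultimately show False
    using assms(1) card_Un_le[of "{d \<in> D. f d = \<alpha>}" "{d \<in> D. g d = \<beta>}"] by linarith
qed

text \<open>The pieces form a closed sequence in which consecutive ones are joined by the injection
  \<open>f\<close>. Moving on to the next piece uses one of these edges, an excursion into it uses
  two, and both kinds of extension are recursions along the sequence.\<close>

lemma hconn_cyclic:
  fixes V :: "nat \<Rightarrow> 'v set"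
  assumes sym: "symp E" and m: "0 < m"
    and per: "\<And>i. V (i + m) = V i"
    and step: "\<And>x i. x \<in> V i \<Longrightarrow> f x \<in> V (Suc i) \<and> E x (f x)"
    and inj: "\<And>i. inj_on f (V i)"
    and disj: "\<And>i j. i < j \<Longrightarrow> j < i + m \<Longrightarrow> V i \<inter> V j = {}"
    and hcV: "\<And>i. hconn E (V i)"
    and cardV: "\<And>i. 3 \<le> card (V i)"
  shows "hconn E (\<Union>(range V))"
proof -
  have per': "V (i + k * m) = V i" for i k
  proof (induction k)
    case (Suc k)
    have "V (i + Suc k * m) = V ((i + k * m) + m)" by (simp add: ac_simps)
    then show ?case using per Suc by simp
  qed simp
  have disjU: "V i \<inter> \<Union>(V ` {Suc i..i + j}) = {}" if "j < m" for i j
  proof -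
    have "V i \<inter> V k = {}" if "k \<in> {Suc i..i + j}" for k
      using disj[of i k] that \<open>j < m\<close> by simp
    then show ?thesis by blast
  qed
  \<comment> \<open>Both ends lie in \<open>V i\<close>: the first edge \<open>u\<close>,
    \<open>b\<close> of a path of \<open>V i\<close> is replaced by an excursion from
    \<open>f u\<close> to \<open>f b\<close> through the following pieces, which exists by
    recursion.\<close>
  have absorb: "\<exists>p. hpath E (\<Union>(V ` {i..i + j})) u p v"
    if "j < m" "u \<in> V i" "v \<in> V i" "u \<noteq> v" for i j u v
    using that
  proof (induction j arbitrary: i u v)
    case 0
    then show ?case using hconnD[OF hcV] by auto
  next
    case (Suc j)
    obtain p where p: "hpath E (V i) u p v" using hconnD[OF hcV] Suc.prems by blast
    then obtain b p2 where p2: "p = [] @ u # b # p2"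
      using Suc.prems unfolding hpath_def by (cases p; cases "tl p") auto
    then have ub: "u \<in> V i" "b \<in> V i" "u \<noteq> b" using p unfolding hpath_def by auto
    have "f u \<noteq> f b" using inj_onD[OF inj, of u b] ub by blast
    then obtain q where q: "hpath E (\<Union>(V ` {Suc i..Suc i + j})) (f u) q (f b)"
      using Suc.IH[of "f u" "Suc i" "f b"] Suc.prems ub step by auto
    have "\<exists>p. hpath E (V i \<union> \<Union>(V ` {Suc i..Suc i + j})) u p v"
      by (rule hpath_insert[of _ "V i" u "[]" u b p2 v, OF _ q])
        (use p p2 step[OF ub(1)] step[OF ub(2)] sympD[OF sym] disjU[of "Suc j" i] Suc.prems in auto)
    moreover have "V i \<union> \<Union>(V ` {Suc i..Suc i + j}) = \<Union>(V ` {i..i + Suc j})"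
    proof -
      have "{i..i + Suc j} = insert i {Suc i..Suc i + j}" by auto
      then show ?thesis by simp
    qed
    ultimately show ?case by simp
  qed
  \<comment> \<open>The target lies \<open>d\<close> pieces ahead, while all pieces up to
    \<open>i + e\<close> have to be used. The path moves forward to the piece of the target, where
    \<open>absorb\<close> collects the \<open>e - d\<close> pieces that follow.\<close>
  have across: "\<exists>p. hpath E (\<Union>(V ` {i..i + e})) u p v"
    if "0 < d" "d \<le> e" "e < m" "u \<in> V i" "v \<in> V (i + d)" for d e i u v
    using that
  proof (induction d arbitrary: e i u)
    case (Suc d)
    have disj': "V i \<inter> \<Union>(V ` {Suc i..Suc i + (e - 1)}) = {}"
      using disjU[of e i] Suc.prems by simp
    have un: "V i \<union> \<Union>(V ` {Suc i..Suc i + (e - 1)}) = \<Union>(V ` {i..i + e})"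
    proof -
      have "{i..i + e} = insert i {Suc i..Suc i + (e - 1)}" using Suc.prems by auto
      then show ?thesis by simp
    qed
    obtain a where a: "a \<in> V i" "a \<noteq> u" "f a \<noteq> v"
      using avoid_two[of "V i" "\<lambda>x. x" f u v] cardV[of i] inj[of i] by (auto simp: inj_on_def)
    obtain p where p: "hpath E (V i) u p a" using hconnD[OF hcV] a Suc.prems by blast
    have "\<exists>q. hpath E (\<Union>(V ` {Suc i..Suc i + (e - 1)})) (f a) q v"
    proof (cases "d = 0")
      case True
      then show ?thesis
        using absorb[of "e - 1" "f a" "Suc i" v] step[OF a(1)] a Suc.prems by simp
    next
      case False
      then show ?thesis
        using Suc.IH[of "e - 1" "f a" "Suc i"] step[OF a(1)] Suc.prems by simp
    qed
    then obtain q where q: "hpath E (\<Union>(V ` {Suc i..Suc i + (e - 1)})) (f a) q v" by blast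
    have "E a (f a)" using step[OF a(1)] by blast
    from hpath_append[OF p q this disj'] show ?case unfolding un by blast
  qed simp
  have all: "\<Union>(V ` {i..i + (m - 1)}) = \<Union>(range V)" for i
  proof
    show "\<Union>(range V) \<subseteq> \<Union>(V ` {i..i + (m - 1)})"
    proof
      fix x assume "x \<in> \<Union>(range V)"
      then obtain n where n: "x \<in> V n" by auto
      \<comment> \<open>\<open>l\<close> is n - i modulo \<open>m\<close>; adding
        \<open>i * (m - 1)\<close> replaces the subtraction of \<open>i\<close>.\<close>
      define l where "l = (n + i * (m - 1)) mod m"
      have "l < m" using m by (simp add: l_def)
      have "(i + l) mod m = n mod m"
      proof -
        have "(i + l) mod m = (i + (n + i * (m - 1))) mod m" by (simp add: l_def mod_simps)
        also have "i + (n + i * (m - 1)) = n + i * m"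
          using m by (cases m) auto
        finally show ?thesis by simp
      qed
      moreover have "V a = V (a mod m)" for a using per'[of "a mod m" "a div m"] by simp
      ultimately have "V n = V (i + l)" by metis
      moreover have "i + l \<in> {i..i + (m - 1)}" using \<open>l < m\<close> by simp
      ultimately show "x \<in> \<Union>(V ` {i..i + (m - 1)})" using n by blast
    qed
  qed auto
  show ?thesis
    unfolding hconn_def
  proof (intro ballI impI)
    fix u v assume u: "u \<in> \<Union>(range V)" and v: "v \<in> \<Union>(range V)" and uv: "u \<noteq> v"
    have m1: "m - 1 < m" using m by simp
    from u obtain i where i: "u \<in> V i" by auto
    have "v \<in> \<Union>(V ` {i..i + (m - 1)})" using v all[of i] by blast
    then obtain d where d: "v \<in> V (i + d)" "d \<le> m - 1" by (auto dest!: le_Suc_ex)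
    have "\<exists>p. hpath E (\<Union>(V ` {i..i + (m - 1)})) u p v"
    proof (cases "d = 0")
      case True
      then show ?thesis using absorb[OF m1 i _ uv] d by simp
    next
      case False
      then show ?thesis using across[of d "m - 1" u i v] i d m1 by simp
    qed
    then show "\<exists>p. hpath E (\<Union>(range V)) u p v" unfolding all .
  qed
qed

section \<open>Products of cycles\<close>

text \<open>Adjacency in the Cartesian product of two graphs.\<close>

definition prodrel :: "('a \<Rightarrow> 'a \<Rightarrow> bool) \<Rightarrow> ('b \<Rightarrow> 'b \<Rightarrow> bool) \<Rightarrow> 'a \<times> 'b \<Rightarrow> 'a \<times> 'b \<Rightarrow> bool" where
  "prodrel A B u v \<longleftrightarrow>
     snd u = snd v \<and> A (fst u) (fst v) \<or> fst u = fst v \<and> B (snd u) (snd v)"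

text \<open>The cycle on \<open>{..<m}\<close>, which degenerates to an edge for
  \<open>m = 2\<close>.\<close>

definition cadj :: "nat \<Rightarrow> nat \<Rightarrow> nat \<Rightarrow> bool" where
  "cadj m i j \<longleftrightarrow> j = Suc i mod m \<or> i = Suc j mod m"

lemma symp_cadj: "symp (cadj m)"
  by (auto simp: symp_def cadj_def)

lemma hpath_map_line:
  assumes "hpath A S a p b"
  shows "hpath (prodrel A B) (S \<times> {y}) (a, y) (map (\<lambda>x. (x, y)) p) (b, y)"
proof -
  have "(\<lambda>x. (x, y)) ` S = S \<times> {y}" by auto
  then show ?thesis
    using hpath_image[OF assms, of "\<lambda>x. (x, y)" "prodrel A B"]
    by (auto simp: inj_on_def prodrel_def)
qed

text \<open>Boustrophedon: every step along \<open>q\<close> reverses the direction of travel along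
  \<open>p\<close>, so the parity of the number of rows decides on which side the path ends.\<close>

lemma snake:
  assumes "symp A" "hpath A S a p b" "hpath B S' c q d"
  shows "\<exists>r. hpath (prodrel A B) (S \<times> S') (a, c) r (if even (length q) then a else b, d)"
  using assms(2,3)
proof (induction q arbitrary: a b c p S')
  case Nil
  then show ?case by (simp add: hpath_def)
next
  case (Cons y q)
  have y: "y = c" using Cons.prems(2) by (simp add: hpath_def)
  note line = hpath_map_line[OF Cons.prems(1), of B y]
  show ?case
  proof (cases "q = []")
    case True
    then have "S' = {y}" "d = y" using Cons.prems(2) by (auto simp: hpath_def)
    then show ?thesis using line y True by auto
  next
    case False
    note s = hpath_split[of B S' c "[y]" q d, simplified, OF Cons.prems(2) False]
    obtain r where r: "hpath (prodrel A B) (S \<times> set q) (b, hd q) r (if even (length q) then b else a, d)"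
      using Cons.IH[OF hpath_rev[OF assms(1) Cons.prems(1)] s(2)] by blast
    have "hpath (prodrel A B) (S \<times> {y} \<union> S \<times> set q) (a, y)
        (map (\<lambda>x. (x, y)) p @ r) (if even (length q) then b else a, d)"
      by (rule hpath_append[OF line r]) (use s in \<open>auto simp: prodrel_def\<close>)
    moreover have "S \<times> {y} \<union> S \<times> set q = S \<times> S'" using s by auto
    ultimately show ?thesis using y by auto
  qed
qed

lemma snake_swap:
  assumes "symp B" "hpath A S a p b" "hpath B S' c q d"
  shows "\<exists>r. hpath (prodrel A B) (S \<times> S') (a, c) r (b, if even (length p) then c else d)"
proof -
  obtain r where r: "hpath (prodrel B A) (S' \<times> S) (c, a) r (if even (length p) then c else d, b)"
    using snake[OF assms(1,3,2)] by blast
  have "(\<lambda>(x, y). (y, x)) ` (S' \<times> S) = S \<times> S'" by auto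
  moreover have "hpath (prodrel A B) ((\<lambda>(x, y). (y, x)) ` (S' \<times> S)) ((\<lambda>(x, y). (y, x)) (c, a))
      (map (\<lambda>(x, y). (y, x)) r) ((\<lambda>(x, y). (y, x)) (if even (length p) then c else d, b))"
    by (rule hpath_image[OF r]) (auto simp: inj_on_def prodrel_def)
  ultimately show ?thesis by auto
qed

lemma hpath_upt: "a < b \<Longrightarrow> b \<le> m \<Longrightarrow> hpath (cadj m) {a..<b} a [a..<b] (b - 1)"
  by (auto simp: hpath_def successively_conv_nth cadj_def)

lemma hpath_upt_rev: "a < b \<Longrightarrow> b \<le> m \<Longrightarrow> hpath (cadj m) {a..<b} (b - 1) (rev [a..<b]) a"
  using hpath_rev[OF symp_cadj hpath_upt] .

abbreviation tadj :: "nat \<Rightarrow> nat \<times> nat \<Rightarrow> nat \<times> nat \<Rightarrow> bool" where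
  "tadj m \<equiv> prodrel (cadj m) (cadj m)"

text \<open>The rows \<open>0, m - 1, ..., j + 1\<close> form a path because \<open>0\<close> and
  \<open>m - 1\<close> are adjacent. In these rows the columns below \<open>i\<close> are traversed
  vertically; there is an odd number of them, so this ends in row \<open>j + 1\<close>. The columns
  from \<open>i\<close> on are traversed horizontally; the number \<open>m - j\<close> of rows is
  even, so this returns to column \<open>i\<close>, in row \<open>0\<close>. The rows
  \<open>1, ..., j\<close> follow along full copies of \<open>line\<close>.\<close>

lemma torus_aux:
  assumes i: "odd i" "i < m" and j: "j < m" "even (m - j)"
    and line: "hpath (cadj m) {..<m} i l b"
  shows "\<exists>p. hpath (tadj m) ({..<m} \<times> {..<m}) (0, 0) p (if even j then i else b, j)"
proof -
  have j2: "Suc j < m" using j by (cases "Suc j = m") auto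
  let ?R = "insert 0 {Suc j..<m}"
  have rows: "hpath (cadj m) ?R 0 ([0] @ rev [Suc j..<m]) (Suc j)"
  proof -
    have "hpath (cadj m) ({0} \<union> {Suc j..<m}) 0 ([0] @ rev [Suc j..<m]) (Suc j)"
      by (rule hpath_append[OF hpath_single hpath_upt_rev]) (use j2 in \<open>auto simp: cadj_def\<close>)
    then show ?thesis by simp
  qed
  have len: "even (length ([0] @ rev [Suc j..<m]))" using j j2 by simp
  have cols: "hpath (cadj m) {0..<i} 0 [0..<i] (i - 1)" using hpath_upt[of 0 i m] i by (auto elim: oddE)
  obtain r1 where r1: "hpath (tadj m) ({0..<i} \<times> ?R) (0, 0) r1 (i - 1, Suc j)"
    using snake_swap[OF symp_cadj cols rows] i by auto
  have cols2: "hpath (cadj m) {i..<m} i [i..<m] (m - 1)" using hpath_upt[of i m m] i by auto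
  have len2: "even (length (rev ([0] @ rev [Suc j..<m])))" using len by simp
  obtain r2 where r2: "hpath (tadj m) ({i..<m} \<times> ?R) (i, Suc j) r2 (i, 0)"
    using snake[OF symp_cadj cols2 hpath_rev[OF symp_cadj rows]] len2 by (auto simp del: rev_append)
  have "hpath (tadj m) (({0..<i} \<times> ?R) \<union> ({i..<m} \<times> ?R)) (0, 0) (r1 @ r2) (i, 0)"
    by (rule hpath_append[OF r1 r2]) (use i in \<open>auto simp: prodrel_def cadj_def elim!: oddE\<close>)
  moreover have "({0..<i} \<times> ?R) \<union> ({i..<m} \<times> ?R) = {..<m} \<times> ?R" using i by auto
  ultimately have r12: "hpath (tadj m) ({..<m} \<times> ?R) (0, 0) (r1 @ r2) (i, 0)" by simp
  show ?thesis
  proof (cases "j = 0")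
    case True
    then have "?R = {..<m}" using j by auto
    then show ?thesis using r12 True by auto
  next
    case False
    have up: "hpath (cadj m) {1..<Suc j} 1 [1..<Suc j] j" using hpath_upt[of 1 "Suc j" m] False j by auto
    have len3: "length [1..<Suc j] = j" by simp
    obtain r3 where r3: "hpath (tadj m) ({..<m} \<times> {1..<Suc j}) (i, 1) r3 (if even j then i else b, j)"
      using snake[OF symp_cadj line up] unfolding len3 by blast
    have "hpath (tadj m) (({..<m} \<times> ?R) \<union> ({..<m} \<times> {1..<Suc j})) (0, 0) ((r1 @ r2) @ r3)
        (if even j then i else b, j)"
      by (rule hpath_append[OF r12 r3]) (use j2 in \<open>auto simp: prodrel_def cadj_def\<close>)
    moreover have "({..<m} \<times> ?R) \<union> ({..<m} \<times> {1..<Suc j}) = {..<m} \<times> {..<m}" using j by auto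
    ultimately show ?thesis by metis
  qed
qed

text \<open>From \<open>i\<close> down to \<open>0\<close>, across to \<open>m - 1\<close> and down
  to \<open>i + 1\<close>.\<close>

lemma line_down: "i < m \<Longrightarrow> \<exists>l. hpath (cadj m) {..<m} i l (Suc i mod m)"
proof (cases "Suc i = m")
  case True
  then show ?thesis using hpath_upt_rev[of 0 m m] by (auto simp: lessThan_atLeast0)
next
  case False
  assume "i < m"
  then have "hpath (cadj m) ({0..<Suc i} \<union> {Suc i..<m}) i (rev [0..<Suc i] @ rev [Suc i..<m]) (Suc i)"
    using hpath_append[OF hpath_upt_rev[of 0 "Suc i" m] hpath_upt_rev[of "Suc i" m m]]
    False by (auto simp: cadj_def simp del: upt_Suc)
  moreover have "{0..<Suc i} \<union> {Suc i..<m} = {..<m}" using \<open>i < m\<close> by auto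
  ultimately show ?thesis using False \<open>i < m\<close> by auto
qed

lemma line_up: "0 < i \<Longrightarrow> i < m \<Longrightarrow> \<exists>l. hpath (cadj m) {..<m} i l (i - 1)"
proof -
  assume "0 < i" "i < m"
  then obtain l where "hpath (cadj m) {..<m} (i - 1) l i" using line_down[of "i - 1" m]
    by (cases i) auto
  then show ?thesis using hpath_rev[OF symp_cadj] by blast
qed

lemma hpath_tadj_swap:
  assumes "\<exists>p. hpath (tadj m) ({..<m} \<times> {..<m}) (0, 0) p (j, i)"
  shows "\<exists>p. hpath (tadj m) ({..<m} \<times> {..<m}) (0, 0) p (i, j)"
proof -
  obtain p where p: "hpath (tadj m) ({..<m} \<times> {..<m}) (0, 0) p (j, i)" using assms by blast
  have "(\<lambda>(x, y). (y, x)) ` ({..<m} \<times> {..<m}) = {..<m} \<times> {..<m}" by auto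
  moreover have "hpath (tadj m) ((\<lambda>(x, y). (y, x)) ` ({..<m} \<times> {..<m})) ((\<lambda>(x, y). (y, x)) (0, 0))
      (map (\<lambda>(x, y). (y, x)) p) ((\<lambda>(x, y). (y, x)) (j, i))"
    by (rule hpath_image[OF p]) (auto simp: inj_on_def prodrel_def)
  ultimately show ?thesis by auto
qed

text \<open>An odd sum makes one coordinate odd and the other even. Up to exchanging the factors
  \<open>i\<close> is the odd one, and then \<open>m - j\<close> is even as \<open>torus_aux\<close>
  requires.\<close>

lemma hpath_torus_even:
  assumes "even m" "i < m" "j < m" "odd (i + j)"
  shows "\<exists>p. hpath (tadj m) ({..<m} \<times> {..<m}) (0, 0) p (i, j)"
proof (cases "even j")
  case True
  obtain l where "hpath (cadj m) {..<m} i l (Suc i mod m)" using line_down assms(2) by blast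
  then show ?thesis using torus_aux[of i m j] assms True by auto
next
  case False
  obtain l where "hpath (cadj m) {..<m} j l (Suc j mod m)" using line_down assms(3) by blast
  then have "\<exists>p. hpath (tadj m) ({..<m} \<times> {..<m}) (0, 0) p (j, i)"
    using torus_aux[of j m i] assms False by auto
  then show ?thesis by (rule hpath_tadj_swap)
qed

text \<open>The reflection of the cycle that fixes \<open>0\<close>, applied if \<open>b\<close>
  holds. For odd \<open>m\<close> it changes the parity of every nonzero index.\<close>

definition flip :: "bool \<Rightarrow> nat \<Rightarrow> nat \<Rightarrow> nat" where
  "flip b m i = (if b \<and> i \<noteq> 0 then m - i else i)"

lemma flip_props:
  assumes "i < m"
  shows "flip b m i < m" "flip b m (flip b m i) = i" "flip b m 0 = 0"
  using assms by (auto simp: flip_def)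

lemma cadj_iff:
  assumes "i < m" "j < m"
  shows "cadj m i j \<longleftrightarrow>
    j = Suc i \<or> i = Suc j \<or> Suc i = m \<and> j = 0 \<or> Suc j = m \<and> i = 0"
proof -
  have "Suc i mod m = (if Suc i = m then 0 else Suc i)" "Suc j mod m = (if Suc j = m then 0 else Suc j)"
    using assms by auto
  then show ?thesis using assms by (auto simp: cadj_def)
qed

lemma cadj_flip:
  assumes "i < m" "j < m" "cadj m i j"
  shows "cadj m (flip b m i) (flip b m j)"
  using assms by (auto simp: flip_def cadj_iff)

lemma hpath_tadj_flip:
  assumes "\<exists>p. hpath (tadj m) ({..<m} \<times> {..<m}) (0, 0) p (flip b m i, flip c m j)" "i < m" "j < m"
  shows "\<exists>p. hpath (tadj m) ({..<m} \<times> {..<m}) (0, 0) p (i, j)"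
proof -
  obtain p where p: "hpath (tadj m) ({..<m} \<times> {..<m}) (0, 0) p (flip b m i, flip c m j)" using assms by blast
  define f where "f = (\<lambda>z. (flip b m (fst z), flip c m (snd z)))"
  have ff: "f (f z) = z" "f z \<in> {..<m} \<times> {..<m}" if "z \<in> {..<m} \<times> {..<m}" for z
    using that by (auto simp: flip_props f_def)
  have inj: "inj_on f ({..<m} \<times> {..<m})" by (rule inj_on_inverseI[of _ f]) (use ff in blast)
  have im: "f ` ({..<m} \<times> {..<m}) = {..<m} \<times> {..<m}"
  proof
    show "f ` ({..<m} \<times> {..<m}) \<subseteq> {..<m} \<times> {..<m}" using ff(2) by blast
    show "{..<m} \<times> {..<m} \<subseteq> f ` ({..<m} \<times> {..<m})"
    proof
      fix z assume "z \<in> {..<m} \<times> {..<m}"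
      then show "z \<in> f ` ({..<m} \<times> {..<m})" using ff by (intro image_eqI[of z f "f z"]) auto
    qed
  qed
  have "hpath (tadj m) (f ` ({..<m} \<times> {..<m})) (f (0, 0)) (map f p) (f (flip b m i, flip c m j))"
    by (rule hpath_image[OF p inj]) (auto simp: prodrel_def cadj_flip f_def)
  then show ?thesis unfolding im using assms(2,3) by (auto simp: flip_props f_def)
qed

text \<open>An odd cycle imposes no parity condition: reflections bring the target to odd
  \<open>j\<close> and even \<open>i\<close>, and exchanging the factors covers
  \<open>j = 0\<close>.\<close>

lemma hpath_torus_odd:
  assumes m: "odd m" and ij: "i < m" "j < m" "(i, j) \<noteq> (0, 0)"
  shows "\<exists>p. hpath (tadj m) ({..<m} \<times> {..<m}) (0, 0) p (i, j)"
proof -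
  \<comment> \<open>For odd \<open>j\<close> the path of \<open>torus_aux\<close> ends at the far
    end of \<open>line\<close>, which therefore has to run from an odd column to \<open>i\<close>:
    from \<open>i + 1\<close>, or from \<open>i - 1\<close> if \<open>i\<close> is the last
    column.\<close>
  have base: "\<exists>p. hpath (tadj m) ({..<m} \<times> {..<m}) (0, 0) p (i, j)"
    if "odd j" "even i" "i < m" "j < m" for i j
  proof (cases "Suc i < m")
    case True
    then obtain l where "hpath (cadj m) {..<m} (Suc i) l i" using line_up[of "Suc i" m] by auto
    then show ?thesis using torus_aux[of "Suc i" m j l i] that m True by simp
  next
    case False
    then have i: "Suc i = m" "m > 1" using that m by (auto elim: oddE)
    have "Suc (i - 1) mod m = i" using i that by auto
    then obtain l where "hpath (cadj m) {..<m} (i - 1) l i" using line_down[of "i - 1" m] that i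
      by (cases i) auto
    then show ?thesis using torus_aux[of "i - 1" m j l i] i that m by simp
  qed
  have main: "\<exists>p. hpath (tadj m) ({..<m} \<times> {..<m}) (0, 0) p (i, j)"
    if "j \<noteq> 0" "i < m" "j < m" for i j
  proof (rule hpath_tadj_flip[of m "odd i" i "even j" j])
    show "\<exists>p. hpath (tadj m) ({..<m} \<times> {..<m}) (0, 0) p (flip (odd i) m i, flip (even j) m j)"
      by (rule base) (use that m in \<open>auto simp: flip_def\<close>)
  qed (use that in auto)
  show ?thesis
  proof (cases "j = 0")
    case True
    then show ?thesis using ij by (intro hpath_tadj_swap[OF main]) auto
  qed (use main ij in auto)
qed

section \<open>Cayley graphs and cosets\<close>

definition (in group) cayley :: "'a set \<Rightarrow> 'a \<Rightarrow> 'a \<Rightarrow> bool" where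
  "cayley S x y \<longleftrightarrow> x \<in> carrier G \<and> y \<in> carrier G \<and> (\<exists>s\<in>S. y = s \<otimes> x)"

context group
begin

lemma symp_cayley:
  assumes "S \<subseteq> carrier G" "\<And>s. s \<in> S \<Longrightarrow> inv s \<in> S"
  shows "symp (cayley S)"
proof (rule sympI)
  fix x y assume "cayley S x y"
  then obtain s where s: "s \<in> S" "y = s \<otimes> x" "x \<in> carrier G" "y \<in> carrier G" by (auto simp: cayley_def)
  then have "x = inv s \<otimes> y" using assms(1) by (metis inv_solve_left subsetD)
  then show "cayley S y x" using s assms(2) by (auto simp: cayley_def)
qed

text \<open>The generators act on the left, so right translations preserve adjacency.\<close>

lemma hconn_rcoset:
  assumes "hconn (cayley S) K" "K \<subseteq> carrier G" "g \<in> carrier G" "S \<subseteq> carrier G"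
  shows "hconn (cayley S) (K #> g)"
proof -
  have "hconn (cayley S) ((\<lambda>x. x \<otimes> g) ` K)"
    using assms by (intro hconn_image[OF assms(1)])
      (auto simp: inj_on_def cayley_def subset_iff m_assoc)
  moreover have "(\<lambda>x. x \<otimes> g) ` K = K #> g" by (auto simp: r_coset_def)
  ultimately show ?thesis by simp
qed

lemma mem_rcoset_iff:
  assumes "subgroup K G" "a \<in> carrier G" "b \<in> carrier G"
  shows "b \<in> K #> a \<longleftrightarrow> b \<otimes> inv a \<in> K"
proof
  assume "b \<in> K #> a"
  then obtain k where k: "k \<in> K" "b = k \<otimes> a" by (auto simp: r_coset_def)
  then have "b \<otimes> inv a = k" using assms subgroup.mem_carrier[OF assms(1)] by (simp add: m_assoc)
  then show "b \<otimes> inv a \<in> K" using k by simp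
next
  assume "b \<otimes> inv a \<in> K"
  moreover have "b = (b \<otimes> inv a) \<otimes> a" using assms by (simp add: m_assoc)
  ultimately show "b \<in> K #> a" unfolding r_coset_def by blast
qed

lemma rcoset_eq_iff:
  assumes "subgroup K G" "a \<in> carrier G" "b \<in> carrier G"
  shows "K #> a = K #> b \<longleftrightarrow> b \<otimes> inv a \<in> K"
  using assms mem_rcoset_iff[OF assms] repr_independence[of b K a] rcos_self[of b K] by blast

text \<open>\<open>cover\<close> says that L - K lies in K s K, so any two cosets are joined by an
  edge with label \<open>s\<close>. An element \<open>d\<close> with s d s^-1 in \<open>K\<close>
  moves this edge to a parallel one between the same cosets; the three elements of \<open>D\<close>
  allow one forbidden vertex on each side to be avoided. \<open>k0\<close> shows that
  \<open>s\<close> does not send a whole coset into a single one.\<close>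

lemma hconn_coset_join:
  assumes fin: "finite (carrier G)"
    and S: "S \<subseteq> carrier G" "\<And>s. s \<in> S \<Longrightarrow> inv s \<in> S"
    and K: "subgroup K G" and L: "subgroup L G" and KL: "K \<subseteq> L"
    and s: "s \<in> S" "s \<in> L"
    and cover: "\<And>g. g \<in> L \<Longrightarrow> g \<notin> K \<Longrightarrow> \<exists>k\<in>K. s \<otimes> k \<otimes> inv g \<in> K"
    and D: "D \<subseteq> K" "3 \<le> card D" "\<And>d. d \<in> D \<Longrightarrow> s \<otimes> d \<otimes> inv s \<in> K"
    and k0: "k0 \<in> K" "s \<otimes> k0 \<otimes> inv s \<notin> K"
    and hc: "hconn (cayley S) K"
  shows "hconn (cayley S) L"
proof -
  note Kc = subgroup.mem_carrier[OF K] and Lc = subgroup.mem_carrier[OF L]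
  note sc = Lc[OF s(2)]
  let ?I = "(\<lambda>a. K #> a) ` L"
  have sK: "s \<notin> K" using k0 subgroup.m_closed[OF K] subgroup.m_inv_closed[OF K] by blast
  have Un: "\<Union>?I = L"
  proof
    show "\<Union>?I \<subseteq> L" using KL subgroup.m_closed[OF L] by (auto simp: r_coset_def)
    show "L \<subseteq> \<Union>?I" using rcos_self[OF _ K] Lc by blast
  qed
  have "hconn (cayley S) (\<Union>(id ` ?I))"
  proof (rule hconn_join)
    show "finite ?I" using fin finite_subset[of L "carrier G"] Lc by blast
    have k0c: "k0 \<in> carrier G" using Kc k0 by blast
    have ne: "K #> \<one> \<noteq> K #> s" "K #> \<one> \<noteq> K #> (s \<otimes> k0)" "K #> s \<noteq> K #> (s \<otimes> k0)"
    proof -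
      show "K #> \<one> \<noteq> K #> s" using rcoset_eq_iff[OF K, of \<one> s] sc sK by simp
      show "K #> s \<noteq> K #> (s \<otimes> k0)" using rcoset_eq_iff[OF K, of s "s \<otimes> k0"] sc k0c k0 by simp
      show "K #> \<one> \<noteq> K #> (s \<otimes> k0)"
      proof
        assume "K #> \<one> = K #> (s \<otimes> k0)"
        then have "s \<otimes> k0 \<in> K" using rcoset_eq_iff[OF K, of \<one> "s \<otimes> k0"] sc k0c by simp
        then have "(s \<otimes> k0) \<otimes> inv k0 \<in> K" using k0 subgroup.m_closed[OF K] subgroup.m_inv_closed[OF K] by blast
        then show False using sK sc k0c by (simp add: m_assoc)
      qed
    qed
    have "\<one> \<in> L" "s \<in> L" "s \<otimes> k0 \<in> L"
      using subgroup.one_closed[OF L] s subgroup.m_closed[OF L] k0 KL by auto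
    then have "{K #> \<one>, K #> s, K #> (s \<otimes> k0)} \<subseteq> ?I" by blast
    moreover have "card {K #> \<one>, K #> s, K #> (s \<otimes> k0)} = 3" using ne by simp
    ultimately show "3 \<le> card ?I" using card_mono[OF \<open>finite ?I\<close>] by metis
    show "symp (cayley S)" using symp_cayley[OF S] .
  next
    fix i j assume "i \<in> ?I" "j \<in> ?I" "i \<noteq> j"
    then obtain a b where ab: "a \<in> L" "b \<in> L" "i = K #> a" "j = K #> b" by blast
    have "z \<notin> K #> a" if "z \<in> K #> b" for z
    proof
      assume "z \<in> K #> a"
      then have "K #> a = K #> z" "K #> b = K #> z"
        using repr_independence[OF _ Lc[OF ab(1)] K] repr_independence[OF that Lc[OF ab(2)] K] by simp_all
      then show False using \<open>i \<noteq> j\<close> ab by simp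
    qed
    then show "id i \<inter> id j = {}" using ab by auto
  next
    fix i assume "i \<in> ?I"
    then show "hconn (cayley S) (id i)"
      using hconn_rcoset[OF hc _ _ S(1)] Kc Lc by auto
  next
    fix i j \<alpha> \<beta> assume "i \<in> ?I" "j \<in> ?I" "i \<noteq> j"
    then obtain a b where ab: "a \<in> L" "b \<in> L" "i = K #> a" "j = K #> b" by blast
    note abc = Lc[OF ab(1)] Lc[OF ab(2)]
    let ?g = "b \<otimes> inv a"
    have gc: "?g \<in> carrier G" using abc by simp
    have "?g \<in> L" using ab subgroup.m_closed[OF L] subgroup.m_inv_closed[OF L] by blast
    moreover have "?g \<notin> K" using rcoset_eq_iff[OF K abc] ab \<open>i \<noteq> j\<close> by simp
    ultimately obtain k where k: "k \<in> K" "s \<otimes> k \<otimes> inv ?g \<in> K" using cover by blast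
    note kc = Kc[OF k(1)]
    \<comment> \<open>With g = b a^-1 the edge ends in s d k a = (s d s^-1) (s k g^-1) b, and both
      brackets lie in \<open>K\<close>.\<close>
    have link: "d \<otimes> k \<otimes> a \<in> K #> a \<and> s \<otimes> (d \<otimes> k \<otimes> a) \<in> K #> b
        \<and> cayley S (d \<otimes> k \<otimes> a) (s \<otimes> (d \<otimes> k \<otimes> a))" if d: "d \<in> D" for d
    proof -
      have dc: "d \<in> carrier G" using d D Kc by blast
      have g: "inv ?g = a \<otimes> inv b" using abc by (simp add: inv_mult_group)
      have 1: "s \<otimes> k \<otimes> inv ?g \<otimes> b = s \<otimes> (k \<otimes> a)"
        unfolding g using sc kc abc by (simp add: m_assoc)
      have 2: "inv s \<otimes> (s \<otimes> (k \<otimes> a)) = k \<otimes> a"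
        using sc kc abc by (simp add: m_assoc[symmetric])
      have "(s \<otimes> d \<otimes> inv s) \<otimes> (s \<otimes> k \<otimes> inv ?g) \<otimes> b = s \<otimes> d \<otimes> (inv s \<otimes> (s \<otimes> k \<otimes> inv ?g \<otimes> b))"
        using dc kc sc abc gc by (simp add: m_assoc)
      then have "s \<otimes> (d \<otimes> k \<otimes> a) = (s \<otimes> d \<otimes> inv s) \<otimes> (s \<otimes> k \<otimes> inv ?g) \<otimes> b"
        unfolding 1 2 using dc kc sc abc by (simp add: m_assoc)
      moreover have "(s \<otimes> d \<otimes> inv s) \<otimes> (s \<otimes> k \<otimes> inv ?g) \<in> K"
        using D(3)[OF d] k subgroup.m_closed[OF K] by blast
      moreover have "d \<otimes> k \<in> K" using d D k subgroup.m_closed[OF K] by blast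
      moreover have "cayley S (d \<otimes> k \<otimes> a) (s \<otimes> (d \<otimes> k \<otimes> a))"
        using s(1) dc kc sc abc by (auto simp: cayley_def)
      ultimately show ?thesis unfolding r_coset_def by blast
    qed
    have "inj_on (\<lambda>d. d \<otimes> k \<otimes> a) D" "inj_on (\<lambda>d. s \<otimes> (d \<otimes> k \<otimes> a)) D"
      using D(1) Kc kc abc sc by (auto simp: inj_on_def subset_iff)
    from avoid_two[OF D(2) this] obtain d where
      "d \<in> D" "d \<otimes> k \<otimes> a \<noteq> \<alpha>" "s \<otimes> (d \<otimes> k \<otimes> a) \<noteq> \<beta>" by blast
    then show "\<exists>x\<in>id i. \<exists>y\<in>id j. cayley S x y \<and> x \<noteq> \<alpha> \<and> y \<noteq> \<beta>"
      using link ab by auto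
  next
    fix i assume "i \<in> ?I"
    then obtain a where a: "a \<in> L" "i = K #> a" by blast
    note ac = Lc[OF a(1)] and k0c = Kc[OF k0(1)]
    let ?\<pi> = "\<lambda>x. K #> (s \<otimes> x)"
    have iL: "i \<subseteq> L" using Un a by blast
    have A: "cayley S x (s \<otimes> x) \<and> s \<otimes> x \<in> id (?\<pi> x) \<and> ?\<pi> x \<in> ?I \<and> ?\<pi> x \<noteq> i" if "x \<in> id i" for x
    proof -
      have x: "x \<in> L" "x \<in> K #> a" using that iL a by auto
      note xc = Lc[OF x(1)]
      have i: "i = K #> x" using a(2) repr_independence[OF x(2) ac K] by simp
      have "K #> x \<noteq> K #> (s \<otimes> x)"
        using rcoset_eq_iff[OF K, of x "s \<otimes> x"] xc sc sK by (simp add: m_assoc)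
      moreover have "s \<otimes> x \<in> K #> (s \<otimes> x)" using rcos_self[OF _ K, of "s \<otimes> x"] xc sc by simp
      moreover have "s \<otimes> x \<in> L" using subgroup.m_closed[OF L s(2) x(1)] .
      moreover have "cayley S x (s \<otimes> x)" using xc sc s(1) by (auto simp: cayley_def)
      ultimately show ?thesis using i by simp
    qed
    have B: "a \<in> id i" "k0 \<otimes> a \<in> id i"
      using a rcos_self[OF ac K] k0 by (auto simp: r_coset_def)
    \<comment> \<open>The two exits have the quotient s k0 s^-1, which is outside
      \<open>K\<close>.\<close>
    have C: "?\<pi> a \<noteq> ?\<pi> (k0 \<otimes> a)"
    proof -
      have "s \<otimes> (k0 \<otimes> a) \<otimes> inv (s \<otimes> a) = s \<otimes> k0 \<otimes> inv s"
      proof -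
        have "a \<otimes> (inv a \<otimes> inv s) = inv s" using ac sc by (simp add: m_assoc[symmetric])
        then show ?thesis using ac k0c sc by (simp add: inv_mult_group m_assoc)
      qed
      then show ?thesis
        using rcoset_eq_iff[OF K, of "s \<otimes> a" "s \<otimes> (k0 \<otimes> a)"] ac k0c sc k0 by simp
    qed
    show "\<exists>f \<pi>. (\<forall>x\<in>id i. cayley S x (f x) \<and> f x \<in> id (\<pi> x) \<and> \<pi> x \<in> ?I \<and> \<pi> x \<noteq> i)
        \<and> (\<exists>x\<in>id i. \<exists>y\<in>id i. \<pi> x \<noteq> \<pi> y)"
      by (rule exI[of _ "\<lambda>x. s \<otimes> x"], rule exI[of _ ?\<pi>], rule conjI, rule ballI, erule A,
          rule bexI[OF _ B(1)], rule bexI[OF _ B(2)], rule C)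
  qed
  then show ?thesis by (simp only: image_id id_apply Un)
qed

text \<open>As \<open>M\<close> normalises \<open>H\<close>, left multiplication by \<open>M\<close>
  sends H M^i to H M^(i+1), and the order of \<open>M\<close> modulo \<open>H\<close> closes the
  sequence of cosets. The resulting set is the subgroup generated by \<open>H\<close> and
  \<open>M\<close>.\<close>

lemma hconn_cyclic_extension:
  assumes fin: "finite (carrier G)"
    and S: "S \<subseteq> carrier G" "\<And>s. s \<in> S \<Longrightarrow> inv s \<in> S"
    and H: "subgroup H G" "3 \<le> card H"
    and M: "M \<in> S" "\<And>h. h \<in> H \<Longrightarrow> M \<otimes> h \<otimes> inv M \<in> H"
    and hc: "hconn (cayley S) H"
  shows "hconn (cayley S) {h \<otimes> M [^] n | h n. h \<in> H \<and> n \<in> (UNIV :: nat set)}"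
proof -
  note Hc = subgroup.mem_carrier[OF H(1)]
  have Mc: "M \<in> carrier G" using M S by blast
  define V where "V i = H #> (M [^] (i::nat))" for i
  have Vc: "V i \<subseteq> carrier G" for i
    using Hc Mc by (auto simp: V_def r_coset_def)
  have sym: "symp (cayley S)" using symp_cayley[OF S] .
  define m :: nat where "m = (LEAST n. 0 < n \<and> M [^] n \<in> H)"
  have "0 < order G \<and> M [^] order G \<in> H"
    using fin Mc pow_order_eq_1 subgroup.one_closed[OF H(1)] order_gt_0_iff_finite by auto
  then have m: "0 < m" "M [^] m \<in> H" unfolding m_def using LeastI[of "\<lambda>n. 0 < n \<and> M [^] n \<in> H" "order G"] by simp_all
  have mless: "M [^] n \<notin> H" if "0 < n" "n < m" for n :: nat
    using that not_less_Least[of n "\<lambda>n::nat. 0 < n \<and> M [^] n \<in> H"] unfolding m_def by blast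
  have per: "V (i + m) = V i" for i
  proof -
    have "M [^] (i + m) \<otimes> inv (M [^] i) = M [^] m"
      using Mc by (simp add: nat_pow_mult[symmetric] add.commute[of i m] m_assoc)
    then show ?thesis
      unfolding V_def using rcoset_eq_iff[OF H(1), of "M [^] i" "M [^] (i + m)"] m Mc by simp
  qed
  have step: "M \<otimes> x \<in> V (Suc i) \<and> cayley S x (M \<otimes> x)" if "x \<in> V i" for x i
  proof -
    obtain h where h: "h \<in> H" "x = h \<otimes> M [^] i" using \<open>x \<in> V i\<close> by (auto simp: V_def r_coset_def)
    note hc' = Hc[OF h(1)]
    have "M \<otimes> M [^] i = M [^] Suc i" using Mc nat_pow_comm[of M 1 i] by simp
    then have "M \<otimes> x = (M \<otimes> h \<otimes> inv M) \<otimes> M [^] Suc i"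
      using h hc' Mc by (simp add: m_assoc inv_solve_left)
    then have "M \<otimes> x \<in> V (Suc i)" using M(2)[OF h(1)] unfolding V_def r_coset_def by blast
    then show ?thesis using h hc' Mc M(1) by (auto simp: cayley_def)
  qed
  have disj: "V i \<inter> V j = {}" if "i < j" "j < i + m" for i j
  proof (rule ccontr)
    assume "V i \<inter> V j \<noteq> {}"
    then obtain x where x: "x \<in> H #> M [^] i" "x \<in> H #> M [^] j" by (auto simp: V_def)
    have "H #> M [^] i = H #> M [^] j"
      using repr_independence[OF x(1) _ H(1)] repr_independence[OF x(2) _ H(1)] Mc by simp
    then have "M [^] j \<otimes> inv (M [^] i) \<in> H"
      using rcoset_eq_iff[OF H(1), of "M [^] i" "M [^] j"] Mc by simp
    moreover have "M [^] j = M [^] (j - i) \<otimes> M [^] i" using Mc that by (simp add: nat_pow_mult)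
    ultimately have "M [^] (j - i) \<in> H" using Mc by (simp add: m_assoc)
    then show False using mless[of "j - i"] that by simp
  qed
  have hcV: "hconn (cayley S) (V i)" for i
    unfolding V_def using hconn_rcoset[OF hc _ _ S(1)] Hc Mc by blast
  have Minj: "M \<otimes> x = M \<otimes> y \<longleftrightarrow> x = y" if "x \<in> V i" "y \<in> V i" for x y i
    using that Vc[of i] Mc by (simp add: subset_iff)
  have cardV: "card (V i) = card H" for i
  proof -
    have "V i = (\<lambda>h. h \<otimes> M [^] i) ` H" by (auto simp: V_def r_coset_def)
    moreover have "inj_on (\<lambda>h. h \<otimes> M [^] i) H" using Hc Mc by (auto simp: inj_on_def)
    ultimately show ?thesis by (simp add: card_image)
  qed
  have "hconn (cayley S) (\<Union>(range V))"
    by (rule hconn_cyclic[OF sym m(1) per step _ disj hcV]) (use Minj cardV H(2) in \<open>auto simp: inj_on_def\<close>)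
  moreover have "\<Union>(range V) = {h \<otimes> M [^] n | h n. h \<in> H \<and> n \<in> (UNIV :: nat set)}"
    by (auto simp: V_def r_coset_def)
  ultimately show ?thesis by simp
qed

text \<open>In a finite group the inverse of an element is one of its powers.\<close>

lemma finite_closed_subgroup:
  assumes "finite (carrier G)" "K \<subseteq> carrier G" "\<one> \<in> K" "\<And>x y. x \<in> K \<Longrightarrow> y \<in> K \<Longrightarrow> x \<otimes> y \<in> K"
  shows "subgroup K G"
proof (rule subgroupI)
  fix a assume a: "a \<in> K"
  then have ac: "a \<in> carrier G" using assms(2) by blast
  have pow: "a [^] n \<in> K" for n :: nat using a assms(3,4) by (induction n) auto
  have "0 < order G" using assms(1) order_gt_0_iff_finite by simp
  then have "a [^] (order G - 1) \<otimes> a = \<one>"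
    using pow_order_eq_1[OF ac] nat_pow_Suc[of a "order G - 1"] by simp
  then have "inv a = a [^] (order G - 1)" using ac by (metis inv_equality nat_pow_closed)
  then show "inv a \<in> K" using pow by simp
qed (use assms in auto)

end

section \<open>Tori and the affine group over a finite field\<close>

locale gen =
  fixes \<alpha> :: "'a::{field,finite}" and m :: nat
  assumes gen: "mult_generator \<alpha>" and m_def: "m = CARD('a) - 1"
begin

lemma alpha_nz: "\<alpha> \<noteq> 0"
proof -
  have "\<alpha> ^ 1 \<in> range (\<lambda>k::nat. \<alpha> ^ k)" by (rule rangeI)
  then show ?thesis using gen by (simp add: mult_generator_def)
qed

text \<open>The powers of \<alpha> repeat in a finite field, so \<alpha> has an order
  \<open>n\<close>; as they exhaust the nonzero elements, \<open>n\<close> equals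
  \<open>m\<close>.\<close>

lemma bij_pow: "bij_betw (\<lambda>i. \<alpha> ^ i) {..<m} (- {0})" and pow_m: "\<alpha> ^ m = 1" and m_pos: "0 < m"
proof -
  have "\<not> inj (\<lambda>k::nat. \<alpha> ^ k)" using finite_imageD[of "\<lambda>k::nat. \<alpha> ^ k" UNIV] infinite_UNIV_nat by auto
  then obtain i j :: nat where "i < j" "\<alpha> ^ i = \<alpha> ^ j" by (metis injI linorder_neqE_nat)
  then have "\<alpha> ^ (j - i) = 1" using alpha_nz by (simp add: power_diff)
  then have ex: "\<exists>n>0. \<alpha> ^ n = 1" using \<open>i < j\<close> by (metis zero_less_diff)
  define n where "n = (LEAST n. 0 < n \<and> \<alpha> ^ n = 1)"
  have n: "0 < n" "\<alpha> ^ n = 1" using LeastI_ex[OF ex] by (simp_all add: n_def)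
  have nless: "\<alpha> ^ k \<noteq> 1" if "0 < k" "k < n" for k
    using that not_less_Least[of k "\<lambda>n. 0 < n \<and> \<alpha> ^ n = 1"] by (auto simp: n_def)
  have inj: "inj_on (\<lambda>i. \<alpha> ^ i) {..<n}"
  proof (rule linorder_inj_onI)
    fix x y assume "x < y" "x \<in> {..<n}" "y \<in> {..<n}"
    then have "\<alpha> ^ (y - x) \<noteq> 1" using nless[of "y - x"] by auto
    then show "\<alpha> ^ x \<noteq> \<alpha> ^ y" using \<open>x < y\<close> alpha_nz by (simp add: power_diff)
  qed auto
  have modn: "\<alpha> ^ k = \<alpha> ^ (k mod n)" for k
  proof -
    have "\<alpha> ^ k = \<alpha> ^ (n * (k div n) + k mod n)" by simp
    also have "\<dots> = \<alpha> ^ (k mod n)" unfolding power_add power_mult n by simp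
    finally show ?thesis .
  qed
  have im: "(\<lambda>i. \<alpha> ^ i) ` {..<n} = - {0}"
  proof
    show "(\<lambda>i. \<alpha> ^ i) ` {..<n} \<subseteq> - {0}" using alpha_nz by auto
    show "- {0} \<subseteq> (\<lambda>i. \<alpha> ^ i) ` {..<n}"
    proof
      fix x assume "x \<in> - {0 :: 'a}"
      then obtain k :: nat where "x = \<alpha> ^ k" using gen by (auto simp: mult_generator_def)
      then have "x = \<alpha> ^ (k mod n)" using modn by simp
      then show "x \<in> (\<lambda>i. \<alpha> ^ i) ` {..<n}" using n by auto
    qed
  qed
  have "n = card ((\<lambda>i. \<alpha> ^ i) ` {..<n})" using inj by (simp add: card_image)
  also have "\<dots> = m" unfolding im by (simp add: m_def Compl_eq_Diff_UNIV)
  finally have "n = m" .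
  then show "bij_betw (\<lambda>i. \<alpha> ^ i) {..<m} (- {0})" "\<alpha> ^ m = 1" "0 < m"
    using inj im n by (simp_all add: bij_betw_def)
qed

lemma pow_mod: "\<alpha> ^ (k mod m) = \<alpha> ^ k"
proof -
  have "\<alpha> ^ k = \<alpha> ^ (m * (k div m) + k mod m)" by simp
  also have "\<dots> = \<alpha> ^ (k mod m)" unfolding power_add power_mult pow_m by simp
  finally show ?thesis by simp
qed

lemma ex_pow: "x \<noteq> 0 \<Longrightarrow> \<exists>i<m. x = \<alpha> ^ i"
  using bij_betw_imp_surj_on[OF bij_pow] by blast

lemma pow_eq_iff: "\<alpha> ^ i = \<alpha> ^ j \<longleftrightarrow> i mod m = j mod m"
proof -
  have inj: "inj_on (\<lambda>i. \<alpha> ^ i) {..<m}" using bij_pow by (rule bij_betw_imp_inj_on)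
  have "\<alpha> ^ i = \<alpha> ^ j \<longleftrightarrow> \<alpha> ^ (i mod m) = \<alpha> ^ (j mod m)" unfolding pow_mod ..
  also have "\<dots> \<longleftrightarrow> i mod m = j mod m" using inj_on_eq_iff[OF inj, of "i mod m" "j mod m"] m_pos by simp
  finally show ?thesis .
qed

text \<open>The nonzero squares. If the order \<open>m\<close> of the multiplicative group is even,
  membership is the parity of the discrete logarithm.\<close>

definition ev :: "'a \<Rightarrow> bool" where "ev x \<longleftrightarrow> (\<exists>i::nat. x = \<alpha> ^ (2 * i))"

definition fadj :: "'a \<Rightarrow> 'a \<Rightarrow> bool" where "fadj a b \<longleftrightarrow> b = \<alpha> * a \<or> a = \<alpha> * b"

abbreviation W :: "('a \<times> 'a) set" where "W \<equiv> (- {0}) \<times> (- {0})"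

lemma torus_image:
  assumes "hpath (tadj m) ({..<m} \<times> {..<m}) (0, 0) p (i, j)" "a \<noteq> 0" "c \<noteq> 0"
  shows "\<exists>p. hpath (prodrel fadj fadj) W (a, c) p (a * \<alpha> ^ i, c * \<alpha> ^ j)"
proof -
  let ?f = "\<lambda>z. (a * \<alpha> ^ fst z, c * \<alpha> ^ snd z)"
  have inj: "inj_on ?f ({..<m} \<times> {..<m})"
    using assms(2,3) bij_pow by (auto simp: inj_on_def bij_betw_def)
  have ex: "\<exists>i<m. x = b * \<alpha> ^ i" if "b \<noteq> 0" "x \<noteq> 0" for b x
    using ex_pow[of "x / b"] that by (auto simp: field_simps)
  have "W \<subseteq> ?f ` ({..<m} \<times> {..<m})"
  proof
    fix z assume "z \<in> W"
    then have z: "fst z \<noteq> 0" "snd z \<noteq> 0" by auto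
    obtain i where i: "i < m" "fst z = a * \<alpha> ^ i" using ex[OF assms(2) z(1)] by blast
    obtain j where j: "j < m" "snd z = c * \<alpha> ^ j" using ex[OF assms(3) z(2)] by blast
    show "z \<in> ?f ` ({..<m} \<times> {..<m})"
      by (rule image_eqI[of z ?f "(i, j)"]) (use i j in \<open>auto simp: prod_eq_iff\<close>)
  qed
  then have im: "?f ` ({..<m} \<times> {..<m}) = W" using assms(2,3) alpha_nz by auto
  have adj: "fadj (b * \<alpha> ^ i) (b * \<alpha> ^ j)" if "cadj m i j" for b i j
    using that pow_mod[of "Suc i"] pow_mod[of "Suc j"] by (auto simp: cadj_def fadj_def)
  have "hpath (prodrel fadj fadj) (?f ` ({..<m} \<times> {..<m})) (?f (0, 0)) (map ?f p) (?f (i, j))"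
    by (rule hpath_image[OF assms(1) inj]) (auto simp: prodrel_def adj)
  then show ?thesis unfolding im by auto
qed

lemma hconn_torus:
  assumes "odd m"
  shows "hconn (prodrel fadj fadj) W"
  unfolding hconn_def
proof (intro ballI impI)
  fix u v assume "u \<in> W" "v \<in> W" "u \<noteq> v"
  then obtain a c b d where uv: "u = (a, c)" "v = (b, d)" "a \<noteq> 0" "c \<noteq> 0" "b \<noteq> 0" "d \<noteq> 0" by auto
  obtain i j where ij: "i < m" "j < m" "b / a = \<alpha> ^ i" "d / c = \<alpha> ^ j"
    using ex_pow[of "b / a"] ex_pow[of "d / c"] uv by auto
  then have bd: "b = a * \<alpha> ^ i" "d = c * \<alpha> ^ j" using uv by (auto simp: field_simps)
  have "(i, j) \<noteq> (0, 0)"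
  proof
    assume "(i, j) = (0, 0)"
    then show False using bd uv \<open>u \<noteq> v\<close> by simp
  qed
  then show "\<exists>p. hpath (prodrel fadj fadj) W u p v"
    using hpath_torus_odd[OF assms ij(1,2)] torus_image[of _ i j a c] uv bd by auto
qed

end

locale gen_odd = gen +
  assumes even_m: "even m"
begin

lemma ev_pow [simp]: "ev (\<alpha> ^ i) \<longleftrightarrow> even i"
proof
  assume "ev (\<alpha> ^ i)"
  then obtain j where "i mod m = (2 * j) mod m" by (auto simp: ev_def pow_eq_iff)
  then show "even i" using even_m by (metis dvd_mod_iff dvd_triv_left)
next
  assume "even i"
  then show "ev (\<alpha> ^ i)" by (auto simp: ev_def elim: evenE)
qed

lemma ev_alpha [simp]: "\<not> ev \<alpha>" using ev_pow[of 1] by simp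
lemma ev_one [simp]: "ev 1" using ev_pow[of 0] by simp

lemma ev_mult: "x \<noteq> 0 \<Longrightarrow> y \<noteq> 0 \<Longrightarrow> ev (x * y) \<longleftrightarrow> (ev x \<longleftrightarrow> ev y)"
  using ex_pow[of x] ex_pow[of y] by (auto simp: power_add[symmetric])

lemma torus_lace:
  assumes "(a, c) \<in> W" "(b, d) \<in> W" "ev (a * c) \<noteq> ev (b * d)"
  shows "\<exists>p. hpath (prodrel fadj fadj) W (a, c) p (b, d)"
proof -
  have nz: "a \<noteq> 0" "c \<noteq> 0" "b \<noteq> 0" "d \<noteq> 0" using assms by auto
  obtain i j where ij: "i < m" "j < m" "b / a = \<alpha> ^ i" "d / c = \<alpha> ^ j"
    using ex_pow[of "b / a"] ex_pow[of "d / c"] nz by auto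
  then have bd: "b = a * \<alpha> ^ i" "d = c * \<alpha> ^ j" using nz by (auto simp: field_simps)
  have "b * d = (a * c) * \<alpha> ^ (i + j)" using bd by (simp add: power_add)
  then have "odd (i + j)" using assms(3) nz alpha_nz by (simp only: ev_mult ev_pow) (auto simp: ev_mult)
  then obtain p where "hpath (tadj m) ({..<m} \<times> {..<m}) (0, 0) p (i, j)"
    using hpath_torus_even[OF even_m ij(1,2)] by blast
  then show ?thesis using torus_image[of p i j a c] nz bd by auto
qed

end

text \<open>The triangular group in coordinates: (t, a, c) stands for the matrix with rows a (f + t
  e) and c e, for fixed vectors f and e. Adding the second row to the first changes t by c / a, and
  the torus scales a and c.\<close>

definition (in gen) kadj :: "'a \<times> 'a \<times> 'a \<Rightarrow> 'a \<times> 'a \<times> 'a \<Rightarrow> bool" where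
  "kadj u v \<longleftrightarrow> fst u = fst v \<and> prodrel fadj fadj (snd u) (snd v) \<or>
     snd u = snd v \<and> (fst v = fst u + snd (snd u) / fst (snd u) \<or> fst v = fst u - snd (snd u) / fst (snd u))"

lemma (in gen) symp_kadj: "symp kadj"
  by (auto simp: symp_def kadj_def prodrel_def fadj_def)

section \<open>Lacing the tori of the triangular group for odd q\<close>

context gen_odd
begin

definition evk :: "'a \<times> 'a \<times> 'a \<Rightarrow> bool" where "evk u = ev (fst (snd u) * snd (snd u))"

lemma fibre_lace:
  assumes "u \<in> {t} \<times> W" "v \<in> {t} \<times> W" "evk u \<noteq> evk v"
  shows "\<exists>p. hpath kadj ({t} \<times> W) u p v"
proof -
  have "snd u \<in> W" "snd v \<in> W" using assms by auto
  then obtain p where p: "hpath (prodrel fadj fadj) W (snd u) p (snd v)"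
    using torus_lace[of "fst (snd u)" "snd (snd u)" "fst (snd v)" "snd (snd v)"] assms(3)
    unfolding evk_def by auto
  have "hpath kadj (Pair t ` W) (t, snd u) (map (Pair t) p) (t, snd v)"
    by (rule hpath_image[OF p]) (auto simp: inj_on_def kadj_def)
  moreover have "Pair t ` W = {t} \<times> W" by auto
  ultimately show ?thesis using assms by auto
qed

text \<open>At \<open>(t, 1, s * (t' - t))\<close> the quotient c / a equals t' - t up to the sign
  \<open>s\<close>, so one additive step leads to \<open>t'\<close>. The torus over \<open>t\<close>
  can be traversed from \<open>u\<close> to this vertex if the characters differ, and the step keeps
  the character.\<close>

lemma fibre_step:
  assumes "u \<in> {t} \<times> W" "t \<noteq> t'" "s = 1 \<or> s = - 1" "evk u \<noteq> ev (s * (t' - t))"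
  shows "\<exists>p. hpath kadj ({t} \<times> W) u p (t, 1, s * (t' - t))"
    "kadj (t, 1, s * (t' - t)) (t', 1, s * (t' - t))"
    "(t', 1, s * (t' - t)) \<in> {t'} \<times> W" "evk (t', 1, s * (t' - t)) = ev (s * (t' - t))"
  using assms by (auto intro!: fibre_lace simp: evk_def kadj_def)

text \<open>Consecutive points of the walk t + \<beta>^i d differ by (\<beta> - 1) \<beta>^i d. As
  \<beta> is a non-square, these differences alternate in character, which is what the fibres need:
  each is left at a vertex whose colour is opposite to that of its entry. The suffix
  \<open>q\<close> records that the last fibre is traversed as a whole at the end.\<close>

lemma circle_aux:
  assumes "\<beta> \<noteq> 0" "\<not> ev \<beta>" "\<beta> \<noteq> 1" "s = 1 \<or> s = - 1" "\<forall>i j. i < j \<longrightarrow> j < m \<longrightarrow> \<beta> ^ i \<noteq> \<beta> ^ j"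
  shows "n < m \<Longrightarrow> d \<noteq> 0 \<Longrightarrow> u \<in> {t + d} \<times> W \<Longrightarrow> v \<in> {t + \<beta> ^ n * d} \<times> W \<Longrightarrow>
    evk u \<noteq> ev (s * (\<beta> - 1) * d) \<Longrightarrow> evk v = ev (s * (\<beta> - 1) * (\<beta> ^ n * d)) \<Longrightarrow>
    \<exists>p q. hpath kadj ((\<lambda>i. t + \<beta> ^ i * d) ` {..n} \<times> W) u (p @ q) v \<and> set q = {t + \<beta> ^ n * d} \<times> W"
proof (induction n arbitrary: d u)
  case 0
  then have "u \<in> {t + d} \<times> W" "v \<in> {t + d} \<times> W" "evk u \<noteq> evk v" by auto
  from fibre_lace[OF this] obtain q where q: "hpath kadj ({t + d} \<times> W) u q v" by blast
  then have "hpath kadj ((\<lambda>i. t + \<beta> ^ i * d) ` {..0} \<times> W) u ([] @ q) v" "set q = {t + \<beta> ^ 0 * d} \<times> W"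
    by (auto simp: hpath_def)
  then show ?case by blast
next
  case (Suc n)
  have d': "\<beta> * d \<noteq> 0" using assms Suc.prems by simp
  have ne: "t + d \<noteq> t + \<beta> * d" using assms Suc.prems by simp
  have eq: "s * (t + \<beta> * d - (t + d)) = s * (\<beta> - 1) * d" by (simp add: algebra_simps)
  let ?u' = "(t + \<beta> * d, 1, s * (\<beta> - 1) * d)"
  note st = fibre_step[OF Suc.prems(3) ne assms(4), unfolded eq, OF Suc.prems(5)]
  have nz: "s * (\<beta> - 1) * d \<noteq> 0" using assms Suc.prems by auto
  have "ev (s * (\<beta> - 1) * (\<beta> * d)) \<noteq> ev (s * (\<beta> - 1) * d)"
  proof -
    have "s * (\<beta> - 1) * (\<beta> * d) = \<beta> * (s * (\<beta> - 1) * d)" by (simp add: algebra_simps)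
    then show ?thesis using ev_mult[OF assms(1) nz] assms(2) by metis
  qed
  then have ev': "evk ?u' \<noteq> ev (s * (\<beta> - 1) * (\<beta> * d))" using st(4) by simp
  have e: "\<beta> ^ Suc n * d = \<beta> ^ n * (\<beta> * d)" by simp
  have n: "n < m" using Suc.prems by simp
  obtain p q where
    pq: "hpath kadj ((\<lambda>i. t + \<beta> ^ i * (\<beta> * d)) ` {..n} \<times> W) ?u' (p @ q) v"
      "set q = {t + \<beta> ^ Suc n * d} \<times> W"
    using Suc.IH[OF n d' st(3) Suc.prems(4)[unfolded e] ev' Suc.prems(6)[unfolded e]] unfolding e by blast
  obtain r where r: "hpath kadj ({t + d} \<times> W) u r (t + d, 1, s * (\<beta> - 1) * d)" using st(1) by blast
  have set1: "(\<lambda>i. t + \<beta> ^ i * d) ` {..Suc n} = insert (t + d) ((\<lambda>i. t + \<beta> ^ i * (\<beta> * d)) ` {..n})"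
    by (simp add: atMost_Suc_eq_insert_0 image_image ac_simps)
  have "t + d \<notin> (\<lambda>i. t + \<beta> ^ i * (\<beta> * d)) ` {..n}"
  proof
    assume "t + d \<in> (\<lambda>i. t + \<beta> ^ i * (\<beta> * d)) ` {..n}"
    then obtain i where i: "i \<le> n" "d = \<beta> ^ i * (\<beta> * d)" by auto
    then have "\<beta> ^ 0 * d = \<beta> ^ Suc i * d" by (simp add: ac_simps)
    then have "\<beta> ^ 0 = \<beta> ^ Suc i" using Suc.prems(2) mult_right_cancel by blast
    moreover have "0 < Suc i" "Suc i < m" using i(1) Suc.prems(1) by simp_all
    ultimately show False using assms(5) by blast
  qed
  then have "hpath kadj ({t + d} \<times> W \<union> (\<lambda>i. t + \<beta> ^ i * (\<beta> * d)) ` {..n} \<times> W) u (r @ (p @ q)) v"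
    by (intro hpath_append[OF r pq(1) st(2)]) auto
  moreover have "{t + d} \<times> W \<union> (\<lambda>i. t + \<beta> ^ i * (\<beta> * d)) ` {..n} \<times> W = (\<lambda>i. t + \<beta> ^ i * d) ` {..Suc n} \<times> W"
    unfolding set1 by auto
  ultimately have "hpath kadj ((\<lambda>i. t + \<beta> ^ i * d) ` {..Suc n} \<times> W) u ((r @ p) @ q) v" by simp
  then show ?case using pq(2) by blast
qed

text \<open>Passing from \<alpha> to its inverse and changing the sign divides \<alpha> - 1 by the
  non-square \<alpha>, so both characters occur.\<close>

lemma ex_generator_choice:
  assumes "2 < m"
  shows "\<exists>\<beta> s. (\<beta> = \<alpha> \<or> \<beta> * \<alpha> = 1) \<and> (s = 1 \<or> s = - 1) \<and> ev (s * (\<beta> - 1)) = b"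
proof (cases "ev (\<alpha> - 1) = b")
  case True
  then show ?thesis by (intro exI[of _ \<alpha>] exI[of _ 1]) simp
next
  case False
  have ne: "\<alpha> \<noteq> 1" using ev_alpha ev_one by metis
  have "(- 1) * (1 / \<alpha> - 1) = (1 / \<alpha>) * (\<alpha> - 1)" using alpha_nz by (simp add: field_simps)
  moreover have "\<not> ev (1 / \<alpha>)" using ev_mult[of \<alpha> "1 / \<alpha>"] alpha_nz by auto
  ultimately have "ev ((- 1) * (1 / \<alpha> - 1)) = b" using ev_mult[of "1 / \<alpha>" "\<alpha> - 1"] ne alpha_nz False by auto
  then show ?thesis using alpha_nz by (intro exI[of _ "1 / \<alpha>"] exI[of _ "- 1"]) simp
qed

lemma inv_gen_props:
  assumes "\<beta> = \<alpha> \<or> \<beta> * \<alpha> = 1"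
  shows "\<beta> \<noteq> 0" "\<not> ev \<beta>" "\<beta> \<noteq> 1" "\<beta> ^ m = 1" "i < j \<Longrightarrow> j < m \<Longrightarrow> \<beta> ^ i \<noteq> \<beta> ^ j"
proof -
  show nz: "\<beta> \<noteq> 0" using assms alpha_nz by auto
  show ev: "\<not> ev \<beta>" using assms ev_mult[of \<beta> \<alpha>] nz alpha_nz by auto
  show "\<beta> \<noteq> 1" using ev ev_one by metis
  have bk: "\<beta> ^ k * \<alpha> ^ k = 1" if "\<beta> * \<alpha> = 1" for k using that by (simp add: power_mult_distrib[symmetric])
  show "\<beta> ^ m = 1" using assms pow_m bk[of m] by auto
  show "\<beta> ^ i \<noteq> \<beta> ^ j" if "i < j" "j < m"
  proof
    assume eq: "\<beta> ^ i = \<beta> ^ j"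
    have "\<alpha> ^ i = \<alpha> ^ j"
    proof (cases "\<beta> = \<alpha>")
      case True
      then show ?thesis using eq by simp
    next
      case False
      then have "\<beta> * \<alpha> = 1" using assms by simp
      then have "\<beta> ^ i * \<alpha> ^ i = \<beta> ^ i * \<alpha> ^ j" using bk eq by metis
      then show ?thesis using nz by simp
    qed
    then show False using that by (simp add: pow_eq_iff)
  qed
qed

text \<open>The fibre over \<open>t\<close> comes first and then the fibres over a circle around
  \<open>t\<close>, which starts at t + \<beta> l, meets every point other than \<open>t\<close> and
  ends at t + \<beta>^m l = t'. The sign \<open>s0\<close> makes the initial step away from
  \<open>t\<close> possible.\<close>

lemma borel_lace_aux:
  assumes m: "2 < m" and u: "u \<in> {t} \<times> W" and v: "v \<in> {t'} \<times> W" and "t \<noteq> t'" "evk u \<noteq> evk v"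
    and s0: "s0 = 1 \<or> s0 = - 1" "ev (s0 * (t' - t)) = evk u"
  shows "\<exists>p1 p2 p3. hpath kadj (UNIV \<times> W) u (p1 @ p2 @ p3) v \<and> set p1 = {t} \<times> W \<and> set p3 = {t'} \<times> W"
proof -
  define l where "l = t' - t"
  have l: "l \<noteq> 0" "t' = t + l" using assms by (auto simp: l_def)
  \<comment> \<open>This choice gives s (\<beta> - 1) l the character of \<open>v\<close>, so that
    the alternation along the circle ends with the right colour.\<close>
  obtain \<beta> s where \<beta>: "\<beta> = \<alpha> \<or> \<beta> * \<alpha> = 1" "s = 1 \<or> s = - 1" "ev (s * (\<beta> - 1)) = (ev l \<noteq> evk u)"
    using ex_generator_choice[OF m] by blast
  note \<beta>p = inv_gen_props[OF \<beta>(1)]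
  have nz: "s * (\<beta> - 1) \<noteq> 0" using \<beta> \<beta>p by auto
  have e1: "ev (s * (\<beta> - 1) * l) \<noteq> evk u" using ev_mult[OF nz l(1)] \<beta>(3) by auto
  have e2: "ev (s * (\<beta> - 1) * (\<beta> * l)) = evk u"
  proof -
    have "s * (\<beta> - 1) * (\<beta> * l) = \<beta> * (s * (\<beta> - 1) * l)" by (simp add: algebra_simps)
    moreover have "s * (\<beta> - 1) * l \<noteq> 0" using nz l by simp
    ultimately show ?thesis using e1 ev_mult[of \<beta> "s * (\<beta> - 1) * l"] \<beta>p(1,2) by metis
  qed
  have s0nz: "s0 * l \<noteq> 0" using s0 l by auto
  have e3: "ev (s0 * (\<beta> * l)) \<noteq> evk u"
  proof -
    have "s0 * (\<beta> * l) = \<beta> * (s0 * l)" by simp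
    then show ?thesis using s0(2) ev_mult[OF \<beta>p(1) s0nz] \<beta>p(2) unfolding l_def by metis
  qed
  let ?t1 = "t + \<beta> * l" let ?u1 = "(?t1, 1, s0 * (\<beta> * l))"
  have eq: "s0 * (?t1 - t) = s0 * (\<beta> * l)" by simp
  have ne: "t \<noteq> ?t1" using \<beta>p l by simp
  note st = fibre_step[OF u ne s0(1), unfolded eq, OF e3[symmetric]]
  have bl: "\<beta> ^ (m - 1) * (\<beta> * l) = l"
  proof -
    have "\<beta> ^ (m - 1) * (\<beta> * l) = \<beta> ^ Suc (m - 1) * l" by simp
    then show ?thesis using \<beta>p(4) m_pos by simp
  qed
  have v': "v \<in> {t + \<beta> ^ (m - 1) * (\<beta> * l)} \<times> W" "{t'} \<times> W = {t + \<beta> ^ (m - 1) * (\<beta> * l)} \<times> W"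
    "evk v = ev (s * (\<beta> - 1) * (\<beta> ^ (m - 1) * (\<beta> * l)))"
    unfolding bl using v l assms(5) e1 by auto
  have nz1: "\<beta> * l \<noteq> 0" using \<beta>p l by simp
  have e4: "evk ?u1 \<noteq> ev (s * (\<beta> - 1) * (\<beta> * l))" using st(4) e2 e3 by simp
  have bpow: "\<forall>i j. i < j \<longrightarrow> j < m \<longrightarrow> \<beta> ^ i \<noteq> \<beta> ^ j" using \<beta>p(5) by blast
  have m1: "m - 1 < m" using m_pos by simp
  obtain p q where pq: "hpath kadj ((\<lambda>i. t + \<beta> ^ i * (\<beta> * l)) ` {..m - 1} \<times> W) ?u1 (p @ q) v"
      "set q = {t'} \<times> W"
    using circle_aux[OF \<beta>p(1-3) \<beta>(2) bpow m1 nz1 st(3) v'(1) e4 v'(3)] unfolding v'(2)[symmetric] by blast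
  obtain r where r: "hpath kadj ({t} \<times> W) u r (t, 1, s0 * (\<beta> * l))" using st(1) by blast
  have inj: "inj_on (\<lambda>i. t + \<beta> ^ i * (\<beta> * l)) {..m - 1}"
    by (rule linorder_inj_onI) (use \<beta>p(5) nz1 m_pos in auto)
  let ?C = "(\<lambda>i. t + \<beta> ^ i * (\<beta> * l)) ` {..m - 1}"
  have "card ?C = m" using card_image[OF inj] m_pos by simp
  moreover have "?C \<subseteq> - {t}" using nz1 \<beta>p(1) by auto
  moreover have "card (- {t}) = m" by (simp add: m_def Compl_eq_Diff_UNIV)
  ultimately have C: "?C = - {t}" by (metis card_subset_eq finite)
  have "hpath kadj ({t} \<times> W \<union> ?C \<times> W) u (r @ (p @ q)) v"
  proof (rule hpath_append[OF r pq(1) st(2)])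
    show "{t} \<times> W \<inter> ?C \<times> W = {}" unfolding C by blast
  qed
  moreover have "{t} \<times> W \<union> ?C \<times> W = UNIV \<times> W" unfolding C by auto
  moreover have "set r = {t} \<times> W" using r by (simp add: hpath_def)
  ultimately show ?thesis using pq(2) by metis
qed

text \<open>The initial step needs a sign for which s0 (t' - t) has the character of
  \<open>u\<close>. If neither sign has this property, then -1 is a square and t - t' has the
  character of \<open>v\<close>, so the path can be built from \<open>v\<close> and reversed.
  Recording both \<open>p1\<close> and \<open>p3\<close> keeps the statement symmetric under this
  reversal.\<close>

lemma borel_lace:
  assumes m: "2 < m" and u: "u \<in> {t} \<times> W" and v: "v \<in> {t'} \<times> W" and "t \<noteq> t'" "evk u \<noteq> evk v"
  shows "\<exists>p1 p2 p3. hpath kadj (UNIV \<times> W) u (p1 @ p2 @ p3) v \<and> set p1 = {t} \<times> W \<and> set p3 = {t'} \<times> W"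
proof -
  consider "ev (t' - t) = evk u" | "ev (t' - t) \<noteq> evk u" "ev (- 1)" | "ev (t' - t) \<noteq> evk u" "\<not> ev (- 1)" by blast
  then show ?thesis
  proof cases
    case 1
    then show ?thesis using borel_lace_aux[OF assms, of 1] by simp
  next
    case 2
    have "ev (t - t') = ev (t' - t)" using ev_mult[of "- 1" "t' - t"] assms(4) 2 by auto
    then obtain p1 p2 p3 where p: "hpath kadj (UNIV \<times> W) v (p1 @ p2 @ p3) u"
        "set p1 = {t'} \<times> W" "set p3 = {t} \<times> W"
      using borel_lace_aux[OF m v u, of 1] assms 2 by auto
    have "hpath kadj (UNIV \<times> W) u (rev p3 @ rev p2 @ rev p1) v"
      using hpath_rev[OF symp_kadj p(1)] by simp
    then show ?thesis using p by (metis set_rev)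
  next
    case 3
    have "ev (- 1 * (t' - t)) \<noteq> ev (t' - t)" using ev_mult[of "- 1" "t' - t"] assms(4) 3 by auto
    then show ?thesis using borel_lace_aux[OF assms, of "- 1"] 3 by auto
  qed
qed

end

section \<open>Pairs of row vectors and the case $n = 2$\<close>

definition det2 :: "'a::comm_ring_1 \<times> 'a \<Rightarrow> 'a \<times> 'a \<Rightarrow> 'a" where
  "det2 x y = fst x * snd y - snd x * fst y"

definition scl :: "'a::times \<Rightarrow> 'a \<times> 'a \<Rightarrow> 'a \<times> 'a" where
  "scl c x = (c * fst x, c * snd x)"

definition GL2 :: "(('a::comm_ring_1 \<times> 'a) \<times> ('a \<times> 'a)) set" where
  "GL2 = {X. det2 (fst X) (snd X) \<noteq> 0}"

text \<open>The point of the projective line spanned by a nonzero vector; \<open>None\<close> is the point at infinity.\<close>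

definition ln2 :: "'a::field \<times> 'a \<Rightarrow> 'a option" where
  "ln2 x = (if fst x = 0 then None else Some (snd x / fst x))"

text \<open>The right cosets of the upper triangular group: its row operations only rescale the
  second row, so the point \<open>Q\<close> spanned by that row is the invariant.\<close>

definition VQ :: "'a::field option \<Rightarrow> (('a \<times> 'a) \<times> ('a \<times> 'a)) set" where
  "VQ Q = {X \<in> GL2. ln2 (snd X) = Q}"

definition rep :: "'a::field option \<Rightarrow> 'a \<times> 'a" where
  "rep Q = (case Q of None \<Rightarrow> (0, 1) | Some s \<Rightarrow> (1, s))"

text \<open>The row operation that leaves a coset. Among its values those with \<open>s = 1\<close>
  and \<open>s = - 1\<close> are edges; other coefficients describe the exits of rescaled
  matrices.\<close>

definition mv :: "'a::comm_ring_1 \<Rightarrow> ('a \<times> 'a) \<times> ('a \<times> 'a) \<Rightarrow> ('a \<times> 'a) \<times> ('a \<times> 'a)" where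
  "mv s X = (fst X, snd X + scl s (fst X))"

lemma ln2_eq_iff:
  assumes "x \<noteq> (0, 0)" "y \<noteq> (0, 0)"
  shows "ln2 x = ln2 y \<longleftrightarrow> det2 x y = 0"
  using assms by (cases x; cases y) (auto simp: ln2_def det2_def field_simps)

lemma ln2_rep [simp]: "ln2 (rep Q) = Q"
  by (cases Q) (auto simp: ln2_def rep_def)

lemma rep_nz [simp]: "rep Q \<noteq> (0, 0)"
  by (cases Q) (auto simp: rep_def)

lemma ln2_scl: "c \<noteq> 0 \<Longrightarrow> ln2 (scl c x) = ln2 x"
  by (auto simp: ln2_def scl_def)

lemma GL2_nz: "X \<in> GL2 \<Longrightarrow> fst X \<noteq> (0, 0) \<and> snd X \<noteq> (0, 0)"
  by (auto simp: GL2_def det2_def)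

lemma GL2_ln2: "X \<in> GL2 \<Longrightarrow> ln2 (fst X) \<noteq> ln2 (snd X)"
  using GL2_nz[of X] by (auto simp: ln2_eq_iff GL2_def)

lemma det2_mv [simp]: "det2 (fst (mv s X)) (snd (mv s X)) = det2 (fst X) (snd X)"
  by (simp add: mv_def det2_def scl_def algebra_simps)

lemma mv_GL2: "X \<in> GL2 \<Longrightarrow> mv s X \<in> GL2"
  by (simp add: GL2_def)

lemma mv_VQ: "X \<in> GL2 \<Longrightarrow> mv s X \<in> VQ (ln2 (snd (mv s X)))"
  by (simp add: VQ_def mv_GL2)

lemma VQ_disj: "Q \<noteq> Q' \<Longrightarrow> VQ Q \<inter> VQ Q' = {}"
  by (auto simp: VQ_def)

lemma VQ_Union: "\<Union>(VQ ` UNIV) = GL2"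
  by (auto simp: VQ_def)

lemma VQ_GL2: "X \<in> VQ Q \<Longrightarrow> X \<in> GL2"
  by (simp add: VQ_def)

lemma mv_exit:
  assumes "X \<in> VQ Q" "s \<noteq> 0"
  shows "ln2 (snd (mv s X)) \<noteq> Q"
proof -
  have X: "X \<in> GL2" "ln2 (snd X) = Q" using assms by (auto simp: VQ_def)
  have "det2 (snd (mv s X)) (snd X) = s * det2 (fst X) (snd X)"
    by (simp add: mv_def det2_def scl_def algebra_simps)
  then have "det2 (snd (mv s X)) (snd X) \<noteq> 0" using X assms by (simp add: GL2_def)
  then show ?thesis
    using X GL2_nz[OF X(1)] GL2_nz[OF mv_GL2[OF X(1)], of s] ln2_eq_iff[of "snd (mv s X)" "snd X"] by simp
qed

text \<open>The two new second rows have determinant (s - s') times that of \<open>X\<close>. In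
  particular, if 1 and -1 differ, every vertex has exits to two different cosets.\<close>

lemma mv_exit_neq:
  assumes "X \<in> GL2" "s \<noteq> s'"
  shows "ln2 (snd (mv s X)) \<noteq> ln2 (snd (mv s' X))"
proof -
  have "det2 (snd (mv s X)) (snd (mv s' X)) = (s - s') * det2 (fst X) (snd X)"
    by (simp add: mv_def det2_def scl_def algebra_simps)
  then have "det2 (snd (mv s X)) (snd (mv s' X)) \<noteq> 0" using assms by (simp add: GL2_def)
  then show ?thesis
    using GL2_nz[OF mv_GL2[OF assms(1)], of s] GL2_nz[OF mv_GL2[OF assms(1)], of s']
      ln2_eq_iff[of "snd (mv s X)" "snd (mv s' X)"] by simp
qed

section \<open>Coordinates on the cosets of the triangular group\<close>

context gen
begin

definition radj :: "('a \<times> 'a) \<times> ('a \<times> 'a) \<Rightarrow> ('a \<times> 'a) \<times> ('a \<times> 'a) \<Rightarrow> bool" where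
  "radj X Y \<longleftrightarrow>
     fst Y = fst X \<and> (snd Y = snd X + fst X \<or> snd Y = snd X - fst X) \<or>
     snd Y = snd X \<and> (fst Y = fst X + snd X \<or> fst Y = fst X - snd X) \<or>
     snd Y = snd X \<and> (fst Y = scl \<alpha> (fst X) \<or> fst X = scl \<alpha> (fst Y)) \<or>
     fst Y = fst X \<and> (snd Y = scl \<alpha> (snd X) \<or> snd X = scl \<alpha> (snd Y))"

lemma symp_radj: "symp radj"
  by (rule sympI) (auto simp: radj_def)

lemma radj_mv:
  assumes "s = 1 \<or> s = - 1"
  shows "radj X (mv s X) \<and> radj (mv s X) X"
proof -
  have sc: "scl 1 (fst X) = fst X" "scl (- 1) (fst X) = - fst X" by (simp_all add: scl_def prod_eq_iff)
  have "radj X (mv s X)" using assms by (auto simp: radj_def mv_def sc)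
  then show ?thesis using symp_radj by (auto dest: sympD)
qed

definition psi :: "'a \<times> 'a \<Rightarrow> 'a \<times> 'a \<Rightarrow> 'a \<times> 'a \<times> 'a \<Rightarrow> ('a \<times> 'a) \<times> ('a \<times> 'a)" where
  "psi f e z = (scl (fst (snd z)) (f + scl (fst z) e), scl (snd (snd z)) e)"

lemma det2_psi: "det2 (fst (psi f e z)) (snd (psi f e z)) = fst (snd z) * snd (snd z) * det2 f e"
  by (simp add: psi_def det2_def scl_def algebra_simps)

lemma psi_inj: "det2 f e \<noteq> 0 \<Longrightarrow> inj_on (psi f e) (UNIV \<times> W)"
proof (rule inj_onI)
  fix y z assume D: "det2 f e \<noteq> 0" and yz: "y \<in> UNIV \<times> W" "z \<in> UNIV \<times> W" "psi f e y = psi f e z"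
  obtain t a c where y: "y = (t, a, c)" by (cases y)
  obtain t' a' c' where z: "z = (t', a', c')" by (cases z)
  have nz: "a \<noteq> 0" "c \<noteq> 0" "a' \<noteq> 0" "c' \<noteq> 0" using yz y z by auto
  have eqs: "a * (fst f + t * fst e) = a' * (fst f + t' * fst e)"
    "a * (snd f + t * snd e) = a' * (snd f + t' * snd e)"
    "c * fst e = c' * fst e" "c * snd e = c' * snd e"
    using yz(3) by (simp_all add: y z psi_def scl_def)
  have "a * det2 f e = a' * det2 f e"
  proof -
    have "a * det2 f e = a * (fst f + t * fst e) * snd e - a * (snd f + t * snd e) * fst e"
      by (simp add: det2_def algebra_simps)
    also have "\<dots> = a' * (fst f + t' * fst e) * snd e - a' * (snd f + t' * snd e) * fst e" by (simp only: eqs)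
    also have "\<dots> = a' * det2 f e" by (simp add: det2_def algebra_simps)
    finally show ?thesis .
  qed
  then have a: "a = a'" using D by simp
  have e: "fst e \<noteq> 0 \<or> snd e \<noteq> 0" using D by (auto simp: det2_def)
  have "c = c'" using e eqs(3,4) by auto
  moreover have "t = t'" using e eqs(1,2) a nz by auto
  ultimately show "y = z" using a y z by simp
qed

lemma psi_adj:
  assumes "kadj y z" "y \<in> UNIV \<times> W" "z \<in> UNIV \<times> W"
  shows "radj (psi f e y) (psi f e z)"
proof -
  obtain t a c where y: "y = (t, a, c)" by (cases y)
  obtain t' a' c' where z: "z = (t', a', c')" by (cases z)
  have nz: "a \<noteq> 0" "c \<noteq> 0" "a' \<noteq> 0" "c' \<noteq> 0" using assms y z by auto
  have scl2: "scl (x * y) v = scl x (scl y v)" for x y :: 'a and v by (simp add: scl_def mult.assoc)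
  have add: "scl a (f + scl (t + c / a) e) = scl a (f + scl t e) + scl c e"
    using nz by (simp add: scl_def prod_eq_iff field_simps)
  have diff: "scl a (f + scl (t - c / a) e) = scl a (f + scl t e) - scl c e"
    using nz by (simp add: scl_def prod_eq_iff field_simps)
  have 1: "radj (psi f e y) (psi f e z)" if "t' = t" "c' = c" "fadj a a'"
    using that by (auto simp: radj_def psi_def y z fadj_def scl2)
  have 2: "radj (psi f e y) (psi f e z)" if "t' = t" "a' = a" "fadj c c'"
    using that by (auto simp: radj_def psi_def y z fadj_def scl2)
  have 3: "radj (psi f e y) (psi f e z)" if "a' = a" "c' = c" "t' = t + c / a \<or> t' = t - c / a"
    using that by (auto simp: radj_def psi_def y z add diff)
  show ?thesis using assms(1) 1 2 3 unfolding kadj_def prodrel_def y z by auto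
qed

lemma cramer:
  fixes f e x :: "'a \<times> 'a"
  assumes "det2 f e \<noteq> 0"
  shows "x = scl (det2 x e / det2 f e) f + scl (det2 f x / det2 f e) e"
proof -
  have "det2 x e * fst f + det2 f x * fst e = det2 f e * fst x"
    "det2 x e * snd f + det2 f x * snd e = det2 f e * snd x"
    by (simp_all add: det2_def algebra_simps)
  then have "fst x = (det2 x e * fst f + det2 f x * fst e) / det2 f e"
    "snd x = (det2 x e * snd f + det2 f x * snd e) / det2 f e"
    using assms by simp_all
  then show ?thesis by (simp add: scl_def prod_eq_iff add_divide_distrib)
qed

text \<open>By Cramer's rule the rows of a matrix in the coset are a f + b e and c e, so t = b / a;
  and t = 0 means that the first row is proportional to \<open>f\<close>, which singles out a coset
  of the torus.\<close>

lemma psi_image: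
  assumes "(f, e) \<in> GL2"
  shows "psi f e ` (UNIV \<times> W) = VQ (ln2 e)"
    "psi f e ` ({0} \<times> W) = {X \<in> VQ (ln2 e). ln2 (fst X) = ln2 f}"
proof -
  have D: "det2 f e \<noteq> 0" using assms by (simp add: GL2_def)
  have enz: "f \<noteq> (0, 0)" "e \<noteq> (0, 0)" using GL2_nz[OF assms] by auto
  have sub: "psi f e z \<in> VQ (ln2 e)" if "z \<in> UNIV \<times> W" for z
    using that D det2_psi[of f e z] by (auto simp: VQ_def GL2_def psi_def ln2_scl)
  have sup: "\<exists>z \<in> UNIV \<times> W. psi f e z = X \<and> (ln2 (fst X) = ln2 f \<longrightarrow> fst z = 0)" if X: "X \<in> VQ (ln2 e)" for X
  proof -
    have X': "X \<in> GL2" "ln2 (snd X) = ln2 e" using X by (auto simp: VQ_def)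
    note Xnz = GL2_nz[OF X'(1)]
    have s0: "det2 (snd X) e = 0" using ln2_eq_iff[of "snd X" e] Xnz X'(2) enz by auto
    define a b c where "a = det2 (fst X) e / det2 f e" and "b = det2 f (fst X) / det2 f e"
      and "c = det2 f (snd X) / det2 f e"
    have fX: "fst X = scl a f + scl b e" unfolding a_def b_def by (rule cramer[OF D])
    have sX: "snd X = scl c e" using cramer[OF D, of "snd X"] s0 by (simp add: c_def scl_def)
    have cnz: "c \<noteq> 0" using Xnz sX by (auto simp: scl_def)
    have "ln2 (fst X) \<noteq> ln2 e" using GL2_ln2[OF X'(1)] X'(2) by simp
    then have anz: "a \<noteq> 0" using ln2_eq_iff[of "fst X" e] Xnz enz D by (auto simp: a_def)
    have "psi f e (b / a, a, c) = X"
      using anz by (simp add: psi_def prod_eq_iff fX sX scl_def algebra_simps)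
    moreover have "b = 0" if "ln2 (fst X) = ln2 f"
      using that ln2_eq_iff[of f "fst X"] Xnz enz by (simp add: b_def)
    ultimately show ?thesis using anz cnz by (intro bexI[of _ "(b / a, a, c)"]) auto
  qed
  show "psi f e ` (UNIV \<times> W) = VQ (ln2 e)"
  proof
    show "psi f e ` (UNIV \<times> W) \<subseteq> VQ (ln2 e)" using sub by blast
    show "VQ (ln2 e) \<subseteq> psi f e ` (UNIV \<times> W)" using sup by blast
  qed
  show "psi f e ` ({0} \<times> W) = {X \<in> VQ (ln2 e). ln2 (fst X) = ln2 f}"
  proof
    show "psi f e ` ({0} \<times> W) \<subseteq> {X \<in> VQ (ln2 e). ln2 (fst X) = ln2 f}"
    proof
      fix X assume "X \<in> psi f e ` ({0} \<times> W)"
      then obtain z where z: "z \<in> {0} \<times> W" "X = psi f e z" by auto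
      then have "X \<in> VQ (ln2 e)" using sub by auto
      moreover have "fst X = scl (fst (snd z)) f" using z by (auto simp: psi_def scl_def prod_eq_iff)
      ultimately show "X \<in> {X \<in> VQ (ln2 e). ln2 (fst X) = ln2 f}" using z by (auto simp: ln2_scl)
    qed
    show "{X \<in> VQ (ln2 e). ln2 (fst X) = ln2 f} \<subseteq> psi f e ` ({0} \<times> W)"
    proof
      fix X assume "X \<in> {X \<in> VQ (ln2 e). ln2 (fst X) = ln2 f}"
      then have X: "X \<in> VQ (ln2 e)" "ln2 (fst X) = ln2 f" by simp_all
      obtain z where "z \<in> UNIV \<times> W" "psi f e z = X" "fst z = 0" using sup[OF X(1)] X(2) by blast
      then show "X \<in> psi f e ` ({0} \<times> W)" by (intro image_eqI[of X _ z]) auto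
    qed
  qed
qed

end

section \<open>Chains of cosets with control of the quadratic character\<close>

context gen_odd
begin

definition par :: "('a \<times> 'a) \<times> ('a \<times> 'a) \<Rightarrow> bool" where
  "par X = ev (det2 (fst X) (snd X))"

lemma par_mv [simp]: "par (mv s X) = par X"
  by (simp add: par_def)

lemma VQ_lace:
  assumes m: "2 < m" and u: "u \<in> VQ Q" and v: "v \<in> VQ Q" and ne: "ln2 (fst u) \<noteq> ln2 (fst v)"
    and par: "par u \<noteq> par v"
  shows "\<exists>p1 p2. hpath radj (VQ Q) u (p1 @ p2) v \<and> set p1 = {X \<in> VQ Q. ln2 (fst X) = ln2 (fst u)}"
proof -
  \<comment> \<open>With the rows of \<open>u\<close> as base, \<open>u\<close> has coordinates (0,
    1, 1) and the fibre over 0 is the torus through \<open>u\<close>.\<close>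
  define f e where "f = fst u" and "e = snd u"
  have fe: "(f, e) \<in> GL2" "ln2 e = Q" "u = (f, e)" using u by (auto simp: VQ_def f_def e_def)
  have D: "det2 f e \<noteq> 0" using fe by (simp add: GL2_def)
  note im = psi_image[OF fe(1), unfolded fe(2)]
  obtain z where z: "z \<in> UNIV \<times> W" "v = psi f e z" using v im(1) by blast
  have u0: "u = psi f e (0, 1, 1)" by (simp add: psi_def fe scl_def prod_eq_iff)
  have "fst z \<noteq> 0"
  proof
    assume "fst z = 0"
    then have "v \<in> psi f e ` ({0} \<times> W)" using z by (intro image_eqI[of v _ z]) auto
    then have "v \<in> {X \<in> VQ Q. ln2 (fst X) = ln2 f}" using im(2) by simp
    then show False using ne fe(3) by simp
  qed
  have nz: "fst (snd z) * snd (snd z) \<noteq> 0" using z by auto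
  have "evk z \<noteq> evk (0, 1, 1)"
    using par ev_mult[OF nz D] unfolding par_def z(2) det2_psi evk_def u0 by auto
  then have par': "evk (0, 1, 1) \<noteq> evk z" by simp
  have w: "(0, 1, 1) \<in> {0} \<times> W" "z \<in> {fst z} \<times> W" "0 \<noteq> fst z"
    using z(1) \<open>fst z \<noteq> 0\<close> by (auto simp: mem_Times_iff)
  obtain p1 p2 p3 where p: "hpath kadj (UNIV \<times> W) (0, 1, 1) (p1 @ p2 @ p3) z" "set p1 = {0} \<times> W"
    using borel_lace[OF m w par'] by blast
  have "hpath radj (psi f e ` (UNIV \<times> W)) (psi f e (0, 1, 1)) (map (psi f e) (p1 @ p2 @ p3)) (psi f e z)"
    by (rule hpath_image[OF p(1) psi_inj[OF D]]) (rule psi_adj)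
  then have "hpath radj (VQ Q) u (map (psi f e) p1 @ map (psi f e) (p2 @ p3)) v"
    unfolding im u0[symmetric] z(2)[symmetric] by simp
  moreover have "set (map (psi f e) p1) = {X \<in> VQ Q. ln2 (fst X) = ln2 (fst u)}"
    using im(2) p(2) by (simp add: f_def)
  ultimately show ?thesis by blast
qed

text \<open>The matrix with rows l rep Q' - rep Q and rep Q is sent to \<open>VQ Q'\<close> by
  adding its rows, and its determinant is l D. The factor \<mu> fixes the character and the even
  powers of \<alpha> keep it. From m = 6 on there are three such powers, hence three tori to choose
  from when \<open>P\<close> and \<open>P'\<close> are excluded.\<close>

lemma ex_port:
  assumes m: "6 \<le> m" and Q: "Q \<noteq> Q'"
  shows "\<exists>X\<in>VQ Q. par X = b \<and> ln2 (fst X) \<noteq> P \<and> ln2 (fst X) \<noteq> P' \<and> mv 1 X \<in> VQ Q'"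
proof -
  define D where "D = det2 (rep Q') (rep Q)"
  have D: "D \<noteq> 0" using ln2_eq_iff[of "rep Q'" "rep Q"] Q by (auto simp: D_def)
  define \<mu> where "\<mu> = (if b then 1 / D else \<alpha> / D)"
  have \<mu>: "\<mu> \<noteq> 0" "ev (\<mu> * D) = b" using D alpha_nz by (auto simp: \<mu>_def)
  define l where "l i = \<mu> * \<alpha> ^ (2 * i)" for i :: nat
  have l: "l i \<noteq> 0" "ev (l i * D) = b" for i
  proof -
    show "l i \<noteq> 0" using \<mu> alpha_nz by (simp add: l_def)
    have e: "l i * D = \<alpha> ^ (2 * i) * (\<mu> * D)" by (simp add: l_def)
    show "ev (l i * D) = b" unfolding e using ev_mult[of "\<alpha> ^ (2 * i)" "\<mu> * D"] \<mu> D alpha_nz by simp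
  qed
  define X where "X i = (scl (l i) (rep Q') - rep Q, rep Q)" for i
  have det: "det2 (fst (X i)) (snd (X i)) = l i * D" for i
    by (simp add: X_def det2_def scl_def D_def algebra_simps)
  have GL: "X i \<in> GL2" for i using l D by (simp add: GL2_def det)
  have VQ: "X i \<in> VQ Q" for i using GL by (simp add: VQ_def X_def)
  have mv: "mv 1 (X i) \<in> VQ Q'" for i
  proof -
    have "snd (mv 1 (X i)) = scl (l i) (rep Q')" by (simp add: mv_def X_def scl_def prod_eq_iff)
    then have "ln2 (snd (mv 1 (X i))) = Q'" using l by (simp add: ln2_scl)
    then show ?thesis using mv_VQ[OF GL, of 1 i] by simp
  qed
  have injl: "l i \<noteq> l j" if "i < j" "j < 3" for i j
  proof
    assume "l i = l j"
    then have "\<alpha> ^ (2 * i) = \<alpha> ^ (2 * j)" using \<mu> by (simp add: l_def)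
    then show False using that m by (simp add: pow_eq_iff)
  qed
  have inj: "inj_on (\<lambda>i. ln2 (fst (X i))) {..<3}"
  proof (rule linorder_inj_onI)
    fix i j :: nat assume ij: "i < j" "i \<in> {..<3}" "j \<in> {..<3}"
    have "det2 (fst (X i)) (fst (X j)) = (l j - l i) * D"
      by (simp add: X_def det2_def scl_def D_def algebra_simps)
    then have "det2 (fst (X i)) (fst (X j)) \<noteq> 0" using injl[of i j] ij D by auto
    then show "ln2 (fst (X i)) \<noteq> ln2 (fst (X j))"
      using ln2_eq_iff[of "fst (X i)" "fst (X j)"] GL2_nz[OF GL[of i]] GL2_nz[OF GL[of j]] by simp
  qed auto
  obtain i where "ln2 (fst (X i)) \<noteq> P" "ln2 (fst (X i)) \<noteq> P'"
    using avoid_two[OF _ inj inj, of P P'] by auto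
  then show ?thesis using VQ mv det l by (intro bexI[of _ "X i"]) (auto simp: par_def)
qed

text \<open>The character changes once per coset, between entry and exit, and \<open>mv\<close>
  preserves it. The port avoids the torus of \<open>x\<close> because \<open>VQ_lace\<close> joins
  different tori only; it avoids the first point of \<open>z\<close> because \<open>mv 1\<close>
  keeps the first row and the same condition arises in the last coset.\<close>

lemma hpath_chain:
  assumes m: "6 \<le> m"
  shows "distinct Qs \<Longrightarrow> 2 \<le> length Qs \<Longrightarrow> x \<in> VQ (hd Qs) \<Longrightarrow> z \<in> VQ (last Qs) \<Longrightarrow>
    par z = (par x = even (length Qs)) \<Longrightarrow> \<exists>p. hpath radj (\<Union>(VQ ` set Qs)) x p z"
proof (induction Qs arbitrary: x)
  case Nil
  then show ?case by simp
next
  case (Cons Q Qs)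
  then obtain Q' Rs where Qs: "Qs = Q' # Rs" by (cases Qs) auto
  have "Q \<noteq> Q'" using Cons.prems Qs by auto
  then obtain X where X: "X \<in> VQ Q" "par X = (\<not> par x)" "ln2 (fst X) \<noteq> ln2 (fst x)"
      "ln2 (fst X) \<noteq> ln2 (fst z)" "mv 1 X \<in> VQ Q'"
    using ex_port[OF m, of Q Q' "\<not> par x" "ln2 (fst x)" "ln2 (fst z)"] by auto
  have m2: "2 < m" using m by simp
  obtain p where p: "hpath radj (VQ Q) x p X"
    using VQ_lace[OF m2, of x Q X] X Cons.prems by auto
  have "\<exists>q. hpath radj (\<Union>(VQ ` set Qs)) (mv 1 X) q z"
  proof (cases "Rs = []")
    case True
    have "ln2 (fst (mv 1 X)) \<noteq> ln2 (fst z)" using X by (simp add: mv_def)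
    moreover have "z \<in> VQ Q'" "par (mv 1 X) \<noteq> par z" using Cons.prems X(2) True Qs by auto
    ultimately show ?thesis using VQ_lace[OF m2 X(5), of z] True Qs by auto
  next
    case False
    then have "2 \<le> length Qs" using Qs by (cases Rs) auto
    then show ?thesis using Cons.IH[of "mv 1 X"] Cons.prems X Qs by auto
  qed
  then obtain q where q: "hpath radj (\<Union>(VQ ` set Qs)) (mv 1 X) q z" by blast
  have "VQ Q \<inter> VQ R = {}" if "R \<in> set Qs" for R using VQ_disj[of Q R] Cons.prems that by auto
  then have "VQ Q \<inter> \<Union>(VQ ` set Qs) = {}" by blast
  from hpath_append[OF p q _ this] radj_mv[of 1 X] show ?case by auto
qed

text \<open>The chain has \<open>card S + 2\<close> members, a number of the same parity as
  \<open>card S\<close>.\<close>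

lemma hpath_chain_set:
  assumes "6 \<le> m" "a \<noteq> b" "a \<notin> S" "b \<notin> S" "x \<in> VQ a" "z \<in> VQ b" "par z = (par x = even (card S))"
  shows "\<exists>p. hpath radj (\<Union>(VQ ` (insert a (insert b S)))) x p z"
proof -
  obtain L where L: "set L = S" "distinct L" using finite_distinct_list[of S] by auto
  then have "length L = card S" by (metis distinct_card)
  moreover have "set (a # L @ [b]) = insert a (insert b S)" using L by auto
  ultimately show ?thesis using hpath_chain[OF assms(1), of "a # L @ [b]" x z] assms L by auto
qed

end

section \<open>Hamilton connectedness of GL_2(q) for odd q >= 7\<close>

context gen_odd
begin

lemma one_neq_minus_one: "2 < m \<Longrightarrow> (1 :: 'a) \<noteq> - 1"
proof
  assume m: "2 < m" and eq: "(1 :: 'a) = - 1"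
  have "(\<alpha> ^ (m div 2))\<^sup>2 = 1" using even_m pow_m by (simp add: power_mult[symmetric])
  then have "\<alpha> ^ (m div 2) = 1" using eq by (metis power2_eq_1_iff)
  then have "\<alpha> ^ (m div 2) = \<alpha> ^ 0" by simp
  then have "(m div 2) mod m = 0" by (simp only: pow_eq_iff) simp
  then show False using m by simp
qed

lemma card_points: "CARD('a option) = m + 2"
  using m_def m_pos by (simp add: card_option)

text \<open>The right coset of the diagonal torus through \<open>u\<close>.\<close>

definition torus :: "('a \<times> 'a) \<times> ('a \<times> 'a) \<Rightarrow> (('a \<times> 'a) \<times> ('a \<times> 'a)) set" where
  "torus u = {X \<in> VQ (ln2 (snd u)). ln2 (fst X) = ln2 (fst u)}"

text \<open>An addition moves one of the two points, so a torus neighbour arises by scaling a row.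
  Scaling the second row by \<beta> acts on exits like scaling the first row by the inverse of
  \<beta>; hence the exits of \<open>z\<close> are those of \<open>u\<close> with coefficient
  multiplied by \<alpha> or its inverse.\<close>

lemma torus_nbr:
  assumes u: "u \<in> GL2" and z: "z \<in> torus u" "radj u z"
  shows "\<exists>\<beta>. (\<beta> = \<alpha> \<or> \<beta> * \<alpha> = 1) \<and> (\<forall>s. ln2 (snd (mv s z)) = ln2 (snd u + scl (s * \<beta>) (fst u)))"
    "par z \<noteq> par u"
proof -
  have uz: "ln2 (fst z) = ln2 (fst u)" "ln2 (snd z) = ln2 (snd u)" using z by (auto simp: torus_def VQ_def)
  have z2: "z \<in> GL2" using z by (auto simp: torus_def VQ_def)
  have nz: "fst u \<noteq> (0, 0)" "snd u \<noteq> (0, 0)" "fst z \<noteq> (0, 0)" "snd z \<noteq> (0, 0)"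
    using GL2_nz[OF u] GL2_nz[OF z2] by auto
  have D: "det2 (fst u) (snd u) \<noteq> 0" using u by (simp add: GL2_def)
  have d0: "det2 (fst z) (fst u) = 0" "det2 (snd z) (snd u) = 0"
    using uz ln2_eq_iff[of "fst z" "fst u"] ln2_eq_iff[of "snd z" "snd u"] nz by simp_all
  have dd: "det2 (fst u + snd u) (fst u) = - det2 (fst u) (snd u)"
    "det2 (fst u - snd u) (fst u) = det2 (fst u) (snd u)"
    "det2 (snd u + fst u) (snd u) = det2 (fst u) (snd u)"
    "det2 (snd u - fst u) (snd u) = - det2 (fst u) (snd u)"
    by (simp_all add: det2_def algebra_simps)
  have n1: "fst z \<noteq> fst u + snd u" "fst z \<noteq> fst u - snd u"
    using d0(1) D dd(1,2) by (metis neg_equal_0_iff_equal)+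
  have n2: "snd z \<noteq> snd u + fst u" "snd z \<noteq> snd u - fst u"
    using d0(2) D dd(3,4) by (metis neg_equal_0_iff_equal)+
  define b where "b = 1 / \<alpha>"
  have b: "b \<noteq> 0" "b * \<alpha> = 1" "\<alpha> * b = 1" using alpha_nz by (simp_all add: b_def)
  have nev: "\<not> ev b" using ev_mult[of b \<alpha>] b alpha_nz by auto
  have inv: "x = scl b y" if "y = scl \<alpha> x" for x y
    using that b by (simp add: scl_def prod_eq_iff mult.assoc[symmetric])
  from z(2) n1 n2 have "snd z = snd u \<and> (fst z = scl \<alpha> (fst u) \<or> fst u = scl \<alpha> (fst z)) \<or>
     fst z = fst u \<and> (snd z = scl \<alpha> (snd u) \<or> snd u = scl \<alpha> (snd z))"
    unfolding radj_def by blast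
  then consider \<beta> where "\<beta> = \<alpha> \<or> \<beta> = b" "snd z = snd u" "fst z = scl \<beta> (fst u)"
    | \<beta> where "\<beta> = \<alpha> \<or> \<beta> = b" "fst z = fst u" "snd z = scl \<beta> (snd u)"
    using inv by metis
  then have "(\<exists>\<beta>. (\<beta> = \<alpha> \<or> \<beta> * \<alpha> = 1) \<and> (\<forall>s. ln2 (snd (mv s z)) = ln2 (snd u + scl (s * \<beta>) (fst u)))) \<and> par z \<noteq> par u"
  proof cases
    case (1 \<beta>)
    have "snd (mv s z) = snd u + scl (s * \<beta>) (fst u)" for s
      using 1 by (simp add: mv_def scl_def mult.assoc)
    moreover have "det2 (fst z) (snd z) = \<beta> * det2 (fst u) (snd u)"
      using 1 by (simp add: det2_def scl_def algebra_simps)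
    moreover have "\<beta> \<noteq> 0" "\<not> ev \<beta>" using 1 b nev alpha_nz by auto
    ultimately show ?thesis using 1 b ev_mult[of \<beta> "det2 (fst u) (snd u)"] D unfolding par_def by auto
  next
    case (2 \<beta>)
    have nzb: "\<beta> \<noteq> 0" "\<not> ev \<beta>" using 2 b nev alpha_nz by auto
    define c where "c = (if \<beta> = \<alpha> then b else \<alpha>)"
    have c: "c = \<alpha> \<or> c * \<alpha> = 1" "\<beta> * c = 1" using 2 b by (auto simp: c_def)
    have "snd (mv s z) = scl \<beta> (snd u + scl (s * c) (fst u))" for s
    proof -
      have "\<beta> * (s * c * y) = s * y" for y
      proof -
        have "\<beta> * (s * c * y) = (\<beta> * c) * (s * y)" by (simp add: ac_simps)
        then show ?thesis using c by simp
      qed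
      then show ?thesis using 2 by (simp add: mv_def scl_def prod_eq_iff distrib_left)
    qed
    then have "ln2 (snd (mv s z)) = ln2 (snd u + scl (s * c) (fst u))" for s using nzb by (simp add: ln2_scl)
    moreover have "det2 (fst z) (snd z) = \<beta> * det2 (fst u) (snd u)"
      using 2 by (simp add: det2_def scl_def algebra_simps)
    ultimately show ?thesis using c(1) nzb ev_mult[of \<beta> "det2 (fst u) (snd u)"] D unfolding par_def by auto
  qed
  then show "\<exists>\<beta>. (\<beta> = \<alpha> \<or> \<beta> * \<alpha> = 1) \<and> (\<forall>s. ln2 (snd (mv s z)) = ln2 (snd u + scl (s * \<beta>) (fst u)))"
    "par z \<noteq> par u" by blast+
qed

text \<open>The points reachable by the exits of torus neighbours of \<open>u\<close>: a bound that
  is available before the neighbour is known.\<close>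

definition exits :: "('a \<times> 'a) \<times> ('a \<times> 'a) \<Rightarrow> 'a option set" where
  "exits u = (\<lambda>c. ln2 (snd u + scl c (fst u))) ` {\<alpha>, - \<alpha>, 1 / \<alpha>, - (1 / \<alpha>)}"

lemma card_exits: "card (exits u) \<le> 4"
  unfolding exits_def by (rule order_trans[OF card_image_le]) (simp_all add: card_insert_if)

text \<open>The second claim holds because the square of \<beta> is not 1, so that the coefficient
  \<open>s * \<beta>\<close> is neither 1 nor -1.\<close>

lemma torus_nbr_exit:
  assumes m: "2 < m" and u: "u \<in> GL2" and z: "z \<in> torus u" "radj u z" and s: "s = 1 \<or> s = - 1"
  shows "ln2 (snd (mv s z)) \<in> exits u"
    "s' = 1 \<or> s' = - 1 \<Longrightarrow> ln2 (snd (mv s z)) \<noteq> ln2 (snd (mv s' u))"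
proof -
  obtain \<beta> where \<beta>: "\<beta> = \<alpha> \<or> \<beta> * \<alpha> = 1" "ln2 (snd (mv s z)) = ln2 (snd u + scl (s * \<beta>) (fst u))"
    using torus_nbr(1)[OF u z] by blast
  have \<beta>': "\<beta> = \<alpha> \<or> \<beta> = 1 / \<alpha>" using \<beta>(1) alpha_nz by (auto simp: field_simps)
  then show "ln2 (snd (mv s z)) \<in> exits u" unfolding exits_def \<beta>(2) using s by auto
  assume s': "s' = 1 \<or> s' = - 1"
  have \<alpha>2: "\<alpha> * \<alpha> \<noteq> 1"
  proof
    assume "\<alpha> * \<alpha> = 1"
    then have "\<alpha> ^ 2 = \<alpha> ^ 0" by (simp add: power2_eq_square)
    then have "2 mod m = 0 mod m" unfolding pow_eq_iff .
    then show False using m by simp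
  qed
  have \<beta>2: "\<beta> * \<beta> \<noteq> 1"
  proof
    assume "\<beta> * \<beta> = 1"
    then have "\<beta> * (\<beta> * \<alpha>) = \<alpha>" by (simp add: mult.assoc[symmetric])
    then have "\<beta> = \<alpha>" using \<beta>(1) by (metis mult.right_neutral)
    then show False using \<alpha>2 \<open>\<beta> * \<beta> = 1\<close> by simp
  qed
  have "s * \<beta> \<noteq> s'"
  proof
    assume "s * \<beta> = s'"
    then have "(s * \<beta>) * (s * \<beta>) = 1" using s' by auto
    then show False using s \<beta>2 by auto
  qed
  then have "ln2 (snd (mv (s * \<beta>) u)) \<noteq> ln2 (snd (mv s' u))" by (rule mv_exit_neq[OF u])
  then show "ln2 (snd (mv s z)) \<noteq> ln2 (snd (mv s' u))" using \<beta>(2) by (simp add: mv_def)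
qed

text \<open>The path begins with the whole torus of \<open>u\<close>. So the vertices next to
  \<open>u\<close>, or before another vertex of this torus, are torus neighbours, whose character
  and exits are under control.\<close>

lemma ex_start:
  assumes m: "2 < m" and u: "u \<in> VQ Q" and b: "b \<noteq> par u" and Q': "Q' \<noteq> Q" and m6: "6 \<le> m"
  shows "\<exists>y p1 p2. y \<in> VQ Q \<and> par y = b \<and> mv 1 y \<in> VQ Q' \<and> hpath radj (VQ Q) u (p1 @ p2) y \<and>
    set p1 = torus u"
proof -
  obtain y where y: "y \<in> VQ Q" "par y = b" "ln2 (fst y) \<noteq> ln2 (fst u)" "mv 1 y \<in> VQ Q'"
    using ex_port[OF m6 Q'[symmetric], of b] by metis
  have "ln2 (snd u) = Q" using u by (simp add: VQ_def)
  moreover have "par u \<noteq> par y" using y(2) b by auto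
  ultimately obtain p1 p2 where "hpath radj (VQ Q) u (p1 @ p2) y" "set p1 = torus u"
    using VQ_lace[OF m u y(1) y(3)[symmetric]] unfolding torus_def by blast
  then show ?thesis using y(1,2,4) by blast
qed

text \<open>The torus contains a second vertex, for instance \<open>u\<close> with its first row
  scaled by \<alpha>, so the prefix continues after \<open>u\<close> inside the torus.\<close>

lemma torus_second:
  assumes m: "2 < m" and u: "u \<in> GL2" and p: "hpath radj (VQ Q) u (p1 @ p2) y" "set p1 = torus u"
  shows "\<exists>z p1'. p1 = u # z # p1' \<and> z \<in> torus u \<and> radj u z"
proof -
  let ?u' = "(scl \<alpha> (fst u), snd u)"
  have \<alpha>1: "\<alpha> \<noteq> 1" using ev_alpha ev_one by metis
  have "det2 (scl \<alpha> (fst u)) (snd u) = \<alpha> * det2 (fst u) (snd u)"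
    by (simp add: det2_def scl_def algebra_simps)
  then have "?u' \<in> torus u" using u alpha_nz by (simp add: torus_def VQ_def GL2_def ln2_scl)
  moreover have "?u' \<noteq> u" using GL2_nz[OF u] \<alpha>1 by (auto simp: scl_def prod_eq_iff)
  moreover have "u \<in> torus u" using u by (simp add: torus_def VQ_def)
  ultimately have "u \<in> set p1" "?u' \<in> set p1" "?u' \<noteq> u" using p(2) by auto
  moreover have "hd (p1 @ p2) = u" using p(1) by (simp add: hpath_def)
  ultimately obtain z p1' where eq: "p1 = u # z # p1'"
    by (cases p1; cases "tl p1") auto
  then show ?thesis using p by (auto simp: hpath_def)
qed

lemma torus_pred:
  assumes p: "hpath radj (VQ Q) u (p1 @ p2) y" "set p1 = torus u" and v: "v \<in> torus u" "v \<noteq> u"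
  shows "\<exists>r w b. p1 = r @ w # v # b \<and> w \<in> torus u \<and> radj w v"
proof -
  obtain a b where ab: "p1 = a @ v # b" using v p(2) by (metis split_list)
  have "a \<noteq> []"
    using ab p(1) v(2) by (auto simp: hpath_def)
  then obtain r w where a: "a = r @ [w]" by (metis rev_exhaust)
  have "successively radj (r @ w # v # (b @ p2))" using p(1) ab a by (simp add: hpath_def)
  then have "radj w v" by (simp add: successively_append_iff)
  moreover have "w \<in> torus u" using p(2) ab a by auto
  moreover have "p1 = r @ w # v # b" using ab a by simp
  ultimately show ?thesis by blast
qed

lemma mv_exit1:
  assumes "X \<in> VQ Q" "s = 1 \<or> s = - (1 :: 'a)"
  shows "ln2 (snd (mv s X)) \<noteq> Q"
proof -
  have "s \<noteq> 0" using assms(2) by auto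
  then show ?thesis by (rule mv_exit[OF assms(1)])
qed

lemma VQ_dis1: "Q \<notin> A \<Longrightarrow> VQ Q \<inter> \<Union>(VQ ` A) = {}"
  by (auto simp: VQ_def)

lemma VQ_dis2: "A \<inter> B = {} \<Longrightarrow> \<Union>(VQ ` A) \<inter> \<Union>(VQ ` B) = {}"
  by (auto simp: VQ_def)

lemma card_Compl_points: "card (- A) = m + 2 - card A" for A :: "'a option set"
  unfolding Compl_eq_Diff_UNIV card_points[symmetric] by (rule card_Diff_subset) simp_all

lemma torus_GL2: "X \<in> torus u \<Longrightarrow> X \<in> GL2 \<and> ln2 (snd X) = ln2 (snd u) \<and> torus X = torus u"
  by (auto simp: torus_def VQ_def)

text \<open>With equal characters a single chain visits all m + 2 cosets, an even number. Otherwise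
  \<open>u\<close> exits at once to \<open>R\<close>, and a chain of m - 1 cosets, an odd number,
  ends in \<open>Q2\<close> next to \<open>y\<close>. The rest of the coset of \<open>u\<close> is
  traversed backwards from \<open>y\<close> to \<open>z\<close>, the successor of \<open>u\<close>,
  and the cosets \<open>P\<close> and \<open>Q'\<close> lead from there to \<open>v\<close>.\<close>

lemma hpath_GL2_distinct:
  assumes m: "6 \<le> m" and u: "u \<in> VQ Q" and v: "v \<in> VQ Q'" and Q: "Q \<noteq> Q'"
  shows "\<exists>p. hpath radj GL2 u p v"
proof (cases "par u = par v")
  case True
  have "card (- {Q, Q'}) = m" using Q by (simp add: card_Compl_points)
  then have "\<exists>p. hpath radj (\<Union>(VQ ` (insert Q (insert Q' (- {Q, Q'}))))) u p v"
    by (intro hpath_chain_set[OF m Q _ _ u v]) (use True even_m in auto)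
  moreover have "insert Q (insert Q' (- {Q, Q'})) = UNIV" by auto
  ultimately show ?thesis by (simp add: VQ_Union)
next
  case False
  have m2: "2 < m" using m by simp
  have uG: "u \<in> GL2" "ln2 (snd u) = Q" using u by (auto simp: VQ_def)
  note one = one_neq_minus_one[OF m2]
  obtain s0 :: 'a where s0: "s0 = 1 \<or> s0 = - 1" "ln2 (snd (mv s0 u)) \<noteq> Q'"
    using mv_exit_neq[OF uG(1) one] by metis
  define R where "R = ln2 (snd (mv s0 u))"
  have RQ: "R \<noteq> Q" unfolding R_def using mv_exit1[OF u s0(1)] .
  \<comment> \<open>\<open>Q2\<close> determines the path and thereby \<open>z\<close>, so the exit
    \<open>P\<close> of \<open>z\<close> is not yet known here. Excluding the at most four points of
    \<open>exits u\<close> ensures that it will differ from \<open>Q2\<close>.\<close>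
  have "card ({Q, Q', R} \<union> exits u) \<le> 3 + 4"
    by (rule order_trans[OF card_Un_le add_mono[OF _ card_exits]]) (simp_all add: card_insert_if)
  then have "card ({Q, Q', R} \<union> exits u) < CARD('a option)" using card_points m by simp
  then obtain Q2 where Q2: "Q2 \<notin> {Q, Q', R} \<union> exits u"
    by (metis UNIV_eq_I less_irrefl)
  obtain y p1 p2 where y: "y \<in> VQ Q" "par y = (\<not> par u)" "mv 1 y \<in> VQ Q2"
      "hpath radj (VQ Q) u (p1 @ p2) y" "set p1 = torus u"
    using ex_start[OF m2 u, of "\<not> par u" Q2] m Q2 by auto
  obtain z p1' where z: "p1 = u # z # p1'" "z \<in> torus u" "radj u z"
    using torus_second[OF m2 uG(1) y(4,5)] by blast
  have zG: "z \<in> GL2" "ln2 (snd z) = Q" using torus_GL2[OF z(2)] uG by auto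
  have zQ: "z \<in> VQ Q" using zG by (simp add: VQ_def)
  obtain s :: 'a where s: "s = 1 \<or> s = - 1" "ln2 (snd (mv s z)) \<noteq> Q'"
    using mv_exit_neq[OF zG(1) one] by metis
  define P where "P = ln2 (snd (mv s z))"
  have P: "P \<noteq> Q'" "P \<noteq> Q" "P \<noteq> R" "P \<noteq> Q2" "P \<in> exits u"
    unfolding P_def R_def using s mv_exit1[OF zQ s(1)] torus_nbr_exit[OF m2 uG(1) z(2,3) s(1)] s0(1) Q2 by auto
  have parz: "par z = (\<not> par u)" using torus_nbr(2)[OF uG(1) z(2,3)] by simp
  let ?S = "- {Q, Q', R, Q2, P}"
  have "card {Q, Q', R, Q2, P} = 5" using P Q2 RQ Q s0 R_def by auto
  then have "card ?S = m - 3" by (simp add: card_Compl_points)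
  then have odd: "odd (card ?S)" using even_m m by simp
  have R': "mv s0 u \<in> VQ R" unfolding R_def using mv_VQ[OF uG(1)] .
  have "R \<noteq> Q2" using Q2 by auto
  then obtain q1 where q1: "hpath radj (\<Union>(VQ ` (insert R (insert Q2 ?S)))) (mv s0 u) q1 (mv 1 y)"
    using hpath_chain_set[OF m _ _ _ R' y(3), of ?S] odd y(2) by auto
  have P': "mv s z \<in> VQ P" unfolding P_def using mv_VQ[OF zG(1)] .
  obtain q2 where q2: "hpath radj (\<Union>(VQ ` (insert P (insert Q' {})))) (mv s z) q2 v"
    using hpath_chain_set[OF m P(1) _ _ P' v, of "{}"] parz False by auto
  have sp: "hpath radj (VQ Q) u ([u] @ (z # p1' @ p2)) y" using y(4) z(1) by simp
  note sp' = hpath_split[OF sp, simplified]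
  let ?Z = "set (z # p1' @ p2)"
  have rz: "hpath radj ?Z y (rev (z # p1' @ p2)) z"
    by (rule hpath_rev[OF symp_radj]) (use sp'(2) in simp)
  have VQd: "VQ Q = insert u ?Z" "u \<notin> ?Z" using sp' by auto
  have dis: "VQ Q \<inter> \<Union>(VQ ` A) = {}" if "Q \<notin> A" for A
    using VQ_dis1[OF that] .
  have disAB: "\<Union>(VQ ` A) \<inter> \<Union>(VQ ` B) = {}" if "A \<inter> B = {}" for A B
    using VQ_dis2[OF that] .
  let ?A = "insert R (insert Q2 ?S)" and ?B = "insert P (insert Q' {})"
  have A: "Q \<notin> ?A" and B: "Q \<notin> ?B" and AB: "?A \<inter> ?B = {}" and ABQ: "insert Q (?A \<union> ?B) = UNIV"
    using RQ P Q Q2 s0 R_def by auto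
  have e1: "radj u (mv s0 u)" "radj (mv 1 y) y" "radj z (mv s z)" using radj_mv s0 s by auto
  have h1: "hpath radj ({u} \<union> \<Union>(VQ ` ?A)) u ([u] @ q1) (mv 1 y)"
    by (rule hpath_append[OF hpath_single q1 e1(1)]) (use dis[OF A] VQd in auto)
  have h2: "hpath radj (({u} \<union> \<Union>(VQ ` ?A)) \<union> ?Z) u (([u] @ q1) @ rev (z # p1' @ p2)) z"
    by (rule hpath_append[OF h1 rz e1(2)]) (use dis[OF A] VQd in auto)
  have h3: "hpath radj ((({u} \<union> \<Union>(VQ ` ?A)) \<union> ?Z) \<union> \<Union>(VQ ` ?B)) u
      ((([u] @ q1) @ rev (z # p1' @ p2)) @ q2) v"
    by (rule hpath_append[OF h2 q2 e1(3)]) (use dis[OF B] disAB[OF AB] VQd in blast)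
  have "(({u} \<union> \<Union>(VQ ` ?A)) \<union> ?Z) \<union> \<Union>(VQ ` ?B) = \<Union>(VQ ` (insert Q (?A \<union> ?B)))"
    using VQd(1) by auto
  also have "\<dots> = GL2" unfolding ABQ VQ_Union ..
  finally show ?thesis using h3 by metis
qed

text \<open>A coset path from \<open>u\<close> to \<open>y\<close> meets \<open>v\<close> inside the
  first torus, right after a torus neighbour \<open>w\<close> of \<open>v\<close>. If the characters
  of \<open>u\<close> and \<open>v\<close> differ, the path follows it up to \<open>w\<close>,
  visits all other cosets, an odd number, enters \<open>y\<close> and returns to \<open>v\<close>.
  If they agree, \<open>w\<close> and \<open>y\<close> have equal character, so the detour between
  them must be even: it takes two cosets, and the other m - 1 are inserted between \<open>u\<close>
  and its successor \<open>g\<close>.\<close>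

lemma hpath_GL2_torus:
  assumes m: "6 \<le> m" and u: "u \<in> GL2" and v: "v \<in> torus u" and uv: "u \<noteq> v"
  shows "\<exists>p. hpath radj GL2 u p v"
proof -
  define Q where "Q = ln2 (snd u)"
  have m2: "2 < m" using m by simp
  have uQ: "u \<in> VQ Q" using u by (simp add: VQ_def Q_def)
  have vG: "v \<in> GL2" using v torus_GL2 by blast
  note one = one_neq_minus_one[OF m2]
  have dis: "VQ Q \<inter> \<Union>(VQ ` A) = {}" if "Q \<notin> A" for A
    using VQ_dis1[OF that] .
  have tQ: "X \<in> VQ Q" if "X \<in> torus u" for X using that by (auto simp: torus_def Q_def)
  show ?thesis
  proof (cases "par u = par v")
    case False
    have "card {Q} < CARD('a option)" using card_points by simp
    then obtain Q2 where Q2: "Q2 \<noteq> Q" by (metis UNIV_eq_I insertCI less_irrefl singletonD)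
    obtain y p1 p2 where y: "y \<in> VQ Q" "par y = (\<not> par u)" "mv 1 y \<in> VQ Q2"
        "hpath radj (VQ Q) u (p1 @ p2) y" "set p1 = torus u"
      using ex_start[OF m2 uQ, of "\<not> par u" Q2] m Q2 by auto
    obtain r w b where w: "p1 = r @ w # v # b" "w \<in> torus u" "radj w v"
      using torus_pred[OF y(4,5) v uv[symmetric]] by blast
    have wG: "w \<in> GL2" "w \<in> VQ Q" using w(2) torus_GL2 tQ by auto
    have "v \<in> torus w" using v torus_GL2[OF w(2)] by simp
    then have parw: "par w = par u" using torus_nbr(2)[OF wG(1) _ w(3)] False by simp
    obtain s :: 'a where s: "s = 1 \<or> s = - 1" "ln2 (snd (mv s w)) \<noteq> Q2"
      using mv_exit_neq[OF wG(1) one] by metis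
    define P where "P = ln2 (snd (mv s w))"
    have P: "P \<noteq> Q2" "P \<noteq> Q" "mv s w \<in> VQ P"
      unfolding P_def using s mv_exit1[OF wG(2) s(1)] mv_VQ[OF wG(1)] by auto
    let ?S = "- {Q, Q2, P}"
    have "card ?S = m - 1" using P Q2 by (simp add: card_Compl_points)
    then have odd: "odd (card ?S)" using even_m m by simp
    let ?A = "insert P (insert Q2 ?S)"
    obtain q where q: "hpath radj (\<Union>(VQ ` ?A)) (mv s w) q (mv 1 y)"
      using hpath_chain_set[OF m P(1) _ _ P(3) y(3), of ?S] odd y(2) parw by auto
    have sp: "hpath radj (VQ Q) u ((r @ [w]) @ (v # b @ p2)) y" using y(4) w(1) by simp
    note sp' = hpath_split[OF sp, simplified]
    have h1: "hpath radj (set (r @ [w])) u (r @ [w]) w" using sp'(1) by simp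
    have h2: "hpath radj (set (v # b @ p2)) y (rev (v # b @ p2)) v"
      by (rule hpath_rev[OF symp_radj]) (use sp'(2) in simp)
    have VQd: "VQ Q = set (r @ [w]) \<union> set (v # b @ p2)" "set (r @ [w]) \<inter> set (v # b @ p2) = {}"
      using sp' by auto
    have A: "Q \<notin> ?A" "insert Q ?A = UNIV" using P Q2 by auto
    have e: "radj w (mv s w)" "radj (mv 1 y) y" using radj_mv s by auto
    have h3: "hpath radj (set (r @ [w]) \<union> \<Union>(VQ ` ?A)) u ((r @ [w]) @ q) (mv 1 y)"
      by (rule hpath_append[OF h1 q e(1)]) (use dis[OF A(1)] VQd in blast)
    have h4: "hpath radj ((set (r @ [w]) \<union> \<Union>(VQ ` ?A)) \<union> set (v # b @ p2)) u (((r @ [w]) @ q) @ rev (v # b @ p2)) v"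
      by (rule hpath_append[OF h3 h2 e(2)]) (use dis[OF A(1)] VQd in blast)
    have "(set (r @ [w]) \<union> \<Union>(VQ ` ?A)) \<union> set (v # b @ p2) = \<Union>(VQ ` (insert Q ?A))"
      using VQd(1) by blast
    also have "\<dots> = GL2" unfolding A VQ_Union ..
    finally show ?thesis using h4 by metis
  next
    case True
    let ?e = "\<lambda>s X. ln2 (snd (mv s X))"
    have "card ({Q, ?e 1 u, ?e (- 1) u} \<union> exits u) \<le> 3 + 4"
      by (rule order_trans[OF card_Un_le add_mono[OF _ card_exits]]) (simp_all add: card_insert_if)
    then have "card ({Q, ?e 1 u, ?e (- 1) u} \<union> exits u) < CARD('a option)" using card_points m by simp
    then obtain Q2 where Q2: "Q2 \<notin> {Q, ?e 1 u, ?e (- 1) u} \<union> exits u"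
      by (metis UNIV_eq_I less_irrefl)
    obtain y p1 p2 where y: "y \<in> VQ Q" "par y = (\<not> par u)" "mv 1 y \<in> VQ Q2"
        "hpath radj (VQ Q) u (p1 @ p2) y" "set p1 = torus u"
      using ex_start[OF m2 uQ, of "\<not> par u" Q2] m Q2 by auto
    obtain r w b where w: "p1 = r @ w # v # b" "w \<in> torus u" "radj w v"
      using torus_pred[OF y(4,5) v uv[symmetric]] by blast
    have wG: "w \<in> GL2" "w \<in> VQ Q" using w(2) torus_GL2 tQ by auto
    have "v \<in> torus w" using v torus_GL2[OF w(2)] by simp
    then have parw: "par w = (\<not> par u)" using torus_nbr(2)[OF wG(1) _ w(3)] True by auto
    obtain g p1' where g: "p1 = u # g # p1'" "g \<in> torus u" "radj u g"
      using torus_second[OF m2 u y(4,5)] by blast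
    have gG: "g \<in> GL2" "g \<in> VQ Q" using g(2) torus_GL2 tQ by auto
    have parg: "par g = (\<not> par u)" using torus_nbr(2)[OF u g(2,3)] by simp
    have "w \<noteq> u" using parw by auto
    then obtain r' where r: "r = u # r'" "hd (r' @ [w]) = g"
      using w(1) g(1) by (cases r; cases "tl r") auto
    \<comment> \<open>Each vertex has two exits, so each choice can avoid one point. In this order
      one point is enough: \<open>Q2\<close> is already no exit of \<open>u\<close> or
      \<open>g\<close>, and the exits of \<open>g\<close> differ from those of
      \<open>u\<close>.\<close>
    obtain sw :: 'a where sw: "sw = 1 \<or> sw = - 1" "?e sw w \<noteq> Q2"
      using mv_exit_neq[OF wG(1) one] by metis
    obtain su :: 'a where su: "su = 1 \<or> su = - 1" "?e su u \<noteq> ?e sw w"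
      using mv_exit_neq[OF u one] by metis
    obtain sg :: 'a where sg: "sg = 1 \<or> sg = - 1" "?e sg g \<noteq> ?e sw w"
      using mv_exit_neq[OF gG(1) one] by metis
    define Pw Pu Pg where "Pw = ?e sw w" and "Pu = ?e su u" and "Pg = ?e sg g"
    have Pw: "Pw \<noteq> Q2" "Pw \<noteq> Q" "mv sw w \<in> VQ Pw"
      unfolding Pw_def using sw mv_exit1[OF wG(2) sw(1)] mv_VQ[OF wG(1)] by auto
    have Pu: "Pu \<noteq> Pw" "Pu \<noteq> Q" "Pu \<noteq> Q2" "mv su u \<in> VQ Pu"
      unfolding Pw_def Pu_def using su mv_exit1[OF uQ su(1)] mv_VQ[OF u] Q2 by auto
    have Pg: "Pg \<noteq> Pw" "Pg \<noteq> Q" "Pg \<noteq> Pu" "Pg \<noteq> Q2" "mv sg g \<in> VQ Pg"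
      unfolding Pw_def Pg_def Pu_def
      using sg mv_exit1[OF gG(2) sg(1)] mv_VQ[OF gG(1)] torus_nbr_exit[OF m2 u g(2,3) sg(1)] su(1) Q2 by auto
    let ?S = "- {Q, Pu, Pg, Pw, Q2}"
    have "card {Q, Pu, Pg, Pw, Q2} = 5" using Pw Pu Pg Q2 by auto
    then have "card ?S = m - 3" by (simp add: card_Compl_points)
    then have odd: "odd (card ?S)" using even_m m by simp
    let ?A = "insert Pu (insert Pg ?S)" and ?B = "insert Pw (insert Q2 {})"
    obtain q1 where q1: "hpath radj (\<Union>(VQ ` ?A)) (mv su u) q1 (mv sg g)"
      using hpath_chain_set[OF m Pg(3)[symmetric] _ _ Pu(4) Pg(5), of ?S] odd parg by auto
    obtain q2 where q2: "hpath radj (\<Union>(VQ ` ?B)) (mv sw w) q2 (mv 1 y)"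
      using hpath_chain_set[OF m Pw(1) _ _ Pw(3) y(3), of "{}"] y(2) parw by auto
    have sp: "hpath radj (VQ Q) u ([u] @ ((r' @ [w]) @ (v # b @ p2))) y" using y(4) w(1) r(1) by simp
    note sp1 = hpath_split[OF sp, simplified]
    have "hpath radj (set ((r' @ [w]) @ (v # b @ p2))) g ((r' @ [w]) @ (v # b @ p2)) y"
      using sp1(2) r(2) by (cases r') (simp_all add: insert_commute)
    note sp2 = hpath_split[OF this, simplified]
    have h1: "hpath radj (set (r' @ [w])) g (r' @ [w]) w" using sp2(1) by simp
    have h2: "hpath radj (set (v # b @ p2)) y (rev (v # b @ p2)) v"
      by (rule hpath_rev[OF symp_radj]) (use sp2(2) in simp)
    let ?C = "set (r' @ [w])" and ?D = "set (v # b @ p2)"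
    have VQd: "VQ Q = {u} \<union> ?C \<union> ?D" "u \<notin> ?C" "u \<notin> ?D" "?C \<inter> ?D = {}"
      using sp1 sp2 by auto
    have A: "Q \<notin> ?A" "Q \<notin> ?B" "?A \<inter> ?B = {}" "insert Q (?A \<union> ?B) = UNIV" using Pu Pg Pw Q2 by auto
    have disAB: "\<Union>(VQ ` ?A) \<inter> \<Union>(VQ ` ?B) = {}" using VQ_dis2[OF A(3)] .
    have e: "radj u (mv su u)" "radj (mv sg g) g" "radj w (mv sw w)" "radj (mv 1 y) y"
      using radj_mv su sg sw by auto
    have k1: "hpath radj ({u} \<union> \<Union>(VQ ` ?A)) u ([u] @ q1) (mv sg g)"
      by (rule hpath_append[OF hpath_single q1 e(1)]) (use dis[OF A(1)] VQd in blast)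
    have k2: "hpath radj (({u} \<union> \<Union>(VQ ` ?A)) \<union> ?C) u (([u] @ q1) @ (r' @ [w])) w"
      by (rule hpath_append[OF k1 h1 e(2)]) (use dis[OF A(1)] VQd in blast)
    have k3: "hpath radj ((({u} \<union> \<Union>(VQ ` ?A)) \<union> ?C) \<union> \<Union>(VQ ` ?B)) u ((([u] @ q1) @ (r' @ [w])) @ q2) (mv 1 y)"
      by (rule hpath_append[OF k2 q2 e(3)]) (use dis[OF A(2)] disAB VQd in blast)
    have k4: "hpath radj (((({u} \<union> \<Union>(VQ ` ?A)) \<union> ?C) \<union> \<Union>(VQ ` ?B)) \<union> ?D) u
        (((([u] @ q1) @ (r' @ [w])) @ q2) @ rev (v # b @ p2)) v"
    proof (rule hpath_append[OF k3 h2 e(4)])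
      have "?D \<subseteq> VQ Q" using VQd(1) by blast
      then have d: "\<Union>(VQ ` ?A) \<inter> ?D = {}" "\<Union>(VQ ` ?B) \<inter> ?D = {}" "{u} \<inter> ?D = {}"
        using dis[OF A(1)] dis[OF A(2)] VQd(3) by blast+
      show "((({u} \<union> \<Union>(VQ ` ?A)) \<union> ?C) \<union> \<Union>(VQ ` ?B)) \<inter> ?D = {}"
        by (simp only: Int_Un_distrib2 d VQd(4) Un_empty_left)
    qed
    have "((({u} \<union> \<Union>(VQ ` ?A)) \<union> ?C) \<union> \<Union>(VQ ` ?B)) \<union> ?D = VQ Q \<union> (\<Union>(VQ ` ?A) \<union> \<Union>(VQ ` ?B))"
      unfolding VQd(1) by (simp only: ac_simps Un_left_absorb)
    also have "\<dots> = \<Union>(VQ ` (insert Q (?A \<union> ?B)))" by (simp only: UN_insert UN_Un image_Un Union_Un_distrib)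
    also have "\<dots> = GL2" unfolding A(4) VQ_Union ..
    finally show ?thesis using k4 by metis
  qed
qed

lemma hconn_GL2_odd:
  assumes m: "6 \<le> m"
  shows "hconn radj (GL2 :: (('a \<times> 'a) \<times> ('a \<times> 'a)) set)"
  unfolding hconn_def
proof (intro ballI impI)
  fix u v :: "('a \<times> 'a) \<times> ('a \<times> 'a)" assume u: "u \<in> GL2" and v: "v \<in> GL2" and uv: "u \<noteq> v"
  show "\<exists>p. hpath radj GL2 u p v"
  proof (cases "ln2 (snd u) = ln2 (snd v)")
    case False
    then show ?thesis using hpath_GL2_distinct[OF m, of u "ln2 (snd u)" v "ln2 (snd v)"] u v by (simp add: VQ_def)
  next
    case snd: True
    show ?thesis
    proof (cases "ln2 (fst u) = ln2 (fst v)")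
      case True
      then have "v \<in> torus u" using snd v by (simp add: torus_def VQ_def)
      then show ?thesis using hpath_GL2_torus[OF m u _ uv] by blast
    next
      case False
      \<comment> \<open>Exchanging the two rows preserves \<open>radj\<close>, and it reduces
        different first points to different second points.\<close>
      have sw: "prod.swap X \<in> GL2 \<longleftrightarrow> X \<in> GL2" for X :: "('a \<times> 'a) \<times> ('a \<times> 'a)"
      proof -
        have "det2 (snd X) (fst X) = - det2 (fst X) (snd X)" by (simp add: det2_def algebra_simps)
        then show ?thesis by (simp add: GL2_def)
      qed
      obtain p where p: "hpath radj GL2 (prod.swap u) p (prod.swap v)"
        using hpath_GL2_distinct[OF m, of "prod.swap u" "ln2 (fst u)" "prod.swap v" "ln2 (fst v)"] u v sw False
        by (auto simp: VQ_def)
      have "hpath radj (prod.swap ` GL2) (prod.swap (prod.swap u)) (map prod.swap p) (prod.swap (prod.swap v))"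
        by (rule hpath_image[OF p]) (auto simp: radj_def)
      moreover have "prod.swap ` GL2 = (GL2 :: (('a \<times> 'a) \<times> ('a \<times> 'a)) set)"
      proof
        show "prod.swap ` GL2 \<subseteq> (GL2 :: (('a \<times> 'a) \<times> ('a \<times> 'a)) set)" using sw by blast
        show "(GL2 :: (('a \<times> 'a) \<times> ('a \<times> 'a)) set) \<subseteq> prod.swap ` GL2"
        proof
          fix X :: "('a \<times> 'a) \<times> ('a \<times> 'a)" assume "X \<in> GL2"
          then show "X \<in> prod.swap ` GL2" using sw by (intro image_eqI[of X _ "prod.swap X"]) auto
        qed
      qed
      ultimately show ?thesis by auto
    qed
  qed
qed

end

section \<open>Fields with three and five elements\<close>

definition nadj :: "nat \<Rightarrow> nat \<Rightarrow> nat \<Rightarrow> bool" where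
  "nadj p x y \<longleftrightarrow>
     x mod p = y mod p \<and> (y div p = 2 * (x div p) mod p \<or> x div p = 2 * (y div p) mod p) \<or>
     x div p = y div p \<and> (y mod p = (x mod p + x div p) mod p \<or> x mod p = (y mod p + x div p) mod p)"

text \<open>The pair \<open>(t, d)\<close> of residues modulo \<open>p\<close> is encoded as the number \<open>t + p d\<close>.\<close>

definition affine_cert :: "nat \<Rightarrow> nat list \<Rightarrow> bool" where
  "affine_cert p P \<longleftrightarrow> P \<noteq> [] \<and> hd P = p \<and> distinct P \<and> length P = p * (p - 1) \<and>
     list_all (\<lambda>x. p \<le> x \<and> x < p * p) P \<and> successively (nadj p) P"

text \<open>Paths from \<open>p\<close>, the code of (0, 1), to all other vertices; the action of
  the affine group on itself supplies the other starting points.\<close>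

definition affine_certs :: "nat \<Rightarrow> nat list list \<Rightarrow> bool" where
  "affine_certs p Ps \<longleftrightarrow>
     list_all (affine_cert p) Ps \<and> list_all (\<lambda>x. x = p \<or> x \<in> set (map last Ps)) [p..<p * p]"

lemma affine_certs_3: "affine_certs 3
    [[3, 4, 5, 8, 7, 6],
     [3, 6, 7, 8, 5, 4],
     [3, 6, 8, 5, 4, 7],
     [3, 6, 8, 7, 4, 5],
     [3, 6, 7, 4, 5, 8]]"
  by code_simp

lemma affine_certs_5: "affine_certs 5
    [[5, 15, 20, 21, 11, 6, 16, 18, 8, 7, 17, 22, 12, 14, 9, 19, 24, 23, 13, 10],
     [5, 10, 20, 21, 11, 6, 7, 17, 22, 12, 14, 9, 8, 13, 23, 24, 19, 16, 18, 15],
     [5, 10, 12, 7, 6, 11, 13, 8, 18, 15, 17, 22, 23, 24, 14, 9, 19, 16, 21, 20],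
     [5, 10, 20, 15, 17, 7, 12, 22, 21, 11, 13, 8, 18, 23, 24, 14, 9, 19, 16, 6],
     [5, 10, 20, 15, 17, 7, 6, 16, 21, 22, 12, 14, 9, 19, 24, 23, 18, 8, 13, 11],
     [5, 10, 20, 15, 17, 7, 6, 11, 21, 22, 12, 14, 9, 19, 24, 23, 13, 8, 18, 16],
     [5, 10, 20, 15, 17, 7, 6, 11, 13, 8, 9, 19, 16, 18, 23, 24, 14, 12, 22, 21],
     [5, 10, 20, 15, 17, 22, 21, 11, 6, 16, 18, 23, 13, 8, 9, 19, 24, 14, 12, 7],
     [5, 10, 20, 15, 17, 7, 6, 11, 13, 8, 18, 16, 21, 22, 23, 24, 19, 9, 14, 12],
     [5, 10, 20, 15, 18, 16, 6, 11, 21, 22, 12, 7, 8, 13, 23, 24, 14, 9, 19, 17],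
     [5, 10, 20, 15, 17, 7, 6, 11, 21, 16, 18, 8, 13, 23, 24, 19, 9, 14, 12, 22],
     [5, 10, 20, 15, 17, 7, 6, 11, 13, 23, 18, 16, 21, 22, 12, 14, 24, 19, 9, 8],
     [5, 10, 20, 15, 17, 7, 6, 11, 21, 16, 18, 8, 9, 19, 24, 14, 12, 22, 23, 13],
     [5, 10, 20, 15, 17, 7, 6, 11, 21, 22, 12, 14, 9, 8, 13, 23, 24, 19, 16, 18],
     [5, 10, 20, 15, 17, 7, 6, 11, 13, 8, 18, 16, 21, 22, 12, 14, 9, 19, 24, 23],
     [5, 10, 20, 15, 17, 7, 6, 11, 21, 16, 18, 8, 13, 23, 22, 12, 14, 24, 19, 9],
     [5, 10, 20, 15, 17, 7, 6, 11, 13, 8, 9, 19, 24, 23, 18, 16, 21, 22, 12, 14],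
     [5, 10, 20, 15, 17, 7, 6, 11, 13, 8, 9, 14, 12, 22, 21, 16, 18, 23, 24, 19],
     [5, 10, 20, 15, 17, 7, 6, 11, 21, 16, 18, 8, 13, 23, 22, 12, 14, 9, 19, 24]]"
  by code_simp

lemma affine_cert_hpath:
  assumes "affine_cert p P"
  shows "hpath (nadj p) {p..<p * p} p P (last P)"
proof -
  have sub: "set P \<subseteq> {p..<p * p}" using assms by (auto simp: affine_cert_def list_all_iff)
  have "card (set P) = p * (p - 1)" using assms by (simp add: affine_cert_def distinct_card)
  also have "\<dots> = card {p..<p * p}" by (simp add: diff_mult_distrib2)
  finally have "set P = {p..<p * p}" using sub by (simp add: card_subset_eq)
  then show ?thesis using assms by (simp add: affine_cert_def hpath_def)
qed

lemma affine_certs_hpath: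
  assumes "affine_certs p Ps" "x \<in> {p..<p * p}" "x \<noteq> p"
  shows "\<exists>P. hpath (nadj p) {p..<p * p} p P x"
proof -
  have "x \<in> set (map last Ps)" using assms by (auto simp: affine_certs_def list_all_iff)
  then obtain P where "P \<in> set Ps" "x = last P" by auto
  then show ?thesis using assms affine_cert_hpath by (auto simp: affine_certs_def list_all_iff)
qed

section \<open>GL_2(q) for even q, for q = 3 and for q = 5\<close>

context gen
begin

definition ladj :: "'a \<times> 'a \<Rightarrow> 'a \<times> 'a \<Rightarrow> bool" where
  "ladj x y \<longleftrightarrow> fst x = fst y \<and> fadj (snd x) (snd y) \<or>
     snd x = snd y \<and> (fst y = fst x + snd x \<or> fst y = fst x - snd x)"

text \<open>\<open>ladj\<close> is a Cayley graph of the affine group of the line. The certificates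
  double the second coordinate; this is a generator step or its inverse since 2 is a primitive root
  modulo 3 and 5 and the only other one, 3 modulo 5, is its inverse. The automorphism
  \<open>g\<close> moves (0, 1) to \<open>u\<close>.\<close>

lemma hconn_ladj_small:
  assumes p: "prime p" "CARD('a) = p" and cert: "affine_certs p Ps"
    and two: "\<alpha> = 2 \<or> 2 * \<alpha> = 1"
  shows "hconn ladj (UNIV \<times> (- {0}))"
proof -
  have "CHAR('a) dvd p" using CHAR_dvd_CARD[where 'a = 'a] p(2) by simp
  moreover have "CHAR('a) \<noteq> 1" using CHAR_not_1'[where 'a = 'a] by simp
  ultimately have char: "CHAR('a) = p" using p(1) by (metis prime_nat_iff)
  have p1: "1 < p" using p(1) prime_gt_1_nat by blast
  have eq: "(of_nat i :: 'a) = of_nat j \<longleftrightarrow> i = j" if "i < p" "j < p" for i j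
    using that char by (simp add: of_nat_eq_iff_cong_CHAR cong_def)
  have md: "(of_nat (i mod p) :: 'a) = of_nat i" for i
    using char by (simp add: of_nat_eq_iff_cong_CHAR)
  define \<delta> :: "nat \<Rightarrow> 'a \<times> 'a" where "\<delta> x = (of_nat (x mod p), of_nat (x div p))" for x
  have inj: "inj_on \<delta> {p..<p * p}"
  proof (rule inj_onI)
    fix x y assume xy: "x \<in> {p..<p * p}" "y \<in> {p..<p * p}" "\<delta> x = \<delta> y"
    then have "x div p < p" "y div p < p" using p1 by (simp_all add: less_mult_imp_div_less)
    then have "x mod p = y mod p" "x div p = y div p" using xy p1 by (simp_all add: \<delta>_def eq)
    then show "x = y" by (metis div_mult_mod_eq)
  qed
  have nz: "(of_nat (x div p) :: 'a) \<noteq> 0" if "x \<in> {p..<p * p}" for x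
  proof -
    have "x div p < p" "x div p \<noteq> 0" using that p1 by (auto simp: less_mult_imp_div_less div_eq_0_iff)
    then show ?thesis using eq[of "x div p" 0] p1 by simp
  qed
  have sub: "\<delta> ` {p..<p * p} \<subseteq> UNIV \<times> (- {0})" using nz by (auto simp: \<delta>_def)
  have "card (\<delta> ` {p..<p * p}) = p * p - p" using inj by (simp add: card_image)
  also have "\<dots> = card (UNIV \<times> (- {0 :: 'a}) :: ('a \<times> 'a) set)"
    using p(2) by (simp add: card_cartesian_product Compl_eq_Diff_UNIV diff_mult_distrib2)
  finally have im: "\<delta> ` {p..<p * p} = UNIV \<times> (- {0})" using sub by (simp add: card_subset_eq)
  have fadj2: "fadj a b" if "b = 2 * a" for a b
  proof -
    have "a = \<alpha> * b" if "2 * \<alpha> = 1"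
    proof -
      have "\<alpha> * b = (2 * \<alpha>) * a" using \<open>b = 2 * a\<close> by (simp add: ac_simps)
      then show ?thesis using that by simp
    qed
    then show ?thesis using two \<open>b = 2 * a\<close> by (auto simp: fadj_def)
  qed
  have fsym: "fadj a b \<Longrightarrow> fadj b a" for a b by (auto simp: fadj_def)
  have adj: "ladj (\<delta> x) (\<delta> y)" if xy: "nadj p x y" for x y
  proof -
    consider "x mod p = y mod p" "y div p = 2 * (x div p) mod p" | "x mod p = y mod p" "x div p = 2 * (y div p) mod p"
      | "x div p = y div p" "y mod p = (x mod p + x div p) mod p" | "x div p = y div p" "x mod p = (y mod p + x div p) mod p"
      using xy unfolding nadj_def by blast
    then show ?thesis
    proof cases
      case 1
      then have "(of_nat (y div p) :: 'a) = 2 * of_nat (x div p)" using md[of "2 * (x div p)"] by simp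
      then show ?thesis using 1(1) fadj2 by (simp add: ladj_def \<delta>_def)
    next
      case 2
      then have "(of_nat (x div p) :: 'a) = 2 * of_nat (y div p)" using md[of "2 * (y div p)"] by simp
      then show ?thesis using 2(1) fadj2 fsym by (simp add: ladj_def \<delta>_def)
    next
      case 3
      then have "(of_nat (y mod p) :: 'a) = of_nat (x mod p) + of_nat (x div p)" using md[of "x mod p + x div p"] by simp
      then show ?thesis using 3(1) by (simp add: ladj_def \<delta>_def)
    next
      case 4
      then have "(of_nat (x mod p) :: 'a) = of_nat (y mod p) + of_nat (x div p)" using md[of "y mod p + x div p"] by simp
      then show ?thesis using 4(1) by (simp add: ladj_def \<delta>_def)
    qed
  qed
  have \<delta>p: "\<delta> p = (0, 1)" using p1 by (simp add: \<delta>_def)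
  have from01: "\<exists>P. hpath ladj (UNIV \<times> (- {0})) (0, 1) P v" if "v \<in> UNIV \<times> (- {0})" "v \<noteq> (0, 1)" for v
  proof -
    have "v \<in> \<delta> ` {p..<p * p}" unfolding im by (rule that(1))
    then obtain x where x: "x \<in> {p..<p * p}" "v = \<delta> x" by (elim imageE)
    then have "x \<noteq> p" using that(2) \<delta>p by auto
    then obtain P where "hpath (nadj p) {p..<p * p} p P x" using affine_certs_hpath[OF cert x(1)] by blast
    then have "hpath ladj (\<delta> ` {p..<p * p}) (\<delta> p) (map \<delta> P) (\<delta> x)"
      using inj adj by (rule hpath_image)
    then show ?thesis unfolding im \<delta>p x(2)[symmetric] by blast
  qed
  show ?thesis
    unfolding hconn_def
  proof (intro ballI impI)
    fix u v :: "'a \<times> 'a" assume u: "u \<in> UNIV \<times> (- {0})" and v: "v \<in> UNIV \<times> (- {0})" and uv: "u \<noteq> v"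
    define g where "g x = (fst u + snd u * fst x, snd u * snd x)" for x :: "'a \<times> 'a"
    define h where "h x = ((fst x - fst u) / snd u, snd x / snd u)" for x :: "'a \<times> 'a"
    have u0: "snd u \<noteq> 0" using u by auto
    have gh: "g (h x) = x" "h (g x) = x" for x using u0 by (simp_all add: g_def h_def)
    have injg: "inj_on g (UNIV \<times> (- {0}))" by (rule inj_on_inverseI[of _ h]) (rule gh)
    have img: "g ` (UNIV \<times> (- {0})) = UNIV \<times> (- {0})"
    proof
      show "g ` (UNIV \<times> (- {0})) \<subseteq> UNIV \<times> (- {0})" using u0 by (auto simp: g_def)
      show "UNIV \<times> (- {0}) \<subseteq> g ` (UNIV \<times> (- {0}))"
      proof
        fix x :: "'a \<times> 'a" assume "x \<in> UNIV \<times> (- {0})"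
        then have "h x \<in> UNIV \<times> (- {0})" using u0 by (auto simp: h_def)
        then show "x \<in> g ` (UNIV \<times> (- {0}))" using gh(1)[of x] by (intro image_eqI[of x g "h x"]) simp_all
      qed
    qed
    have adjg: "ladj (g x) (g y)" if xy: "ladj x y" for x y
    proof -
      have "snd u * snd y = \<alpha> * (snd u * snd x)" if "snd y = \<alpha> * snd x"
        unfolding that by (rule mult.left_commute)
      moreover have "snd u * snd x = \<alpha> * (snd u * snd y)" if "snd x = \<alpha> * snd y"
        unfolding that by (rule mult.left_commute)
      moreover have "fst u + snd u * fst y = fst u + snd u * fst x + snd u * snd x" if "fst y = fst x + snd x"
        unfolding that by (simp add: distrib_left)
      moreover have "fst u + snd u * fst y = fst u + snd u * fst x - snd u * snd x" if "fst y = fst x - snd x"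
        unfolding that by (simp add: right_diff_distrib)
      ultimately show ?thesis using xy unfolding ladj_def fadj_def g_def by auto
    qed
    have g01: "g (0, 1) = u" by (simp add: g_def)
    have "h v \<noteq> (0, 1)"
    proof
      assume "h v = (0, 1)"
      then have "g (h v) = u" using g01 by simp
      then show False using uv unfolding gh(1) by simp
    qed
    have "h v \<in> UNIV \<times> (- {0})" using v u0 by (auto simp: h_def)
    then obtain P where "hpath ladj (UNIV \<times> (- {0})) (0, 1) P (h v)"
      using from01[OF _ \<open>h v \<noteq> (0, 1)\<close>] by auto
    then have "hpath ladj (g ` (UNIV \<times> (- {0}))) (g (0, 1)) (map g P) (g (h v))"
      using injg adjg by (rule hpath_image)
    then have "hpath ladj (UNIV \<times> (- {0})) u (map g P) v" unfolding img g01 gh .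
    then show "\<exists>P. hpath ladj (UNIV \<times> (- {0})) u P v" by (rule exI)
  qed
qed

text \<open>For fixed c the quotient d = c / a turns \<open>kadj\<close> into \<open>ladj\<close>:
  an additive step changes t by d, and scaling a by \<alpha> divides d by \<alpha>. The layers c =
  \<alpha>^i follow each other cyclically under scaling of c.\<close>

lemma hconn_kadj_layers:
  assumes hc: "hconn ladj (UNIV \<times> (- {0}))" and m: "2 \<le> m"
  shows "hconn kadj (UNIV \<times> W)"
proof -
  define V :: "nat \<Rightarrow> ('a \<times> 'a \<times> 'a) set" where "V i = UNIV \<times> (- {0}) \<times> {\<alpha> ^ i}" for i
  have "hconn kadj (\<Union>(range V))"
  proof (rule hconn_cyclic[OF symp_kadj m_pos])
    show "V (i + m) = V i" for i by (simp add: V_def power_add pow_m)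
    show "(fst x, fst (snd x), \<alpha> * snd (snd x)) \<in> V (Suc i) \<and> kadj x (fst x, fst (snd x), \<alpha> * snd (snd x))"
      if "x \<in> V i" for x i
      using that by (auto simp: V_def kadj_def prodrel_def fadj_def)
    show "inj_on (\<lambda>x. (fst x, fst (snd x), \<alpha> * snd (snd x))) (V i)" for i
      using alpha_nz by (auto simp: inj_on_def)
    show "V i \<inter> V j = {}" if "i < j" "j < i + m" for i j
    proof -
      have "\<alpha> ^ (j - i) \<noteq> 1"
      proof
        assume "\<alpha> ^ (j - i) = 1"
        then have "\<alpha> ^ (j - i) = \<alpha> ^ 0" by simp
        then show False unfolding pow_eq_iff using that by simp
      qed
      then have "\<alpha> ^ i \<noteq> \<alpha> ^ j" using that alpha_nz by (simp add: power_diff)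
      then show ?thesis by (auto simp: V_def)
    qed
    show "hconn kadj (V i)" for i
    proof -
      let ?c = "\<alpha> ^ i"
      have c: "?c \<noteq> 0" using alpha_nz by simp
      let ?f = "\<lambda>x. (fst x, ?c / snd x, ?c)"
      have "hconn kadj (?f ` (UNIV \<times> (- {0})))"
      proof (rule hconn_image[OF hc])
        show "inj_on ?f (UNIV \<times> (- {0}))" using c by (auto simp: inj_on_def field_simps)
        show "kadj (?f x) (?f y)" if xy: "x \<in> UNIV \<times> (- {0})" "y \<in> UNIV \<times> (- {0})" "ladj x y" for x y
        proof -
          have nz: "snd x \<noteq> 0" "snd y \<noteq> 0" using xy by auto
          have "fadj (?c / snd x) (?c / snd y)" if "fadj (snd x) (snd y)"
            using that nz alpha_nz c by (auto simp: fadj_def)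
          then show ?thesis using xy(3) nz c by (auto simp: ladj_def kadj_def prodrel_def)
        qed
      qed
      moreover have "?f ` (UNIV \<times> (- {0})) = V i"
      proof
        show "?f ` (UNIV \<times> (- {0})) \<subseteq> V i" using c by (auto simp: V_def)
        show "V i \<subseteq> ?f ` (UNIV \<times> (- {0}))"
        proof
          fix z assume "z \<in> V i"
          then obtain t a where "z = (t, a, ?c)" "a \<noteq> 0" by (auto simp: V_def)
          then show "z \<in> ?f ` (UNIV \<times> (- {0}))" using c by (intro image_eqI[of z ?f "(t, ?c / a)"]) auto
        qed
      qed
      ultimately show ?thesis by simp
    qed
    show "3 \<le> card (V i)" for i
    proof -
      have "card (V i) = CARD('a) * m"
        using m_def by (simp add: V_def card_cartesian_product Compl_eq_Diff_UNIV)
      moreover have "3 \<le> CARD('a)" using m m_def by simp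
      moreover have "3 * 1 \<le> CARD('a) * m" by (rule mult_le_mono) (use m m_def in simp_all)
      ultimately show ?thesis by simp
    qed
  qed
  moreover have "\<Union>(range V) = UNIV \<times> W"
  proof
    show "\<Union>(range V) \<subseteq> UNIV \<times> W" using alpha_nz by (auto simp: V_def)
    show "UNIV \<times> W \<subseteq> \<Union>(range V)"
    proof
      fix z :: "'a \<times> 'a \<times> 'a" assume "z \<in> UNIV \<times> W"
      then obtain t a c where z: "z = (t, a, c)" "a \<noteq> 0" "c \<noteq> 0" by auto
      obtain i where "c = \<alpha> ^ i" using ex_pow[OF z(3)] by blast
      then have "z \<in> V i" using z by (simp add: V_def)
      then show "z \<in> \<Union>(range V)" by blast
    qed
  qed
  ultimately show ?thesis by simp
qed

lemma alpha_neq_1: "2 \<le> m \<Longrightarrow> \<alpha> \<noteq> 1"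
proof
  assume m: "2 \<le> m" and "\<alpha> = 1"
  then have "\<alpha> ^ 1 = \<alpha> ^ 0" by simp
  then show False unfolding pow_eq_iff using m by simp
qed

text \<open>An odd torus is Hamilton connected, so the fibres can be joined directly. Two fibres are
  linked wherever c / a = t' - t, once for every nonzero a and thus at least three times; the
  quotients 1 and \<alpha> give exits to different fibres.\<close>

lemma hconn_kadj_odd:
  assumes odd: "odd m" and m: "3 \<le> m"
  shows "hconn kadj (UNIV \<times> W)"
proof -
  have \<alpha>1: "\<alpha> \<noteq> 1" using alpha_neq_1 m by simp
  have "hconn kadj (\<Union>((\<lambda>t. {t} \<times> W) ` UNIV))"
  proof (rule hconn_join[OF _ _ _ symp_kadj])
    show "3 \<le> CARD('a)" using m m_def by simp
    show "hconn kadj ({t} \<times> W)" for t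
    proof -
      have "hconn kadj (Pair t ` W)"
        by (rule hconn_image[OF hconn_torus[OF odd]]) (auto simp: inj_on_def kadj_def)
      moreover have "Pair t ` W = {t} \<times> W" by auto
      ultimately show ?thesis by simp
    qed
    show "\<exists>x\<in>{t} \<times> W. \<exists>y\<in>{t'} \<times> W. kadj x y \<and> x \<noteq> u \<and> y \<noteq> v" if "t \<noteq> t'" for t t' u v
    proof -
      have "3 \<le> card (- {0 :: 'a})" using m m_def by (simp add: Compl_eq_Diff_UNIV)
      moreover have "inj_on (\<lambda>a. (s, a, a * (t' - t))) (- {0})" for s :: 'a by (simp add: inj_on_def)
      ultimately obtain a where a: "a \<in> - {0}" "(t, a, a * (t' - t)) \<noteq> u" "(t', a, a * (t' - t)) \<noteq> v"
        using avoid_two[of "- {0}" "\<lambda>a. (t, a, a * (t' - t))" "\<lambda>a. (t', a, a * (t' - t))" u v] by blast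
      moreover have "kadj (t, a, a * (t' - t)) (t', a, a * (t' - t))" using a by (simp add: kadj_def)
      ultimately show ?thesis using that by (intro bexI[of _ "(t, a, a * (t' - t))"] bexI[of _ "(t', a, a * (t' - t))"]) auto
    qed
    show "\<exists>f \<pi>. (\<forall>x\<in>{t} \<times> W. kadj x (f x) \<and> f x \<in> {\<pi> x} \<times> W \<and> \<pi> x \<in> UNIV \<and> \<pi> x \<noteq> t) \<and>
        (\<exists>x\<in>{t} \<times> W. \<exists>y\<in>{t} \<times> W. \<pi> x \<noteq> \<pi> y)" for t
    proof -
      let ?\<pi> = "\<lambda>x. fst x + snd (snd x) / fst (snd x)"
      let ?f = "\<lambda>x. (?\<pi> x, snd x)"
      have "\<forall>x\<in>{t} \<times> W. kadj x (?f x) \<and> ?f x \<in> {?\<pi> x} \<times> W \<and> ?\<pi> x \<in> UNIV \<and> ?\<pi> x \<noteq> t"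
        by (auto simp: kadj_def)
      moreover have "(t, 1, 1) \<in> {t} \<times> W" "(t, 1, \<alpha>) \<in> {t} \<times> W" "?\<pi> (t, 1, 1) \<noteq> ?\<pi> (t, 1, \<alpha>)"
        using alpha_nz \<alpha>1 by auto
      ultimately show ?thesis by (intro exI[of _ ?f] exI[of _ ?\<pi>] conjI) blast+
    qed
  qed auto
  moreover have "\<Union>((\<lambda>t. {t} \<times> W) ` (UNIV :: 'a set)) = UNIV \<times> W" by auto
  ultimately show ?thesis by (simp only:)
qed

lemma hconn_GL2_join:
  assumes hc: "hconn kadj (UNIV \<times> W)" and m: "2 \<le> m"
  shows "hconn radj (GL2 :: (('a \<times> 'a) \<times> ('a \<times> 'a)) set)"
proof -
  have \<alpha>1: "\<alpha> \<noteq> 1" using alpha_neq_1 m by simp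
  have repGL: "(rep Q', rep Q) \<in> GL2" if "Q \<noteq> Q'" for Q Q' :: "'a option"
    using ln2_eq_iff[of "rep Q'" "rep Q"] that by (simp add: GL2_def)
  have other: "\<exists>Q'. Q' \<noteq> Q" for Q :: "'a option" by (cases Q) auto
  have "hconn radj (\<Union>(VQ ` (UNIV :: 'a option set)))"
  proof (rule hconn_join[OF _ _ _ symp_radj])
    show "3 \<le> CARD('a option)" using m m_def by (simp add: card_option)
    show "VQ Q \<inter> VQ Q' = {}" if "Q \<noteq> Q'" for Q Q' :: "'a option" using VQ_disj[OF that] .
    show "hconn radj (VQ Q)" for Q :: "'a option"
    proof -
      obtain Q' where Q': "Q' \<noteq> Q" using other by blast
      have GL: "(rep Q', rep Q) \<in> GL2" using repGL[OF Q'[symmetric]] .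
      have "hconn radj (psi (rep Q') (rep Q) ` (UNIV \<times> W))"
        by (rule hconn_image[OF hc psi_inj]) (use GL psi_adj in \<open>auto simp: GL2_def\<close>)
      then show ?thesis using psi_image(1)[OF GL] by simp
    qed
    show "\<exists>x\<in>VQ Q. \<exists>y\<in>VQ Q'. radj x y \<and> x \<noteq> u \<and> y \<noteq> v" if "Q \<noteq> Q'" for Q Q' :: "'a option" and u v
    proof -
      \<comment> \<open>Adding the rows of \<open>X (a, c)\<close> gives a rep Q'. So every pair of
        nonzero scalars is a link between the two cosets, and three pairs suffice.\<close>
      define X where "X z = (scl (fst z) (rep Q') - scl (snd z) (rep Q), scl (snd z) (rep Q))" for z :: "'a \<times> 'a"
      let ?D = "{(1, 1), (\<alpha>, 1), (1, \<alpha>)} :: ('a \<times> 'a) set"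
      have D: "det2 (rep Q') (rep Q) \<noteq> 0" using repGL[OF that] by (simp add: GL2_def)
      have GL: "X z \<in> GL2" if "fst z \<noteq> 0" "snd z \<noteq> 0" for z
      proof -
        have "det2 (fst (X z)) (snd (X z)) = fst z * snd z * det2 (rep Q') (rep Q)"
          by (simp add: X_def det2_def scl_def algebra_simps)
        then show ?thesis using that D by (simp add: GL2_def)
      qed
      have mvX: "mv 1 (X z) = (fst (X z), scl (fst z) (rep Q'))" for z
        by (simp add: mv_def X_def scl_def prod_eq_iff)
      have scl_inj: "a = b" if "scl a (rep R) = scl b (rep R)" for a b and R :: "'a option"
        using that by (cases R) (auto simp: scl_def rep_def)
      have injX: "z = z'" if "X z = X z'" for z z'
      proof -
        have s: "snd z = snd z'" using that scl_inj[of "snd z" Q "snd z'"] by (simp add: X_def)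
        then have "scl (fst z) (rep Q') = scl (fst z') (rep Q')" using that by (simp add: X_def)
        then have "fst z = fst z'" by (rule scl_inj)
        then show ?thesis using s by (simp add: prod_eq_iff)
      qed
      have inj: "inj_on X ?D" using injX by (simp add: inj_on_def)
      have inj2: "inj_on (\<lambda>z. mv 1 (X z)) ?D"
      proof (rule inj_onI)
        fix z z' assume eq: "mv 1 (X z) = mv 1 (X z')"
        have f: "fst (X z) = fst (X z')" and "scl (fst z) (rep Q') = scl (fst z') (rep Q')"
          using eq unfolding mvX by simp_all
        then have z1: "fst z = fst z'" using scl_inj by blast
        then have "scl (snd z) (rep Q) = scl (snd z') (rep Q)" using f by (simp add: X_def)
        then have "snd z = snd z'" by (rule scl_inj)
        then show "z = z'" using z1 by (simp add: prod_eq_iff)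
      qed
      have "3 \<le> card ?D" using \<alpha>1 by simp
      from avoid_two[OF this inj inj2, of u v] obtain z where z: "z \<in> ?D" "X z \<noteq> u" "mv 1 (X z) \<noteq> v" by blast
      have znz: "fst z \<noteq> 0" "snd z \<noteq> 0" using z(1) alpha_nz by auto
      have "X z \<in> VQ Q" using GL[OF znz] znz by (simp add: VQ_def X_def ln2_scl)
      moreover have "mv 1 (X z) \<in> VQ Q'"
        using mv_VQ[OF GL[OF znz], of 1] znz unfolding mvX by (simp add: ln2_scl)
      ultimately show ?thesis using z(2,3) radj_mv[of 1 "X z"] by blast
    qed
    show "\<exists>f \<pi>. (\<forall>x\<in>VQ Q. radj x (f x) \<and> f x \<in> VQ (\<pi> x) \<and> \<pi> x \<in> UNIV \<and> \<pi> x \<noteq> Q) \<and>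
        (\<exists>x\<in>VQ Q. \<exists>y\<in>VQ Q. \<pi> x \<noteq> \<pi> y)" for Q :: "'a option"
    proof -
      obtain Q' where Q': "Q' \<noteq> Q" using other by blast
      let ?X = "(rep Q', rep Q)" and ?Y = "(scl \<alpha> (rep Q'), rep Q)"
      have X: "?X \<in> GL2" using repGL[OF Q'[symmetric]] .
      have "det2 (scl \<alpha> (rep Q')) (rep Q) = \<alpha> * det2 (rep Q') (rep Q)"
        by (simp add: det2_def scl_def algebra_simps)
      then have Y: "?Y \<in> GL2" using X alpha_nz by (simp add: GL2_def)
      let ?\<pi> = "\<lambda>X. ln2 (snd (mv 1 X))"
      have "snd (mv 1 ?Y) = snd (mv \<alpha> ?X)" "snd (mv 1 ?X) = snd (mv 1 ?X)" by (simp_all add: mv_def scl_def)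
      then have ne: "?\<pi> ?X \<noteq> ?\<pi> ?Y" using mv_exit_neq[OF X, of 1 \<alpha>] \<alpha>1 by simp
      have mem: "?X \<in> VQ Q" "?Y \<in> VQ Q" using X Y by (simp_all add: VQ_def)
      have all: "\<forall>x\<in>VQ Q. radj x (mv 1 x) \<and> mv 1 x \<in> VQ (?\<pi> x) \<and> ?\<pi> x \<in> UNIV \<and> ?\<pi> x \<noteq> Q"
        using radj_mv[of 1] mv_VQ[OF VQ_GL2] mv_exit[of _ Q 1] by auto
      show ?thesis
        by (rule exI[of _ "mv 1"], rule exI[of _ ?\<pi>], rule conjI[OF all], rule bexI[OF _ mem(1)], rule bexI[OF _ mem(2)], rule ne)
    qed
  qed simp_all
  then show ?thesis by (simp only: VQ_Union)
qed

theorem hconn_GL2: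
  assumes q: "2 < CARD('a)"
  shows "hconn radj (GL2 :: (('a \<times> 'a) \<times> ('a \<times> 'a)) set)"
proof -
  have m: "2 \<le> m" using q m_def by simp
  have pow_neq: "\<alpha> ^ 2 \<noteq> 1" if "3 \<le> m"
  proof
    assume "\<alpha> ^ 2 = 1"
    then have "\<alpha> ^ 2 = \<alpha> ^ 0" by simp
    then show False unfolding pow_eq_iff using that by simp
  qed
  have ex_nat: "\<exists>i<p. \<alpha> = of_nat i" if "prime p" "CARD('a) = p" for p
  proof -
    have "CHAR('a) dvd p" using CHAR_dvd_CARD[where 'a = 'a] that(2) by simp
    moreover have "CHAR('a) \<noteq> 1" using CHAR_not_1'[where 'a = 'a] by simp
    ultimately have char: "CHAR('a) = p" using that(1) by (metis prime_nat_iff)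
    have "inj_on (of_nat :: nat \<Rightarrow> 'a) {..<p}"
      by (rule inj_onI) (simp add: of_nat_eq_iff_cong_CHAR cong_def char)
    then have "card ((of_nat :: nat \<Rightarrow> 'a) ` {..<p}) = CARD('a)" using that(2) by (simp add: card_image)
    then have "(of_nat :: nat \<Rightarrow> 'a) ` {..<p} = UNIV" by (intro card_subset_eq) auto
    then have "\<alpha> \<in> (of_nat :: nat \<Rightarrow> 'a) ` {..<p}" by simp
    then show ?thesis by blast
  qed
  have cardz: "(of_nat CARD('a) :: 'a) = 0"
    using CHAR_dvd_CARD[where 'a = 'a] by (simp add: of_nat_eq_0_iff_char_dvd)
  \<comment> \<open>For even \<open>m\<close> below 6 there are too few even powers of \<alpha> for
    \<open>ex_port\<close>, so \<open>q = 3\<close> and \<open>q = 5\<close> rely on the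
    certificates.\<close>
  consider "odd m" "3 \<le> m" | "m = 2" | "m = 4" | "even m" "6 \<le> m"
  proof -
    have "m = 2 \<or> m = 3 \<or> m = 4 \<or> m = 5 \<or> 6 \<le> m" using m by linarith
    then show thesis using that by (cases "even m") auto
  qed
  then show ?thesis
  proof cases
    case 1
    then show ?thesis using hconn_GL2_join[OF hconn_kadj_odd m] by blast
  next
    case 2
    then have C: "CARD('a) = 3" using m_def q by simp
    obtain i where i: "i < 3" "\<alpha> = of_nat i" using ex_nat[of 3] C by auto
    have "\<alpha> = 2" using i alpha_nz alpha_neq_1[OF m] by (auto simp: numeral_3_eq_3 less_Suc_eq)
    then show ?thesis
      using hconn_GL2_join[OF hconn_kadj_layers[OF hconn_ladj_small[OF _ C affine_certs_3] m] m] by simp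
  next
    case 3
    then have C: "CARD('a) = 5" using m_def q by simp
    have five: "(5 :: 'a) = 0" using cardz C by simp
    obtain i where i: "i < 5" "\<alpha> = of_nat i" using ex_nat[of 5] C by auto
    then have "i = 0 \<or> i = 1 \<or> i = 2 \<or> i = 3 \<or> i = 4" by auto
    then have "\<alpha> = 0 \<or> \<alpha> = 1 \<or> \<alpha> = 2 \<or> \<alpha> = 3 \<or> \<alpha> = 4" using i(2) by auto
    moreover have "\<alpha> \<noteq> 4"
    proof
      assume "\<alpha> = 4"
      then have "\<alpha> ^ 2 = 1 + 3 * 5" by simp
      then show False using five pow_neq 3 by simp
    qed
    moreover have "2 * \<alpha> = 1" if "\<alpha> = 3"
    proof -
      have "2 * \<alpha> = 1 + 5" using that by simp
      then show ?thesis using five by simp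
    qed
    ultimately have "\<alpha> = 2 \<or> 2 * \<alpha> = 1" using alpha_nz alpha_neq_1[OF m] by auto
    then show ?thesis
      using hconn_GL2_join[OF hconn_kadj_layers[OF hconn_ladj_small[OF _ C affine_certs_5] m] m] by simp
  next
    case 4
    then interpret gen_odd \<alpha> m by unfold_locales
    show ?thesis using hconn_GL2_odd 4 by blast
  qed
qed

end

section \<open>Corner subgroups of the general linear group\<close>

lemma finite_carrier_mat: "finite (carrier_mat n k :: 'a::finite mat set)"
proof -
  have "carrier_mat n k \<subseteq> (\<lambda>f. mat n k f) ` (PiE ({..<n} \<times> {..<k}) (\<lambda>_. UNIV :: 'a set))"
  proof
    fix A :: "'a mat" assume A: "A \<in> carrier_mat n k"
    have "A = mat n k (restrict (\<lambda>ij. A $$ ij) ({..<n} \<times> {..<k}))"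
      using A by (intro eq_matI) auto
    moreover have "restrict (\<lambda>ij. A $$ ij) ({..<n} \<times> {..<k}) \<in> PiE ({..<n} \<times> {..<k}) (\<lambda>_. UNIV)" by auto
    ultimately show "A \<in> (\<lambda>f. mat n k f) ` (PiE ({..<n} \<times> {..<k}) (\<lambda>_. UNIV :: 'a set))" by blast
  qed
  then show ?thesis by (rule finite_subset) (intro finite_imageI finite_PiE, simp_all)
qed

lemma mat_mult_entry:
  assumes "A \<in> carrier_mat n n" "B \<in> carrier_mat n n" "i < n" "j < n"
  shows "(A * B) $$ (i, j) = (\<Sum>l<n. A $$ (i, l) * B $$ (l, j))"
  using assms by (auto simp: scalar_prod_def atLeast0LessThan intro!: sum.cong)

lemma mat_mult_unit_row:
  assumes "A \<in> carrier_mat n n" "B \<in> carrier_mat n n" "i < n" "j < n"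
    and "\<And>l. l < n \<Longrightarrow> l \<noteq> p \<Longrightarrow> A $$ (i, l) = 0" "p < n"
  shows "(A * B) $$ (i, j) = A $$ (i, p) * (B :: 'a::comm_ring_1 mat) $$ (p, j)"
proof -
  have "(A * B) $$ (i, j) = (\<Sum>l<n. if l = p then A $$ (i, l) * B $$ (l, j) else 0)"
    unfolding mat_mult_entry[OF assms(1-4)] by (rule sum.cong) (use assms(5) in auto)
  then show ?thesis using assms(6) by simp
qed

lemma mat_mult_unit_col:
  assumes "A \<in> carrier_mat n n" "B \<in> carrier_mat n n" "i < n" "j < n"
    and "\<And>l. l < n \<Longrightarrow> l \<noteq> p \<Longrightarrow> B $$ (l, j) = 0" "p < n"
  shows "(A * B) $$ (i, j) = A $$ (i, p) * (B :: 'a::comm_ring_1 mat) $$ (p, j)"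
proof -
  have "(A * B) $$ (i, j) = (\<Sum>l<n. if l = p then A $$ (i, l) * B $$ (l, j) else 0)"
    unfolding mat_mult_entry[OF assms(1-4)] by (rule sum.cong) (use assms(5) in auto)
  then show ?thesis using assms(6) by simp
qed

locale gl_setup = gen \<alpha> m for \<alpha> :: "'a::{field,finite}" and m :: nat +
  fixes n :: nat and T :: "nat pair_pre_digraph"
  assumes arcs: "\<And>i j. (i, j) \<in> parcs T \<Longrightarrow> i < n \<and> j < n \<and> i \<noteq> j"
    and up: "\<And>r. 1 \<le> r \<Longrightarrow> r < n \<Longrightarrow> \<exists>i<r. (i, r) \<in> parcs T"
    and down: "\<And>r. 1 \<le> r \<Longrightarrow> r < n \<Longrightarrow> \<exists>j<r. (r, j) \<in> parcs T"
begin

abbreviation G :: "'a mat monoid" where "G \<equiv> GL TYPE('a) n"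

lemma carrier_G: "X \<in> carrier G \<longleftrightarrow> X \<in> Units (ring_mat TYPE('a) n ())"
  by (simp add: GL_def units_of_def)

lemma mult_G [simp]: "X \<otimes>\<^bsub>G\<^esub> Y = X * Y"
  by (simp add: GL_def units_of_def ring_mat_def)

lemma one_G [simp]: "\<one>\<^bsub>G\<^esub> = 1\<^sub>m n"
  by (simp add: GL_def units_of_def ring_mat_def)

sublocale G: group G
proof -
  interpret semiring "ring_mat TYPE('a) n ()" by (rule semiring_mat)
  show "group G" unfolding GL_def by (rule units_group)
qed

lemma carrier_G_mat: "X \<in> carrier G \<Longrightarrow> X \<in> carrier_mat n n"
  by (auto simp: carrier_G Units_def ring_mat_def)

lemma carrier_GI:
  assumes "X \<in> carrier_mat n n" "Y \<in> carrier_mat n n" "X * Y = 1\<^sub>m n" "Y * X = 1\<^sub>m n"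
  shows "X \<in> carrier G"
  using assms by (auto simp: carrier_G Units_def ring_mat_def)

lemma finite_G: "finite (carrier G)"
  using finite_carrier_mat by (rule finite_subset[rotated]) (auto dest: carrier_G_mat)

lemma addrow_G: "k < n \<Longrightarrow> l < n \<Longrightarrow> k \<noteq> l \<Longrightarrow> addrow_mat n a k l \<in> carrier G"
  by (simp add: carrier_G addrow_mat_Unit)

lemma multrow_G: "k < n \<Longrightarrow> a \<noteq> 0 \<Longrightarrow> multrow_mat n k a \<in> carrier G"
  by (simp add: carrier_G multrow_mat_Unit)

lemma swaprows_G: "k < n \<Longrightarrow> l < n \<Longrightarrow> swaprows_mat n k l \<in> carrier G"
  by (simp add: carrier_G swaprows_mat_Unit)

lemma inv_addrow:
  assumes "k < n" "l < n" "k \<noteq> l"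
  shows "inv\<^bsub>G\<^esub> (addrow_mat n a k l) = addrow_mat n (- a) k l"
proof (rule G.inv_equality)
  show "addrow_mat n (- a) k l \<otimes>\<^bsub>G\<^esub> addrow_mat n a k l = \<one>\<^bsub>G\<^esub>"
    using addrow_mat_inv[OF assms, of "- a"] by simp
qed (use addrow_G assms in auto)

abbreviation S :: "'a mat set" where "S \<equiv> ops n \<alpha> T"
abbreviation E :: "'a mat \<Rightarrow> 'a mat \<Rightarrow> bool" where "E \<equiv> G.cayley S"

lemma op_gens_G: "op_gens n \<alpha> T \<subseteq> carrier G"
  using alpha_nz by (auto simp: op_gens_def A_mat_def M_mat_def split: if_splits
      intro!: addrow_G multrow_G dest: arcs)

lemma S_G: "S \<subseteq> carrier G"
  using op_gens_G by (auto simp: ops_def)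

lemma S_inv: "s \<in> S \<Longrightarrow> inv\<^bsub>G\<^esub> s \<in> S"
  using op_gens_G by (auto simp: ops_def)

lemma symp_E: "symp E"
  by (rule G.symp_cayley[OF S_G S_inv])

lemma arc_S: "(i, j) \<in> parcs T \<Longrightarrow> addrow_mat n 1 j i \<in> S"
  by (auto simp: ops_def op_gens_def A_mat_def)

lemma mult_S: "2 < CARD('a) \<Longrightarrow> i < n \<Longrightarrow> multrow_mat n i \<alpha> \<in> S"
  by (auto simp: ops_def op_gens_def M_mat_def)

definition Gk :: "nat \<Rightarrow> 'a mat set" where
  "Gk k = {g \<in> carrier G. \<forall>i<n. \<forall>j<n. k \<le> i \<or> k \<le> j \<longrightarrow> g $$ (i, j) = of_bool (i = j)}"

text \<open>A maximal parabolic subgroup of the corner GL_(r+1). \<open>Hk r\<close> is its Levi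
  factor GL_r x GL_1.\<close>

definition Pk :: "nat \<Rightarrow> 'a mat set" where
  "Pk r = {g \<in> Gk (Suc r). \<forall>j<r. g $$ (r, j) = 0}"

definition Hk :: "nat \<Rightarrow> 'a mat set" where
  "Hk r = {g \<in> Pk r. \<forall>i<r. g $$ (i, r) = 0}"

lemma Gk_n: "Gk n = carrier G"
  by (auto simp: Gk_def)

lemma GkD: "g \<in> Gk k \<Longrightarrow> i < n \<Longrightarrow> j < n \<Longrightarrow> k \<le> i \<or> k \<le> j \<Longrightarrow> g $$ (i, j) = of_bool (i = j)"
  unfolding Gk_def by blast

lemma Gk_mat: "g \<in> Gk k \<Longrightarrow> g \<in> carrier_mat n n"
  by (simp add: Gk_def carrier_G_mat)

lemma Gk_mult_row:
  assumes "g \<in> Gk k" "h \<in> carrier_mat n n" "k \<le> i" "i < n" "j < n"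
  shows "(g * h) $$ (i, j) = h $$ (i, j)"
  using mat_mult_unit_row[OF Gk_mat[OF assms(1)] assms(2,4,5), of i] GkD[OF assms(1)] assms by simp

lemma subgroup_Gk: "subgroup (Gk k) G"
proof (rule G.finite_closed_subgroup[OF finite_G])
  show "Gk k \<subseteq> carrier G" by (auto simp: Gk_def)
  show "\<one>\<^bsub>G\<^esub> \<in> Gk k" using G.one_closed by (auto simp: Gk_def)
  fix g h assume g: "g \<in> Gk k" and h: "h \<in> Gk k"
  have "(g * h) $$ (i, j) = of_bool (i = j)" if ij: "i < n" "j < n" "k \<le> i \<or> k \<le> j" for i j
  proof (cases "k \<le> i")
    case True
    then show ?thesis using Gk_mult_row[OF g Gk_mat[OF h]] GkD[OF h] ij by simp
  next
    case False
    then have "k \<le> j" using ij by simp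
    then show ?thesis
      using mat_mult_unit_col[OF Gk_mat[OF g] Gk_mat[OF h] ij(1,2), of j] GkD[OF h] GkD[OF g] ij by simp
  qed
  moreover have "g * h \<in> carrier G" using g h G.m_closed[of g h] by (simp add: Gk_def)
  ultimately show "g \<otimes>\<^bsub>G\<^esub> h \<in> Gk k" by (simp add: Gk_def)
qed

lemma Pk_Gk: "g \<in> Pk r \<Longrightarrow> g \<in> Gk (Suc r)"
  by (simp add: Pk_def)

lemma Pk_row: "g \<in> Pk r \<Longrightarrow> r < n \<Longrightarrow> l < n \<Longrightarrow> l \<noteq> r \<Longrightarrow> g $$ (r, l) = 0"
  using GkD[of g "Suc r" r l] by (cases "l < r") (auto simp: Pk_def)

lemma subgroup_Pk: "r < n \<Longrightarrow> subgroup (Pk r) G"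
proof (rule G.finite_closed_subgroup[OF finite_G])
  assume r: "r < n"
  note sG = subgroup_Gk[of "Suc r"]
  show "Pk r \<subseteq> carrier G" by (auto simp: Pk_def Gk_def)
  show "\<one>\<^bsub>G\<^esub> \<in> Pk r" using subgroup.one_closed[OF sG] r by (auto simp: Pk_def)
  fix g h assume g: "g \<in> Pk r" and h: "h \<in> Pk r"
  have "(g * h) $$ (r, j) = 0" if j: "j < r" for j
    using mat_mult_unit_row[OF Gk_mat[OF Pk_Gk[OF g]] Gk_mat[OF Pk_Gk[OF h]] r, of j r]
      Pk_row[OF g r] Pk_row[OF h r, of j] r j by simp
  moreover have "g * h \<in> Gk (Suc r)" using subgroup.m_closed[OF sG] Pk_Gk[OF g] Pk_Gk[OF h] by simp
  ultimately show "g \<otimes>\<^bsub>G\<^esub> h \<in> Pk r" by (simp add: Pk_def)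
qed

lemma Hk_Pk: "g \<in> Hk r \<Longrightarrow> g \<in> Pk r"
  by (simp add: Hk_def)

lemma Hk_col: "g \<in> Hk r \<Longrightarrow> r < n \<Longrightarrow> l < n \<Longrightarrow> l \<noteq> r \<Longrightarrow> g $$ (l, r) = 0"
  using GkD[of g "Suc r" l r] by (cases "l < r") (auto simp: Hk_def Pk_def)

lemma subgroup_Hk: "r < n \<Longrightarrow> subgroup (Hk r) G"
proof (rule G.finite_closed_subgroup[OF finite_G])
  assume r: "r < n"
  note sP = subgroup_Pk[OF r]
  show "Hk r \<subseteq> carrier G" by (auto simp: Hk_def Pk_def Gk_def)
  show "\<one>\<^bsub>G\<^esub> \<in> Hk r" using subgroup.one_closed[OF sP] r by (auto simp: Hk_def)
  fix g h assume g: "g \<in> Hk r" and h: "h \<in> Hk r"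
  have mg: "g \<in> carrier_mat n n" "h \<in> carrier_mat n n"
    using g h Gk_mat Pk_Gk Hk_Pk by blast+
  have "(g * h) $$ (i, r) = 0" if i: "i < r" for i
    using mat_mult_unit_col[OF mg, of i r r] Hk_col[OF h r] Hk_col[OF g r, of i] r i by simp
  moreover have "g * h \<in> Pk r" using subgroup.m_closed[OF sP] Hk_Pk[OF g] Hk_Pk[OF h] by simp
  ultimately show "g \<otimes>\<^bsub>G\<^esub> h \<in> Hk r" by (simp add: Hk_def)
qed

lemma Gk_Hk: "r < n \<Longrightarrow> g \<in> Gk r \<Longrightarrow> g \<in> Hk r"
  by (auto simp: Hk_def Pk_def Gk_def)

lemma addrow_Gk: "i < k \<Longrightarrow> j < k \<Longrightarrow> k \<le> n \<Longrightarrow> i \<noteq> j \<Longrightarrow> addrow_mat n a i j \<in> Gk k"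
  using addrow_G[of i j a] by (auto simp: Gk_def)

lemma multrow_Gk: "i < k \<Longrightarrow> k \<le> n \<Longrightarrow> a \<noteq> 0 \<Longrightarrow> multrow_mat n i a \<in> Gk k"
  using multrow_G[of i a] by (auto simp: Gk_def)

lemma swaprows_Gk: "i < k \<Longrightarrow> j < k \<Longrightarrow> k \<le> n \<Longrightarrow> swaprows_mat n i j \<in> Gk k"
  using swaprows_G[of i j] by (auto simp: Gk_def)

lemma addrow_Pk: "i < r \<Longrightarrow> j \<le> r \<Longrightarrow> r < n \<Longrightarrow> i \<noteq> j \<Longrightarrow> addrow_mat n a i j \<in> Pk r"
  using addrow_Gk[of i "Suc r" j a] by (auto simp: Pk_def)

text \<open>Row \<open>r\<close> of \<open>g\<close> has no other nonzero entry, so a zero on the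
  diagonal would give a zero row.\<close>

lemma Pk_diag_nz: "g \<in> Pk r \<Longrightarrow> r < n \<Longrightarrow> g $$ (r, r) \<noteq> 0"
proof
  assume g: "g \<in> Pk r" and r: "r < n" and 0: "g $$ (r, r) = 0"
  have gc: "g \<in> carrier G" using g by (simp add: Pk_def Gk_def)
  let ?h = "inv\<^bsub>G\<^esub> g"
  have "g * ?h = 1\<^sub>m n" using G.r_inv[OF gc] by simp
  moreover have "(g * ?h) $$ (r, r) = g $$ (r, r) * ?h $$ (r, r)"
    using mat_mult_unit_row[OF carrier_G_mat[OF gc] carrier_G_mat[OF G.inv_closed[OF gc]] r r, of r] Pk_row[OF g r] r by simp
  ultimately show False using 0 r by simp
qed

definition row_mat :: "nat \<Rightarrow> (nat \<Rightarrow> 'a) \<Rightarrow> 'a mat" where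
  "row_mat l v = mat n n (\<lambda>(i, j). if i = l then v j else of_bool (i = j))"

lemma row_mat_inv:
  assumes l: "l < n" and v: "v l \<noteq> 0"
  shows "row_mat l v * row_mat l (\<lambda>j. if j = l then 1 / v l else - v j / v l) = 1\<^sub>m n"
    (is "_ * row_mat l ?w = _")
proof (rule eq_matI)
  have c: "row_mat l v \<in> carrier_mat n n" "row_mat l ?w \<in> carrier_mat n n" by (simp_all add: row_mat_def)
  fix i j assume "i < dim_row (1\<^sub>m n)" "j < dim_col (1\<^sub>m n)"
  then have ij: "i < n" "j < n" by simp_all
  show "(row_mat l v * row_mat l ?w) $$ (i, j) = 1\<^sub>m n $$ (i, j)"
  proof (cases "i = l")
    case False
    then show ?thesis
      using mat_mult_unit_row[OF c ij, of i] ij l by (simp add: row_mat_def)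
  next
    case True
    have "(row_mat l v * row_mat l ?w) $$ (i, j) = (\<Sum>x<n. v x * (if x = l then ?w j else of_bool (x = j)))"
      unfolding mat_mult_entry[OF c ij] by (rule sum.cong) (use True ij in \<open>auto simp: row_mat_def\<close>)
    also have "\<dots> = (\<Sum>x<n. (if x = l then v l * ?w j else 0) + (if x = j then (if j = l then 0 else v j) else 0))"
      by (rule sum.cong) auto
    also have "\<dots> = v l * ?w j + (if j = l then 0 else v j)"
      using l ij by (simp add: sum.distrib)
    also have "\<dots> = of_bool (j = l)" using v by simp
    finally show ?thesis using True ij by auto
  qed
qed (simp_all add: row_mat_def)

lemma row_mat_G:
  assumes "l < n" "v l \<noteq> 0"
  shows "row_mat l v \<in> carrier G"
proof -
  let ?w = "\<lambda>j. if j = l then 1 / v l else - v j / v l"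
  \<comment> \<open>The passage from \<open>v\<close> to \<open>?w\<close> is an involution, so
    \<open>row_mat_inv\<close> applied to \<open>?w\<close> yields the inverse on the other
    side.\<close>
  have "(\<lambda>j. if j = l then 1 / ?w l else - ?w j / ?w l) = v" using assms(2) by (auto simp: fun_eq_iff)
  then have "row_mat l ?w * row_mat l v = 1\<^sub>m n"
    using row_mat_inv[of l ?w] assms by simp
  moreover have "row_mat l v \<in> carrier_mat n n" "row_mat l ?w \<in> carrier_mat n n" by (simp_all add: row_mat_def)
  ultimately show ?thesis using carrier_GI row_mat_inv[of l v] assms by blast
qed

lemma transpose_G:
  assumes "X \<in> carrier G"
  shows "transpose_mat X \<in> carrier G"
proof -
  have c: "X \<in> carrier_mat n n" "inv\<^bsub>G\<^esub> X \<in> carrier_mat n n" using assms carrier_G_mat by auto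
  have "X * inv\<^bsub>G\<^esub> X = 1\<^sub>m n" "inv\<^bsub>G\<^esub> X * X = 1\<^sub>m n" using G.r_inv[OF assms] G.l_inv[OF assms] by simp_all
  moreover have "transpose_mat (inv\<^bsub>G\<^esub> X) * transpose_mat X = transpose_mat (X * inv\<^bsub>G\<^esub> X)"
    "transpose_mat X * transpose_mat (inv\<^bsub>G\<^esub> X) = transpose_mat (inv\<^bsub>G\<^esub> X * X)"
    using transpose_mult[OF c] transpose_mult[OF c(2,1)] by (simp_all only:)
  ultimately have "transpose_mat (inv\<^bsub>G\<^esub> X) * transpose_mat X = 1\<^sub>m n"
    "transpose_mat X * transpose_mat (inv\<^bsub>G\<^esub> X) = 1\<^sub>m n" by (simp_all only: transpose_one)
  then show ?thesis using c carrier_GI[of "transpose_mat X" "transpose_mat (inv\<^bsub>G\<^esub> X)"] by simp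
qed

text \<open>Gauss elimination with pivot row \<open>l\<close>: the matrix \<open>h1\<close> is the
  identity with column \<open>l\<close> replaced by \<open>v\<close>, which turns the pivot into
  \<open>c\<close> and clears the other entries above row \<open>r\<close>; \<open>v\<close>
  vanishes from \<open>r\<close> on, which keeps \<open>h1\<close> in the corner. A swap moves the
  remaining entry to row \<open>j\<close>.\<close>

lemma clear_column:
  assumes g: "g \<in> carrier_mat n n" and r: "r < n" "j < r" and l: "l < r" "g $$ (l, r) \<noteq> 0" and c: "c \<noteq> 0"
  shows "\<exists>h\<in>Gk r. \<forall>i<r. (h * g) $$ (i, r) = (if i = j then c else 0)"
proof -
  let ?x = "g $$ (l, r)"
  define v where "v i = (if i = l then c / ?x else if i < r then - g $$ (i, r) / ?x else 0)" for i
  define h1 where "h1 = transpose_mat (row_mat l v)"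
  have vl: "v l \<noteq> 0" using c l by (simp add: v_def)
  have ent: "h1 $$ (i, b) = (if b = l then v i else of_bool (i = b))" if "i < n" "b < n" for i b
    using that by (auto simp: h1_def row_mat_def)
  have "h1 \<in> carrier G" unfolding h1_def using transpose_G row_mat_G vl l r by simp
  then have h1: "h1 \<in> Gk r" using l by (auto simp: Gk_def ent v_def)
  have h1c: "h1 \<in> carrier_mat n n" using Gk_mat[OF h1] .
  have h1g: "(h1 * g) $$ (i, r) = (if i = l then c else 0)" if i: "i < r" for i
  proof -
    have i': "i < n" using i r by simp
    have "(h1 * g) $$ (i, r) = (\<Sum>b<n. (if b = l then v i else of_bool (i = b)) * g $$ (b, r))"
      unfolding mat_mult_entry[OF h1c g i' r(1)] by (rule sum.cong) (use i' in \<open>auto simp: ent\<close>)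
    also have "\<dots> = (\<Sum>b<n. (if b = l then v i * ?x else 0) + (if b = i then (if i = l then 0 else g $$ (i, r)) else 0))"
      by (rule sum.cong) auto
    also have "\<dots> = v i * ?x + (if i = l then 0 else g $$ (i, r))"
      using i' l r by (simp add: sum.distrib)
    also have "\<dots> = (if i = l then c else 0)" using i l by (simp add: v_def)
    finally show ?thesis .
  qed
  have hg: "h1 * g \<in> carrier_mat n n" using h1c g by simp
  let ?s = "swaprows_mat n l j"
  have s: "?s \<in> Gk r" using swaprows_Gk l r by simp
  have "(?s * h1 * g) $$ (i, r) = (if i = j then c else 0)" if i: "i < r" for i
  proof -
    have "?s * h1 * g = swaprows l j (h1 * g)"
      using swaprows_mat[OF hg, of l j] assoc_mult_mat[OF _ h1c g, of ?s n] l r by simp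
    moreover have "dim_row (h1 * g) = n" "dim_col (h1 * g) = n" using hg by auto
    ultimately show ?thesis using h1g[OF l(1)] h1g[OF r(2)] h1g[OF i] i l r by auto
  qed
  moreover have "?s * h1 \<in> Gk r" using subgroup.m_closed[OF subgroup_Gk s h1] by simp
  ultimately show ?thesis by blast
qed

text \<open>\<open>row_mat\<close> prescribes row \<open>l\<close>, with \<open>w l\<close> as
  pivot, and a swap inside the corner moves that row to \<open>i\<close>. As \<open>l < r\<close>,
  row \<open>r\<close> remains a unit vector.\<close>

lemma ex_row:
  assumes r: "r < n" "i < r" and w: "l < r" "w l \<noteq> 0"
  shows "\<exists>k\<in>Pk r. \<forall>j\<le>r. k $$ (i, j) = w j"
proof -
  define v where "v j = (if j \<le> r then w j else 0)" for j
  have "row_mat l v \<in> carrier G" using row_mat_G r w by (simp add: v_def)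
  then have K: "row_mat l v \<in> Pk r" using r w by (auto simp: Pk_def Gk_def row_mat_def v_def)
  have Kc: "row_mat l v \<in> carrier_mat n n" by (simp add: row_mat_def)
  let ?s = "swaprows_mat n l i"
  have s: "?s \<in> Pk r" using swaprows_Gk[of l r i] w r Gk_Hk Hk_Pk by simp
  have "?s * row_mat l v = swaprows l i (row_mat l v)" using swaprows_mat[OF Kc, of l i] r w by simp
  then have "(?s * row_mat l v) $$ (i, j) = w j" if "j \<le> r" for j
    using that r w by (auto simp: row_mat_def v_def)
  moreover have "?s * row_mat l v \<in> Pk r" using subgroup.m_closed[OF subgroup_Pk[OF r(1)] s K] by simp
  ultimately show ?thesis by blast
qed

end

section \<open>The extension steps between corner subgroups\<close>

context gl_setup
begin

lemma card_Gk: "2 \<le> r \<Longrightarrow> r \<le> n \<Longrightarrow> 3 \<le> card (Gk r)"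
proof -
  assume r: "2 \<le> r" "r \<le> n"
  let ?A = "addrow_mat n 1 0 1 :: 'a mat" and ?B = "addrow_mat n 1 1 0 :: 'a mat"
  have "{1\<^sub>m n, ?A, ?B} \<subseteq> Gk r"
    using addrow_Gk[of 0 r 1] addrow_Gk[of 1 r 0] subgroup.one_closed[OF subgroup_Gk[of r]] r by simp
  moreover have "card {1\<^sub>m n, ?A, ?B} = 3"
  proof -
    have ent: "(1\<^sub>m n :: 'a mat) $$ (0, 1) = 0" "(1\<^sub>m n :: 'a mat) $$ (1, 0) = 0" "?A $$ (0, 1) = 1" "?A $$ (1, 0) = 0"
      "?B $$ (1, 0) = 1" using r by simp_all
    then have "1\<^sub>m n \<noteq> ?A" "1\<^sub>m n \<noteq> ?B" "?A \<noteq> ?B" by (metis zero_neq_one)+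
    then show ?thesis by simp
  qed
  moreover have "finite (Gk r)" using finite_G by (rule finite_subset[rotated]) (auto simp: Gk_def)
  ultimately show ?thesis by (metis card_mono)
qed

lemma multrow_commute:
  assumes h: "h \<in> Gk r" and r: "r < n"
  shows "multrow_mat n r a * h = h * multrow_mat n r a"
proof (rule eq_matI)
  note hc = Gk_mat[OF h]
  have d: "dim_row h = n" "dim_col h = n" using hc by auto
  fix i j assume "i < dim_row (h * multrow_mat n r a)" "j < dim_col (h * multrow_mat n r a)"
  then have ij: "i < n" "j < n" using d by simp_all
  have "(multrow_mat n r a * h) $$ (i, j) = (if i = r then a * h $$ (i, j) else h $$ (i, j))"
    unfolding multrow_mat[OF hc, symmetric] using ij d by auto
  moreover have "(h * multrow_mat n r a) $$ (i, j) = h $$ (i, j) * (if j = r then a else 1)"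
  proof -
    have "multrow_mat n r a $$ (l, j) = 0" if "l < n" "l \<noteq> j" for l using that ij by auto
    from mat_mult_unit_col[OF hc multrow_mat_carrier ij this ij(2)] show ?thesis using ij by auto
  qed
  ultimately show "(multrow_mat n r a * h) $$ (i, j) = (h * multrow_mat n r a) $$ (i, j)"
    using GkD[OF h ij] by auto
qed (use Gk_mat[OF h] in auto)

lemma multrow_mult: "multrow_mat n r a * multrow_mat n r b = multrow_mat n r (a * b)" if "r < n" for a b :: 'a
  unfolding multrow_mat[OF multrow_mat_carrier, symmetric] using that by (intro eq_matI) auto

text \<open>The diagonal generator at position \<open>r\<close> commutes with \<open>Gk r\<close>,
  and its powers run through the factor GL_1. That factor is trivial for the field with two
  elements.\<close>

lemma hconn_Hk:
  assumes hc: "hconn E (Gk r)" and r: "2 \<le> r" "r < n"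
  shows "hconn E (Hk r)"
proof (cases "2 < CARD('a)")
  case False
  have "x = 1" if "x \<noteq> 0" for x :: 'a
  proof (rule ccontr)
    assume "x \<noteq> 1"
    then have "card {0, 1, x} = 3" using that by auto
    then show False using False card_mono[of "UNIV :: 'a set" "{0, 1, x}"] by simp
  qed
  then have 1: "g $$ (r, r) = 1" if "g \<in> Hk r" for g using Pk_diag_nz[OF Hk_Pk[OF that] r(2)] by blast
  have "g \<in> Gk r" if g: "g \<in> Hk r" for g
  proof -
    have "g $$ (i, j) = of_bool (i = j)" if ij: "i < n" "j < n" "r \<le> i \<or> r \<le> j" for i j
    proof -
      consider "Suc r \<le> i \<or> Suc r \<le> j" | "i = r" "j \<noteq> r" | "j = r" "i \<noteq> r" | "i = r" "j = r" using ij by linarith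
      then show ?thesis
        using GkD[OF Pk_Gk[OF Hk_Pk[OF g]] ij(1,2)] Pk_row[OF Hk_Pk[OF g] r(2) ij(2)] Hk_col[OF g r(2) ij(1)] 1[OF g]
        by cases auto
    qed
    moreover have "g \<in> carrier G" using g by (simp add: Hk_def Pk_def Gk_def)
    ultimately show ?thesis by (simp add: Gk_def)
  qed
  then have "Hk r = Gk r" using Gk_Hk[OF r(2)] by blast
  then show ?thesis using hc by simp
next
  case True
  let ?M = "multrow_mat n r \<alpha>"
  have MG: "?M \<in> carrier G" using multrow_G[OF r(2)] alpha_nz by simp
  have pow: "?M [^]\<^bsub>G\<^esub> i = multrow_mat n r (\<alpha> ^ i)" for i :: nat
  proof (induction i)
    case 0
    show ?case using r(2) by (auto intro!: eq_matI)
  next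
    case (Suc i)
    then show ?case using multrow_mult[OF r(2), of "\<alpha> ^ i" \<alpha>] by (simp add: mult.commute)
  qed
  have "hconn E {h \<otimes>\<^bsub>G\<^esub> ?M [^]\<^bsub>G\<^esub> i | h i. h \<in> Gk r \<and> i \<in> (UNIV :: nat set)}"
  proof (rule G.hconn_cyclic_extension[OF finite_G S_G S_inv subgroup_Gk card_Gk _ _ hc])
    show "?M \<in> S" using mult_S[OF True r(2)] .
    fix h assume h: "h \<in> Gk r"
    then have hG: "h \<in> carrier G" by (simp add: Gk_def)
    have "?M \<otimes>\<^bsub>G\<^esub> h = h \<otimes>\<^bsub>G\<^esub> ?M" using multrow_commute[OF h r(2)] by simp
    then have "?M \<otimes>\<^bsub>G\<^esub> h \<otimes>\<^bsub>G\<^esub> inv\<^bsub>G\<^esub> ?M = h"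
      using G.m_assoc[OF hG MG G.inv_closed[OF MG]] G.r_inv[OF MG] G.r_one[OF hG] by simp
    then show "?M \<otimes>\<^bsub>G\<^esub> h \<otimes>\<^bsub>G\<^esub> inv\<^bsub>G\<^esub> ?M \<in> Gk r" using h by simp
  qed (use r in auto)
  moreover have "{h \<otimes>\<^bsub>G\<^esub> ?M [^]\<^bsub>G\<^esub> i | h i. h \<in> Gk r \<and> i \<in> (UNIV :: nat set)} = Hk r"
  proof
    have M: "multrow_mat n r a \<in> Hk r" if "a \<noteq> 0" for a
      using multrow_Gk[of r "Suc r" a] r that by (auto simp: Hk_def Pk_def)
    have "h * multrow_mat n r (\<alpha> ^ i) \<in> Hk r" if "h \<in> Gk r" for h i
      using subgroup.m_closed[OF subgroup_Hk[OF r(2)] Gk_Hk[OF r(2) that] M[of "\<alpha> ^ i"]] alpha_nz by simp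
    then show "{h \<otimes>\<^bsub>G\<^esub> ?M [^]\<^bsub>G\<^esub> i | h i. h \<in> Gk r \<and> i \<in> (UNIV :: nat set)} \<subseteq> Hk r"
      by (auto simp: pow)
    show "Hk r \<subseteq> {h \<otimes>\<^bsub>G\<^esub> ?M [^]\<^bsub>G\<^esub> i | h i. h \<in> Gk r \<and> i \<in> (UNIV :: nat set)}"
    proof
      fix g assume g: "g \<in> Hk r"
      note gP = Hk_Pk[OF g]
      let ?c = "g $$ (r, r)"
      have c: "?c \<noteq> 0" using Pk_diag_nz[OF gP r(2)] .
      obtain i where i: "?c = \<alpha> ^ i" using ex_pow[OF c] by blast
      let ?h = "multrow_mat n r (1 / ?c) * g"
      have gm: "g \<in> carrier_mat n n" using Gk_mat[OF Pk_Gk[OF gP]] .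
      have d: "dim_row g = n" "dim_col g = n" using gm by auto
      have ent: "?h $$ (i, j) = (if i = r then g $$ (i, j) / ?c else g $$ (i, j))" if "i < n" "j < n" for i j
        unfolding multrow_mat[OF gm, symmetric] using that d by auto
      have hH: "?h \<in> Hk r"
        using subgroup.m_closed[OF subgroup_Hk[OF r(2)] M[of "1 / ?c"] g] c by simp
      have h: "?h \<in> Gk r"
      proof -
        have "?h $$ (i, j) = of_bool (i = j)" if ij: "i < n" "j < n" "r \<le> i \<or> r \<le> j" for i j
        proof -
          consider "Suc r \<le> i \<or> Suc r \<le> j" | "i = r" "j \<noteq> r" | "j = r" "i \<noteq> r" | "i = r" "j = r" using ij by linarith
          then show ?thesis
            using GkD[OF Pk_Gk[OF Hk_Pk[OF hH]] ij(1,2)] Pk_row[OF Hk_Pk[OF hH] r(2) ij(2)]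
              Hk_col[OF hH r(2) ij(1)] ent[OF r(2) r(2)] c
            by cases auto
        qed
        moreover have "?h \<in> carrier G" using hH by (simp add: Hk_def Pk_def Gk_def)
        ultimately show ?thesis by (simp add: Gk_def)
      qed
      have "?h * multrow_mat n r ?c = multrow_mat n r ?c * ?h" using multrow_commute[OF h r(2)] by simp
      also have "\<dots> = (multrow_mat n r ?c * multrow_mat n r (1 / ?c)) * g"
        using assoc_mult_mat[OF multrow_mat_carrier multrow_mat_carrier gm] by simp
      also have "\<dots> = g"
      proof -
        have "multrow_mat n r ?c * multrow_mat n r (1 / ?c) = 1\<^sub>m n"
          using multrow_mat_inv[OF r(2) c] by (simp add: inverse_eq_divide)
        then show ?thesis using gm by simp
      qed
      finally have "g = ?h \<otimes>\<^bsub>G\<^esub> ?M [^]\<^bsub>G\<^esub> i" by (simp add: pow i)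
      then show "g \<in> {h \<otimes>\<^bsub>G\<^esub> ?M [^]\<^bsub>G\<^esub> i | h i. h \<in> Gk r \<and> i \<in> (UNIV :: nat set)}" using h by blast
    qed
  qed
  ultimately show ?thesis by simp
qed

lemma conj_addrow:
  assumes "b < n" "d < n"
  shows "addrow_mat n x a b * addrow_mat n y c d * addrow_mat n z e f =
    addrow x a b (addrow y c d (addrow_mat n z e f :: 'a mat))"
proof -
  have "addrow y c d (addrow_mat n z e f) = addrow_mat n y c d * (addrow_mat n z e f :: 'a mat)"
    using addrow_mat[OF addrow_mat_carrier assms(2)] .
  moreover have "addrow x a b (addrow y c d (addrow_mat n z e f)) = addrow_mat n x a b * addrow y c d (addrow_mat n z e f :: 'a mat)"
    by (rule addrow_mat[OF _ assms(1), of _ n]) simp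
  ultimately show ?thesis
    using assoc_mult_mat[OF addrow_mat_carrier addrow_mat_carrier addrow_mat_carrier] by simp
qed

text \<open>\<open>?s\<close> adds row \<open>r\<close> to row \<open>j\<close>. After
  \<open>h\<close> has reduced column \<open>r\<close> of \<open>g\<close> above the diagonal to one
  entry in row \<open>j\<close>, equal to the diagonal entry, the inverse of \<open>?s\<close>
  removes it; this proves \<open>cover\<close>. Additions of other rows above \<open>r\<close> into
  row \<open>j\<close> commute with \<open>?s\<close>, so they can serve as parallel links.\<close>

lemma hconn_Pk:
  assumes hc: "hconn E (Hk r)" and r: "2 \<le> r" "r < n" and large: "3 \<le> r \<or> 2 < CARD('a)"
  shows "hconn E (Pk r)"
proof -
  obtain j where j: "j < r" "(r, j) \<in> parcs T" using down[of r] r by auto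
  have jn: "j < n" "j \<noteq> r" using j r by auto
  let ?s = "addrow_mat n 1 j r :: 'a mat"
  have sG: "?s \<in> carrier G" using addrow_G[of j r] jn r by simp
  have sinv: "inv\<^bsub>G\<^esub> ?s = addrow_mat n (- 1) j r" using inv_addrow[of j r 1] jn r by simp
  have sP: "?s \<in> Pk r" using addrow_Pk[of j r r 1] j r by simp
  obtain l where l: "l < r" "l \<noteq> j"
  proof -
    have "\<exists>l<r. l \<noteq> j" using r by (intro exI[of _ "if j = 0 then 1 else 0"]) auto
    then show thesis using that by blast
  qed
  \<comment> \<open>Two distinct nontrivial additions into row \<open>j\<close>: two coefficients if
    q > 2, otherwise two source rows, which takes r >= 3.\<close>
  obtain a b l' where ab: "a \<noteq> 0" "b \<noteq> (0 :: 'a)" "l' < r" "l' \<noteq> j" "a \<noteq> b \<or> l \<noteq> l'"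
  proof (cases "2 < CARD('a)")
    case True
    then have "2 \<le> m" using m_def by simp
    then show thesis using that[of 1 \<alpha> l] alpha_nz alpha_neq_1 l by auto
  next
    case False
    then have "3 \<le> r" using large by simp
    then have "\<exists>l'<r. l' \<noteq> j \<and> l' \<noteq> l"
      by (intro exI[of _ "if j \<noteq> 0 \<and> l \<noteq> 0 then 0 else if j \<noteq> 1 \<and> l \<noteq> 1 then 1 else 2"]) auto
    then show thesis using that[of 1 1] by auto
  qed
  let ?A = "addrow_mat n a j l" and ?B = "addrow_mat n b j l'"
  have conj: "?s * addrow_mat n x j y * addrow_mat n (- 1) j r = addrow_mat n x j y" if "y < r" "y \<noteq> j" for x y
    unfolding conj_addrow[OF r(2) less_trans[OF that(1) r(2)]]
    using that jn r j by (intro eq_matI) auto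
  show ?thesis
  proof (rule G.hconn_coset_join[OF finite_G S_G S_inv subgroup_Hk[OF r(2)] subgroup_Pk[OF r(2)] _ arc_S[OF j(2)] sP])
    show "Hk r \<subseteq> Pk r" using Hk_Pk by blast
    show "hconn E (Hk r)" by (rule hc)
    show "\<exists>k\<in>Hk r. ?s \<otimes>\<^bsub>G\<^esub> k \<otimes>\<^bsub>G\<^esub> inv\<^bsub>G\<^esub> g \<in> Hk r" if g: "g \<in> Pk r" and gH: "g \<notin> Hk r" for g
    proof -
      have gG: "g \<in> carrier G" using g by (simp add: Pk_def Gk_def)
      have gm: "g \<in> carrier_mat n n" using carrier_G_mat[OF gG] .
      let ?c = "g $$ (r, r)"
      have c: "?c \<noteq> 0" using Pk_diag_nz[OF g r(2)] .
      obtain i where i: "i < r" "g $$ (i, r) \<noteq> 0" using g gH by (auto simp: Hk_def)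
      obtain h where h: "h \<in> Gk r" "\<forall>i<r. (h * g) $$ (i, r) = (if i = j then ?c else 0)"
        using clear_column[OF gm r(2) j(1) i c] by blast
      have hH: "h \<in> Hk r" using Gk_Hk[OF r(2) h(1)] .
      have hG: "h \<in> carrier G" using h by (simp add: Gk_def)
      have hg: "h * g \<in> carrier_mat n n" using Gk_mat[OF h(1)] gm by simp
      have d: "dim_row (h * g) = n" "dim_col (h * g) = n" using hg by auto
      let ?k = "addrow_mat n (- 1) j r * (h * g)"
      have kP: "?k \<in> Pk r"
        using subgroup.m_closed[OF subgroup_Pk[OF r(2)] addrow_Pk[of j r r "- 1"]
            subgroup.m_closed[OF subgroup_Pk[OF r(2)] Hk_Pk[OF hH] g]] j r by simp
      have hr: "(h * g) $$ (r, r) = ?c" using Gk_mult_row[OF h(1) gm _ r(2) r(2)] by simp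
      have "?k $$ (i, r) = 0" if "i < r" for i
        unfolding addrow_mat[OF hg r(2), symmetric] using that h(2) hr d r j by auto
      then have kH: "?k \<in> Hk r" using kP by (simp add: Hk_def)
      have hgG: "h * g \<in> carrier G" using G.m_closed[OF hG gG] by simp
      have "?s \<otimes>\<^bsub>G\<^esub> ?k = h \<otimes>\<^bsub>G\<^esub> g"
      proof -
        have "?s \<otimes>\<^bsub>G\<^esub> (inv\<^bsub>G\<^esub> ?s \<otimes>\<^bsub>G\<^esub> (h * g)) = h * g"
          using G.m_assoc[OF sG G.inv_closed[OF sG] hgG] G.r_inv[OF sG] G.l_one[OF hgG] by (simp del: mult_G)
        then show ?thesis unfolding sinv by simp
      qed
      then have "?s \<otimes>\<^bsub>G\<^esub> ?k \<otimes>\<^bsub>G\<^esub> inv\<^bsub>G\<^esub> g = h"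
        using G.m_assoc[OF hG gG G.inv_closed[OF gG]] G.r_inv[OF gG] G.r_one[OF hG] by (simp del: mult_G)
      then show ?thesis using kH hH by metis
    qed
    show "{1\<^sub>m n, ?A, ?B} \<subseteq> Hk r"
      using subgroup.one_closed[OF subgroup_Hk[OF r(2)]] addrow_Gk[of j r l a] addrow_Gk[of j r l' b] Gk_Hk[OF r(2)] j l ab r
      by auto
    have "(1\<^sub>m n :: 'a mat) $$ (j, l) \<noteq> ?A $$ (j, l)" "(1\<^sub>m n :: 'a mat) $$ (j, l') \<noteq> ?B $$ (j, l')"
      "?A $$ (j, l) \<noteq> ?B $$ (j, l)" using ab l jn r by auto
    then have "1\<^sub>m n \<noteq> ?A" "1\<^sub>m n \<noteq> ?B" "?A \<noteq> ?B" by auto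
    then show "3 \<le> card {1\<^sub>m n, ?A, ?B}" by simp
    show "?s \<otimes>\<^bsub>G\<^esub> d \<otimes>\<^bsub>G\<^esub> inv\<^bsub>G\<^esub> ?s \<in> Hk r" if "d \<in> {1\<^sub>m n, ?A, ?B}" for d
    proof -
      have "?s * 1\<^sub>m n * inv\<^bsub>G\<^esub> ?s = 1\<^sub>m n" using G.r_inv[OF sG] carrier_G_mat[OF sG] by simp
      moreover have "?s * ?A * addrow_mat n (- 1) j r = ?A" "?s * ?B * addrow_mat n (- 1) j r = ?B"
        using conj l ab by simp_all
      ultimately have "?s \<otimes>\<^bsub>G\<^esub> d \<otimes>\<^bsub>G\<^esub> inv\<^bsub>G\<^esub> ?s = d" using that unfolding sinv by auto
      then show ?thesis using that \<open>{1\<^sub>m n, ?A, ?B} \<subseteq> Hk r\<close> by auto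
    qed
    show "addrow_mat n 1 l j \<in> Hk r" using addrow_Gk[of l r j 1] Gk_Hk[OF r(2)] l j r by simp
    have "(?s * addrow_mat n 1 l j * addrow_mat n (- 1) j r) $$ (l, r) = - 1"
      unfolding conj_addrow[OF r(2) jn(1)] using l j r jn by simp
    then show "?s \<otimes>\<^bsub>G\<^esub> addrow_mat n 1 l j \<otimes>\<^bsub>G\<^esub> inv\<^bsub>G\<^esub> ?s \<notin> Hk r"
      unfolding sinv using l by (auto simp: Hk_def)
  qed
qed

text \<open>\<open>?s\<close> adds row \<open>i\<close> to row \<open>r\<close>. If row
  \<open>r\<close> of \<open>?k'\<close> is the unit vector and row \<open>i\<close> is row
  \<open>r\<close> of \<open>g\<close> minus that unit vector, then \<open>?s * ?k'\<close> and
  \<open>g\<close> agree in row \<open>r\<close>, so their quotient fixes the unit row and lies in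
  \<open>Pk r\<close>.\<close>

lemma hconn_Gk_Suc:
  assumes hc: "hconn E (Pk r)" and r: "2 \<le> r" "r < n"
  shows "hconn E (Gk (Suc r))"
proof -
  obtain i where i: "i < r" "(i, r) \<in> parcs T" using up[of r] r by auto
  have jn: "i < n" "i \<noteq> r" using i r by auto
  let ?s = "addrow_mat n 1 r i :: 'a mat"
  have sG: "?s \<in> carrier G" using addrow_G[of r i] jn r by simp
  have sinv: "inv\<^bsub>G\<^esub> ?s = addrow_mat n (- 1) r i" using inv_addrow[of r i 1] jn r by simp
  have sk: "?s \<in> Gk (Suc r)" using addrow_Gk[of r "Suc r" i 1] i r by simp
  obtain l where l: "l < r" "l \<noteq> i"
  proof -
    have "\<exists>l<r. l \<noteq> i" using r by (intro exI[of _ "if i = 0 then 1 else 0"]) auto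
    then show thesis using that by blast
  qed
  \<comment> \<open>Additions into a row \<open>l\<close> other than \<open>i\<close> and
    \<open>r\<close> leave both rows involved in \<open>?s\<close> alone. The sources
    \<open>i\<close> and \<open>r\<close> give two of them already for r = 2 and coefficient
    1.\<close>
  let ?A = "addrow_mat n 1 l i :: 'a mat" and ?B = "addrow_mat n 1 l r :: 'a mat"
  show ?thesis
  proof (rule G.hconn_coset_join[OF finite_G S_G S_inv subgroup_Pk[OF r(2)] subgroup_Gk _ arc_S[OF i(2)] sk])
    show "Pk r \<subseteq> Gk (Suc r)" using Pk_Gk by blast
    show "hconn E (Pk r)" by (rule hc)
    show "\<exists>k\<in>Pk r. ?s \<otimes>\<^bsub>G\<^esub> k \<otimes>\<^bsub>G\<^esub> inv\<^bsub>G\<^esub> g \<in> Pk r" if g: "g \<in> Gk (Suc r)" and gP: "g \<notin> Pk r" for g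
    proof -
      have gG: "g \<in> carrier G" using g by (simp add: Gk_def)
      have gm: "g \<in> carrier_mat n n" "inv\<^bsub>G\<^esub> g \<in> carrier_mat n n" using carrier_G_mat gG by auto
      obtain p where p: "p < r" "g $$ (r, p) \<noteq> 0" using g gP by (auto simp: Pk_def)
      define w where "w j = g $$ (r, j) - of_bool (j = r)" for j
      have "w p \<noteq> 0" using p by (simp add: w_def)
      then obtain k where k: "k \<in> Pk r" "\<forall>j\<le>r. k $$ (i, j) = w j" using ex_row[OF r(2) i(1) p(1)] by blast
      have kg: "k \<in> Gk (Suc r)" using Pk_Gk[OF k(1)] .
      have km: "k \<in> carrier_mat n n" using Gk_mat[OF kg] .
      have d: "dim_row k = n" "dim_col k = n" using km by auto
      let ?k' = "multrow_mat n r (1 / k $$ (r, r)) * k"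
      have nz: "k $$ (r, r) \<noteq> 0" using Pk_diag_nz[OF k(1) r(2)] .
      have M: "multrow_mat n r (1 / k $$ (r, r)) \<in> Pk r"
        using multrow_Gk[of r "Suc r" "1 / k $$ (r, r)"] r nz by (auto simp: Pk_def)
      have k': "?k' \<in> Pk r" using subgroup.m_closed[OF subgroup_Pk[OF r(2)] M k(1)] by simp
      have k'm: "?k' \<in> carrier_mat n n" using Gk_mat[OF Pk_Gk[OF k']] .
      have ent: "?k' $$ (a, j) = (if a = r then k $$ (a, j) / k $$ (r, r) else k $$ (a, j))" if "a < n" "j < n" for a j
        unfolding multrow_mat[OF km, symmetric] using that d by auto
      have sk': "?s * ?k' \<in> carrier_mat n n" by (rule mult_carrier_mat[OF addrow_mat_carrier k'm])
      have row: "(?s * ?k') $$ (r, j) = g $$ (r, j)" if j: "j < n" for j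
      proof -
        have "(?s * ?k') $$ (r, j) = ?k' $$ (i, j) + ?k' $$ (r, j)"
          unfolding addrow_mat[OF k'm jn(1), symmetric] using r j d by simp
        also have "\<dots> = k $$ (i, j) + of_bool (j = r)"
          using ent[OF jn(1) j] ent[OF r(2) j] jn nz Pk_row[OF k(1) r(2) j] by auto
        also have "\<dots> = g $$ (r, j)"
        proof (cases "j \<le> r")
          case True
          then show ?thesis using k(2) by (simp add: w_def)
        next
          case False
          then show ?thesis using GkD[OF kg jn(1) j] GkD[OF g r(2) j] i by auto
        qed
        finally show ?thesis .
      qed
      let ?h = "?s \<otimes>\<^bsub>G\<^esub> ?k' \<otimes>\<^bsub>G\<^esub> inv\<^bsub>G\<^esub> g"
      have hG: "?h \<in> Gk (Suc r)"
        using subgroup.m_closed[OF subgroup_Gk subgroup.m_closed[OF subgroup_Gk sk Pk_Gk[OF k']]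
            subgroup.m_inv_closed[OF subgroup_Gk g]] .
      have "?h $$ (r, j) = 0" if j: "j < r" for j
      proof -
        have jn: "j < n" using j r by simp
        have "?h $$ (r, j) = (\<Sum>x<n. g $$ (r, x) * (inv\<^bsub>G\<^esub> g) $$ (x, j))"
          unfolding mult_G mat_mult_entry[OF sk' gm(2) r(2) jn] by (rule sum.cong) (use row in auto)
        also have "\<dots> = (g * inv\<^bsub>G\<^esub> g) $$ (r, j)" using mat_mult_entry[OF gm r(2) jn] by simp
        also have "\<dots> = 0" using G.r_inv[OF gG] r(2) jn j by simp
        finally show ?thesis .
      qed
      then have "?h \<in> Pk r" using hG by (simp add: Pk_def)
      then show ?thesis using k' by blast
    qed
    show AB: "{1\<^sub>m n, ?A, ?B} \<subseteq> Pk r"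
      using subgroup.one_closed[OF subgroup_Pk[OF r(2)]] addrow_Pk[of l r i 1] addrow_Pk[of l r r 1] i l r
      by auto
    have ln: "l < n" using l r by simp
    have "(1\<^sub>m n :: 'a mat) $$ (l, i) \<noteq> ?A $$ (l, i)" "(1\<^sub>m n :: 'a mat) $$ (l, r) \<noteq> ?B $$ (l, r)"
      "?A $$ (l, i) \<noteq> ?B $$ (l, i)" using l ln jn r by auto
    then have "1\<^sub>m n \<noteq> ?A" "1\<^sub>m n \<noteq> ?B" "?A \<noteq> ?B" by auto
    then show "3 \<le> card {1\<^sub>m n, ?A, ?B}" by simp
    show "?s \<otimes>\<^bsub>G\<^esub> d \<otimes>\<^bsub>G\<^esub> inv\<^bsub>G\<^esub> ?s \<in> Pk r" if "d \<in> {1\<^sub>m n, ?A, ?B}" for d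
    proof -
      have in_G: "?s \<otimes>\<^bsub>G\<^esub> d \<otimes>\<^bsub>G\<^esub> inv\<^bsub>G\<^esub> ?s \<in> Gk (Suc r)"
        using subgroup.m_closed[OF subgroup_Gk subgroup.m_closed[OF subgroup_Gk sk]
            subgroup.m_inv_closed[OF subgroup_Gk sk]] AB that Pk_Gk by blast
      have A: "(?s * addrow_mat n 1 l x * addrow_mat n (- 1) r i) $$ (r, j) = 0" if "j < r" "x < n" for x j
        unfolding conj_addrow[OF jn(1) that(2)] using that l ln jn r by simp
      have one: "?s * 1\<^sub>m n * addrow_mat n (- 1) r i = 1\<^sub>m n"
        using G.r_inv[OF sG] carrier_G_mat[OF sG] unfolding sinv by simp
      have "(?s \<otimes>\<^bsub>G\<^esub> d \<otimes>\<^bsub>G\<^esub> inv\<^bsub>G\<^esub> ?s) $$ (r, j) = 0" if "j < r" for j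
      proof -
        consider "d = 1\<^sub>m n" | "d = ?A" | "d = ?B" using \<open>d \<in> {1\<^sub>m n, ?A, ?B}\<close> by blast
        then show ?thesis
        proof cases
          case 1
          show ?thesis unfolding 1 mult_G sinv one using that r by simp
        next
          case 2
          show ?thesis unfolding 2 mult_G sinv by (rule A[OF that jn(1)])
        next
          case 3
          show ?thesis unfolding 3 mult_G sinv by (rule A[OF that r(2)])
        qed
      qed
      then show ?thesis using in_G by (simp add: Pk_def)
    qed
    show "addrow_mat n 1 i r \<in> Pk r" using addrow_Pk[of i r r 1] i r by simp
    have "(?s * addrow_mat n 1 i r * addrow_mat n (- 1) r i) $$ (r, i) = - 1"
      unfolding conj_addrow[OF jn(1) r(2)] using i r jn by simp
    then show "?s \<otimes>\<^bsub>G\<^esub> addrow_mat n 1 i r \<otimes>\<^bsub>G\<^esub> inv\<^bsub>G\<^esub> ?s \<notin> Pk r"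
      unfolding sinv using i by (auto simp: Pk_def)
  qed
qed

lemma hconn_Gk_induct:
  assumes base: "hconn E (Gk b)" and b: "2 \<le> b" "b \<le> n" and large: "3 \<le> b \<or> 2 < CARD('a)"
  shows "hconn E (carrier G)"
proof -
  have "hconn E (Gk k)" if "b \<le> k" "k \<le> n" for k
    using that
  proof (induction k rule: dec_induct)
    case base
    then show ?case using assms(1) by simp
  next
    case (step k)
    then have k: "2 \<le> k" "k < n" "3 \<le> k \<or> 2 < CARD('a)" using b large by auto
    then show ?case
      using hconn_Gk_Suc[OF hconn_Pk[OF hconn_Hk] k(1,2)] step by auto
  qed
  from this[OF b(2) order_refl] show ?thesis unfolding Gk_n .
qed

end

section \<open>The field with two elements\<close>

text \<open>
  The two upper rows of a \<open>3 \<times> 3\<close> matrix with last row \<open>(0, 0, 1)\<close>. The words in a certificate list the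
  generators to apply: \<open>0\<close> adds the first row to the second, \<open>1\<close> the second to the first, and \<open>2\<close>
  and \<open>3\<close> add the third row to the first and to the second.
\<close>

type_synonym affine_bits = "(bool \<times> bool \<times> bool) \<times> (bool \<times> bool \<times> bool)"

fun bit_op :: "nat \<Rightarrow> affine_bits \<Rightarrow> affine_bits" where
  "bit_op i ((a, b, x), (c, d, y)) =
     (if i = 0 then ((a, b, x), (c \<noteq> a, d \<noteq> b, y \<noteq> x))
      else if i = 1 then ((a \<noteq> c, b \<noteq> d, x \<noteq> y), (c, d, y))
      else if i = 2 then ((a, b, \<not> x), (c, d, y))
      else ((a, b, x), (c, d, \<not> y)))"

fun bit_run :: "nat list \<Rightarrow> affine_bits \<Rightarrow> affine_bits list" where
  "bit_run [] s = [s]"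
| "bit_run (i # w) s = s # bit_run w (bit_op i s)"

fun bit_valid :: "affine_bits \<Rightarrow> bool" where
  "bit_valid ((a, b, x), (c, d, y)) \<longleftrightarrow> (a \<and> d) \<noteq> (b \<and> c)"

definition bit_one :: affine_bits where
  "bit_one = ((True, False, False), (False, True, False))"

text \<open>The group has 24 elements, so each word has 23 letters. That the first path meets all
  valid states fixes their number, and then every other distinct path of that length meets them all,
  too. The parameter \<open>j\<close> is the letter for the addition of the third row, which goes to
  the first or to the second row depending on the arc in the graph.\<close>

definition bit_cert :: "nat \<Rightarrow> nat list list \<Rightarrow> bool" where
  "bit_cert j ws \<longleftrightarrow> ws \<noteq> [] \<and>
     list_all (\<lambda>w. list_all (\<lambda>i. i = 0 \<or> i = 1 \<or> i = j) w \<and> distinct (bit_run w bit_one) \<and>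
       length w = 23 \<and> list_all bit_valid (bit_run w bit_one)) ws \<and>
     (\<forall>s. bit_valid s \<longrightarrow> s \<in> set (bit_run (hd ws) bit_one)) \<and>
     list_all (\<lambda>s. s = bit_one \<or> s \<in> set (map (\<lambda>w. last (bit_run w bit_one)) ws)) (bit_run (hd ws) bit_one)"

lemma bit_cert_2: "bit_cert 2
    [[1, 0, 1, 0, 2, 0, 1, 0, 2, 0, 1, 0, 2, 0, 1, 0, 1, 0, 2, 0, 2, 0, 2],
    [0, 1, 0, 1, 2, 1, 0, 1, 0, 1, 2, 1, 0, 1, 0, 1, 2, 1, 0, 1, 0, 1, 2],
    [0, 1, 0, 1, 0, 2, 0, 1, 0, 2, 0, 1, 0, 2, 0, 1, 0, 1, 0, 2, 0, 2, 0],
    [0, 2, 0, 2, 0, 1, 2, 1, 0, 1, 2, 0, 1, 2, 1, 0, 2, 0, 2, 1, 2, 0, 2],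
    [0, 1, 0, 1, 0, 2, 1, 0, 2, 0, 2, 1, 2, 0, 1, 0, 2, 0, 1, 2, 1, 0, 1],
    [0, 1, 0, 2, 1, 0, 2, 0, 2, 1, 2, 0, 1, 0, 2, 0, 1, 2, 1, 0, 1, 2, 0],
    [1, 0, 1, 0, 1, 2, 1, 0, 1, 2, 1, 0, 2, 0, 1, 0, 2, 1, 2, 0, 2, 0, 1],
    [0, 2, 0, 1, 2, 1, 0, 1, 2, 0, 1, 2, 1, 0, 2, 0, 2, 1, 2, 0, 2, 1, 0],
    [0, 2, 0, 1, 2, 1, 0, 1, 0, 1, 2, 0, 2, 1, 0, 1, 0, 1, 2, 1, 0, 2, 0],
    [1, 0, 1, 0, 1, 2, 0, 1, 0, 2, 0, 1, 0, 2, 0, 1, 0, 1, 0, 2, 0, 2, 0],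
    [0, 1, 0, 2, 1, 2, 0, 2, 1, 0, 1, 2, 1, 0, 1, 2, 0, 2, 1, 2, 0, 1, 0],
    [0, 1, 0, 1, 0, 2, 1, 0, 1, 0, 1, 2, 1, 0, 1, 0, 1, 2, 1, 0, 1, 0, 1],
    [0, 1, 0, 1, 0, 2, 1, 0, 1, 0, 2, 0, 1, 0, 2, 0, 1, 0, 1, 0, 2, 0, 2],
    [0, 1, 0, 1, 0, 2, 1, 0, 2, 0, 2, 0, 1, 0, 2, 1, 2, 0, 2, 0, 1, 0, 2],
    [0, 1, 0, 1, 0, 2, 1, 0, 1, 2, 0, 1, 0, 2, 0, 2, 1, 2, 0, 1, 0, 2, 0],
    [0, 1, 0, 1, 0, 2, 1, 0, 1, 2, 1, 0, 2, 0, 1, 0, 2, 1, 2, 0, 2, 0, 1],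
    [0, 1, 0, 1, 0, 2, 1, 0, 1, 0, 1, 2, 0, 2, 0, 1, 0, 1, 0, 2, 0, 1, 0],
    [0, 1, 0, 1, 0, 2, 1, 0, 1, 0, 1, 2, 1, 0, 1, 0, 2, 0, 1, 0, 1, 0, 2],
    [0, 1, 0, 1, 0, 2, 1, 0, 1, 0, 1, 2, 1, 0, 1, 0, 1, 2, 0, 1, 0, 1, 0],
    [0, 1, 0, 2, 1, 2, 0, 2, 1, 0, 1, 2, 1, 0, 2, 0, 1, 0, 2, 1, 2, 0, 2],
    [0, 1, 0, 2, 1, 2, 0, 2, 1, 0, 1, 2, 1, 0, 1, 2, 1, 0, 1, 0, 1, 2, 1],
    [0, 1, 0, 2, 1, 2, 0, 2, 1, 0, 1, 2, 1, 0, 1, 2, 1, 0, 1, 0, 2, 1, 2],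
    [0, 1, 0, 2, 1, 2, 0, 2, 1, 0, 1, 0, 1, 2, 1, 0, 1, 0, 1, 2, 1, 0, 1]]"
  by code_simp

lemma bit_cert_3: "bit_cert 3
    [[1, 0, 1, 0, 3, 0, 1, 0, 1, 0, 3, 0, 1, 0, 1, 0, 3, 0, 1, 0, 1, 0, 3],
    [0, 1, 0, 1, 3, 1, 0, 1, 3, 1, 0, 1, 3, 1, 0, 1, 0, 1, 3, 1, 3, 1, 3],
    [0, 1, 0, 1, 0, 3, 0, 1, 0, 1, 0, 3, 0, 1, 0, 1, 0, 3, 0, 1, 0, 1, 0],
    [0, 3, 0, 1, 0, 1, 0, 3, 0, 1, 0, 3, 0, 1, 3, 1, 0, 1, 3, 0, 3, 1, 3],
    [0, 1, 0, 1, 0, 3, 0, 1, 0, 3, 0, 1, 3, 1, 0, 1, 3, 0, 3, 1, 3, 1, 0],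
    [0, 1, 0, 3, 0, 1, 0, 3, 0, 1, 3, 1, 0, 1, 3, 0, 3, 1, 3, 1, 0, 3, 0],
    [0, 1, 0, 3, 0, 1, 0, 3, 0, 1, 3, 1, 0, 1, 3, 0, 3, 1, 3, 1, 3, 0, 3],
    [0, 1, 0, 3, 0, 1, 0, 1, 0, 3, 1, 3, 1, 3, 0, 3, 1, 0, 1, 3, 1, 0, 1],
    [0, 1, 3, 1, 0, 1, 3, 1, 0, 1, 3, 1, 0, 1, 3, 0, 3, 1, 3, 1, 3, 1, 3],
    [0, 1, 0, 3, 1, 0, 1, 3, 1, 3, 0, 3, 1, 3, 1, 0, 1, 0, 1, 3, 1, 3, 1],
    [0, 3, 0, 1, 0, 1, 3, 1, 3, 0, 3, 1, 3, 1, 0, 1, 3, 0, 3, 1, 3, 1, 3],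
    [0, 1, 0, 1, 0, 3, 1, 0, 1, 3, 1, 0, 1, 3, 1, 0, 1, 0, 1, 3, 1, 3, 1],
    [0, 1, 0, 1, 0, 3, 0, 1, 0, 1, 3, 1, 0, 1, 3, 1, 0, 1, 0, 1, 3, 1, 3],
    [0, 1, 0, 1, 0, 3, 0, 1, 0, 1, 0, 3, 0, 1, 0, 1, 0, 3, 1, 0, 1, 0, 1],
    [0, 1, 0, 1, 0, 3, 0, 1, 0, 1, 0, 3, 0, 1, 0, 1, 3, 1, 0, 1, 0, 1, 3],
    [0, 1, 0, 1, 0, 3, 0, 1, 3, 1, 3, 0, 3, 1, 0, 1, 3, 1, 0, 3, 0, 1, 0],
    [0, 1, 0, 1, 0, 3, 0, 1, 0, 1, 0, 3, 1, 3, 1, 0, 1, 0, 1, 3, 1, 0, 1],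
    [0, 1, 0, 1, 0, 3, 0, 1, 0, 3, 1, 0, 1, 3, 1, 3, 0, 3, 1, 0, 1, 3, 1],
    [0, 1, 0, 1, 0, 3, 0, 1, 3, 1, 3, 1, 0, 1, 3, 0, 3, 1, 3, 1, 0, 1, 3],
    [0, 3, 0, 1, 0, 1, 0, 3, 1, 3, 1, 3, 0, 3, 1, 0, 1, 3, 1, 3, 0, 3, 1],
    [0, 1, 0, 3, 0, 1, 0, 3, 1, 3, 0, 3, 1, 3, 1, 3, 0, 3, 1, 0, 1, 3, 1],
    [0, 1, 0, 3, 0, 1, 3, 1, 3, 1, 0, 1, 3, 0, 3, 1, 3, 1, 3, 0, 3, 1, 3],
    [0, 1, 0, 3, 0, 1, 0, 1, 3, 1, 0, 1, 3, 1, 0, 1, 3, 0, 3, 1, 3, 1, 3]]"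
  by code_simp

lemma length_bit_run: "length (bit_run w s) = Suc (length w)"
  by (induction w arbitrary: s) auto

lemma hd_bit_run: "bit_run w s \<noteq> [] \<and> hd (bit_run w s) = s"
  by (cases w) auto

lemma successively_bit_run:
  "list_all P w \<Longrightarrow> successively (\<lambda>s t. \<exists>i. P i \<and> t = bit_op i s) (bit_run w s)"
proof (induction w arbitrary: s)
  case (Cons i w)
  then show ?case using hd_bit_run[of w "bit_op i s"] by (auto simp: successively_Cons)
qed simp

lemma bit_cert_hpath:
  assumes "bit_cert j ws" "bit_valid s" "s \<noteq> bit_one"
  shows "\<exists>w. list_all (\<lambda>i. i = 0 \<or> i = 1 \<or> i = j) w \<and>
    hpath (\<lambda>s t. \<exists>i. (i = 0 \<or> i = 1 \<or> i = j) \<and> t = bit_op i s) {s. bit_valid s} bit_one (bit_run w bit_one) s"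
proof -
  have w: "list_all (\<lambda>i. i = 0 \<or> i = 1 \<or> i = j) w" "distinct (bit_run w bit_one)" "length w = 23"
      "list_all bit_valid (bit_run w bit_one)" if "w \<in> set ws" for w
    using assms(1) that unfolding bit_cert_def list_all_iff by blast+
  have cover: "{s. bit_valid s} \<subseteq> set (bit_run (hd ws) bit_one)" and ne: "ws \<noteq> []"
    using assms(1) unfolding bit_cert_def by blast+
  have card: "card (set (bit_run w bit_one)) = 24" if "w \<in> set ws" for w
    using w(2,3)[OF that] by (simp add: distinct_card length_bit_run)
  have sub: "set (bit_run w bit_one) \<subseteq> {s. bit_valid s}" if "w \<in> set ws" for w
    using w(4)[OF that] by (auto simp: list_all_iff)
  have hd: "{s. bit_valid s} = set (bit_run (hd ws) bit_one)"
    using cover sub[of "hd ws"] ne by auto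
  have eq: "set (bit_run w bit_one) = {s. bit_valid s}" if "w \<in> set ws" for w
    using card_subset_eq[OF _ sub[OF that]] card[OF that] card[of "hd ws"] ne unfolding hd by simp
  have "s \<in> set (bit_run (hd ws) bit_one)" using assms(2) hd by blast
  then have "s \<in> set (map (\<lambda>w. last (bit_run w bit_one)) ws)"
    using assms(1,3) unfolding bit_cert_def list_all_iff by blast
  then obtain w where w': "w \<in> set ws" "s = last (bit_run w bit_one)" by auto
  have "hpath (\<lambda>s t. \<exists>i. (i = 0 \<or> i = 1 \<or> i = j) \<and> t = bit_op i s) {s. bit_valid s} bit_one (bit_run w bit_one) s"
    using w(2)[OF w'(1)] eq[OF w'(1)] hd_bit_run[of w bit_one] w'(2) successively_bit_run[OF w(1)[OF w'(1)]]
    by (simp add: hpath_def)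
  then show ?thesis using w(1)[OF w'(1)] by blast
qed

text \<open>A right translation by \<open>u\<close> moves the starting point from the unit element
  to \<open>u\<close>.\<close>

lemma (in group) hconn_from_one:
  assumes S: "S \<subseteq> carrier G" and K: "subgroup K G"
    and one: "\<And>v. v \<in> K \<Longrightarrow> v \<noteq> \<one> \<Longrightarrow> \<exists>p. hpath (cayley S) K \<one> p v"
  shows "hconn (cayley S) K"
  unfolding hconn_def
proof (intro ballI impI)
  fix u v assume u: "u \<in> K" and v: "v \<in> K" and uv: "u \<noteq> v"
  note Kc = subgroup.mem_carrier[OF K]
  note uc = Kc[OF u] and vc = Kc[OF v]
  have "v \<otimes> inv u \<in> K" using subgroup.m_closed[OF K v subgroup.m_inv_closed[OF K u]] .
  moreover have "v \<otimes> inv u \<noteq> \<one>" using uv uc vc by (metis inv_equality inv_inv inv_closed)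
  ultimately obtain p where p: "hpath (cayley S) K \<one> p (v \<otimes> inv u)" using one by blast
  have "hpath (cayley S) ((\<lambda>x. x \<otimes> u) ` K) (\<one> \<otimes> u) (map (\<lambda>x. x \<otimes> u) p) (v \<otimes> inv u \<otimes> u)"
    by (rule hpath_image[OF p]) (use Kc uc S in \<open>auto simp: inj_on_def cayley_def m_assoc subset_iff\<close>)
  moreover have "(\<lambda>x. x \<otimes> u) ` K = K"
  proof
    show "(\<lambda>x. x \<otimes> u) ` K \<subseteq> K" using subgroup.m_closed[OF K] u by blast
    show "K \<subseteq> (\<lambda>x. x \<otimes> u) ` K"
    proof
      fix x assume x: "x \<in> K"
      have "x = (x \<otimes> inv u) \<otimes> u" using Kc[OF x] uc by (simp add: m_assoc)
      moreover have "x \<otimes> inv u \<in> K" using subgroup.m_closed[OF K x subgroup.m_inv_closed[OF K u]] .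
      ultimately show "x \<in> (\<lambda>x. x \<otimes> u) ` K" by blast
    qed
  qed
  moreover have "v \<otimes> inv u \<otimes> u = v" using uc vc by (simp add: m_assoc)
  ultimately show "\<exists>p. hpath (cayley S) K u p v" using uc by auto
qed

section \<open>The base cases inside the general linear group\<close>

context gl_setup
begin

lemma sum_two:
  assumes "2 \<le> n" "\<And>l. 2 \<le> l \<Longrightarrow> l < n \<Longrightarrow> f l = 0"
  shows "(\<Sum>l<n. f l) = f 0 + (f 1 :: 'a)"
proof -
  have "(\<Sum>l<n. f l) = (\<Sum>l\<in>{0, 1}. f l)"
  proof (rule sum.mono_neutral_right)
    show "\<forall>i\<in>{..<n} - {0, 1}. f i = 0"
    proof
      fix i assume "i \<in> {..<n} - {0, 1}"
      then have "2 \<le> i" "i < n" by auto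
      then show "f i = 0" by (rule assms(2))
    qed
  qed (use assms in auto)
  then show ?thesis by simp
qed

text \<open>By \<open>z\<close> the upper left blocks of \<open>g\<close> and \<open>h\<close>
  multiply to the identity, and the 2 x 2 determinant is multiplicative.\<close>

lemma corner_det:
  assumes n: "2 \<le> n" and gh: "g \<in> carrier_mat n n" "h \<in> carrier_mat n n" "g * h = 1\<^sub>m n"
    and z: "\<And>i j l. i < 2 \<Longrightarrow> j < 2 \<Longrightarrow> 2 \<le> l \<Longrightarrow> l < n \<Longrightarrow> g $$ (i, l) * h $$ (l, j) = 0"
  shows "g $$ (0, 0) * g $$ (1, 1) - g $$ (0, 1) * g $$ (1, 0) \<noteq> (0 :: 'a)"
proof
  assume 0: "g $$ (0, 0) * g $$ (1, 1) - g $$ (0, 1) * g $$ (1, 0) = 0"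
  have e: "g $$ (i, 0) * h $$ (0, j) + g $$ (i, 1) * h $$ (1, j) = of_bool (i = j)" if "i < 2" "j < 2" for i j
  proof -
    have ij: "i < n" "j < n" using that n by auto
    have "g $$ (i, 0) * h $$ (0, j) + g $$ (i, 1) * h $$ (1, j) = (\<Sum>l<n. g $$ (i, l) * h $$ (l, j))"
      using sum_two[OF n, of "\<lambda>l. g $$ (i, l) * h $$ (l, j)"] z[OF that] by simp
    also have "\<dots> = (g * h) $$ (i, j)" using mat_mult_entry[OF gh(1,2) ij] by simp
    also have "\<dots> = of_bool (i = j)" unfolding gh(3) using ij by simp
    finally show ?thesis .
  qed
  have "(g $$ (0, 0) * g $$ (1, 1) - g $$ (0, 1) * g $$ (1, 0)) * (h $$ (0, 0) * h $$ (1, 1) - h $$ (0, 1) * h $$ (1, 0))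
    = (g $$ (0, 0) * h $$ (0, 0) + g $$ (0, 1) * h $$ (1, 0)) * (g $$ (1, 0) * h $$ (0, 1) + g $$ (1, 1) * h $$ (1, 1))
    - (g $$ (0, 0) * h $$ (0, 1) + g $$ (0, 1) * h $$ (1, 1)) * (g $$ (1, 0) * h $$ (0, 0) + g $$ (1, 1) * h $$ (1, 0))"
    by (simp add: algebra_simps)
  also have "\<dots> = 1" using e[of 0 0] e[of 0 1] e[of 1 0] e[of 1 1] by simp
  finally show False using 0 by simp
qed

definition phi :: "('a \<times> 'a) \<times> ('a \<times> 'a) \<Rightarrow> 'a mat" where
  "phi X = mat n n (\<lambda>(i, j). if i < 2 \<and> j < 2
     then (if j = 0 then fst else snd) (if i = 0 then fst X else snd X) else of_bool (i = j))"

lemma phi_carrier_mat [simp]: "phi X \<in> carrier_mat n n" "dim_row (phi X) = n" "dim_col (phi X) = n"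
  by (simp_all add: phi_def)

lemma phi_entry: "i < n \<Longrightarrow> j < n \<Longrightarrow> phi X $$ (i, j) = (if i < 2 \<and> j < 2
     then (if j = 0 then fst else snd) (if i = 0 then fst X else snd X) else of_bool (i = j))"
  by (simp add: phi_def)

lemma phi_mult:
  assumes n: "2 \<le> n"
  shows "phi X * phi Y = phi ((fst (fst X) * fst (fst Y) + snd (fst X) * fst (snd Y),
      fst (fst X) * snd (fst Y) + snd (fst X) * snd (snd Y)),
    (fst (snd X) * fst (fst Y) + snd (snd X) * fst (snd Y),
      fst (snd X) * snd (fst Y) + snd (snd X) * snd (snd Y)))" (is "_ = phi ?Z")
proof (rule eq_matI)
  fix i j assume "i < dim_row (phi ?Z)" "j < dim_col (phi ?Z)"
  then have ij: "i < n" "j < n" by simp_all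
  consider "2 \<le> i" | "i < 2" "2 \<le> j" | "i < 2" "j < 2" by linarith
  then show "(phi X * phi Y) $$ (i, j) = phi ?Z $$ (i, j)"
  proof cases
    case 1
    have "phi X $$ (i, l) = 0" if "l < n" "l \<noteq> i" for l using 1 that ij by (simp add: phi_entry)
    from mat_mult_unit_row[OF _ _ ij this ij(1), of "phi Y"] show ?thesis using 1 ij by (simp add: phi_entry)
  next
    case 2
    have "phi Y $$ (l, j) = 0" if "l < n" "l \<noteq> j" for l using 2 that ij by (simp add: phi_entry)
    from mat_mult_unit_col[OF _ _ ij this ij(2), of "phi X"] show ?thesis using 2 ij by (simp add: phi_entry)
  next
    case 3
    have "(phi X * phi Y) $$ (i, j) = (\<Sum>l<n. phi X $$ (i, l) * phi Y $$ (l, j))"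
      by (rule mat_mult_entry[OF _ _ ij]) simp_all
    also have "\<dots> = phi X $$ (i, 0) * phi Y $$ (0, j) + phi X $$ (i, 1) * phi Y $$ (1, j)"
      by (rule sum_two[OF n]) (use 3 ij in \<open>simp add: phi_entry\<close>)
    also have "\<dots> = phi ?Z $$ (i, j)"
    proof -
      have "i = 0 \<or> i = 1" "j = 0 \<or> j = 1" using 3 by auto
      then show ?thesis using n by (auto simp: phi_entry)
    qed
    finally show ?thesis .
  qed
qed simp_all

lemma phi_one: "phi ((1, 0), (0, 1)) = 1\<^sub>m n"
  by (rule eq_matI) (auto simp: phi_entry less_2_cases_iff)

lemma phi_G:
  assumes n: "2 \<le> n" and X: "X \<in> GL2"
  shows "phi X \<in> carrier G"
proof -
  obtain a b c d where X': "X = ((a, b), (c, d))" by (metis prod.collapse)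
  define D where "D = a * d - b * c"
  have D: "D \<noteq> 0" using X by (simp add: X' GL2_def det2_def D_def)
  have e: "a * (d / D) + b * (- c / D) = 1" "a * (- b / D) + b * (a / D) = 0"
    "c * (d / D) + d * (- c / D) = 0" "c * (- b / D) + d * (a / D) = 1"
    "d / D * a + - b / D * c = 1" "d / D * b + - b / D * d = 0"
    "- c / D * a + a / D * c = 0" "- c / D * b + a / D * d = 1"
    using D by (simp_all add: divide_simps) (simp_all add: D_def algebra_simps)
  let ?Y = "((d / D, - b / D), (- c / D, a / D))"
  have "phi X * phi ?Y = 1\<^sub>m n" "phi ?Y * phi X = 1\<^sub>m n"
    unfolding phi_mult[OF n] X' fst_conv snd_conv e phi_one by (rule refl)+
  then show ?thesis by (intro carrier_GI) simp_all
qed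

lemma phi_inj: "2 \<le> n \<Longrightarrow> inj phi"
proof (rule injI)
  fix X Y assume n: "2 \<le> n" and eq: "phi X = phi Y"
  have "phi X $$ (i, j) = phi Y $$ (i, j)" for i j using eq by simp
  from this[of 0 0] this[of 0 1] this[of 1 0] this[of 1 1] show "X = Y"
    using n by (simp add: phi_entry prod_eq_iff)
qed

lemma phi_image:
  assumes n: "2 \<le> n"
  shows "phi ` GL2 = Gk 2"
proof
  show "phi ` GL2 \<subseteq> Gk 2" using phi_G[OF n] by (auto simp: Gk_def phi_entry)
  show "Gk 2 \<subseteq> phi ` GL2"
  proof
    fix g assume g: "g \<in> Gk 2"
    have gG: "g \<in> carrier G" using g by (simp add: Gk_def)
    have gm: "g \<in> carrier_mat n n" "inv\<^bsub>G\<^esub> g \<in> carrier_mat n n" using carrier_G_mat gG by auto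
    have "g * inv\<^bsub>G\<^esub> g = 1\<^sub>m n" using G.r_inv[OF gG] by simp
    then have det: "g $$ (0, 0) * g $$ (1, 1) - g $$ (0, 1) * g $$ (1, 0) \<noteq> 0"
      by (rule corner_det[OF n gm]) (use n in \<open>auto simp: GkD[OF g]\<close>)
    let ?X = "((g $$ (0, 0), g $$ (0, 1)), (g $$ (1, 0), g $$ (1, 1)))"
    have "g = phi ?X"
    proof (rule eq_matI)
      fix i j assume "i < dim_row (phi ?X)" "j < dim_col (phi ?X)"
      then have ij: "i < n" "j < n" by simp_all
      show "g $$ (i, j) = phi ?X $$ (i, j)"
        using GkD[OF g ij] by (auto simp: phi_entry[OF ij] less_2_cases_iff)
    qed (use gm in auto)
    moreover have "?X \<in> GL2" using det by (simp add: GL2_def det2_def)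
    ultimately show "g \<in> phi ` GL2" by blast
  qed
qed

lemma arc01: "2 \<le> n \<Longrightarrow> (0, 1) \<in> parcs T" "2 \<le> n \<Longrightarrow> (1, 0) \<in> parcs T"
  using up[of 1] down[of 1] by auto

lemma phi_addrow:
  assumes n: "2 \<le> n"
  shows "addrow_mat n 1 1 0 * phi X = phi (fst X, snd X + fst X)"
    "addrow_mat n 1 0 1 * phi X = phi (fst X + snd X, snd X)"
proof -
  have n': "0 < n" "1 < n" using n by simp_all
  show "addrow_mat n 1 1 0 * phi X = phi (fst X, snd X + fst X)"
    unfolding addrow_mat[OF phi_carrier_mat(1) n'(1), symmetric]
    using n by (intro eq_matI) (auto simp: phi_entry)
  show "addrow_mat n 1 0 1 * phi X = phi (fst X + snd X, snd X)"
    unfolding addrow_mat[OF phi_carrier_mat(1) n'(2), symmetric]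
    using n by (intro eq_matI) (auto simp: phi_entry)
qed

lemma phi_multrow:
  assumes n: "2 \<le> n"
  shows "multrow_mat n 0 a * phi X = phi (scl a (fst X), snd X)"
    "multrow_mat n 1 a * phi X = phi (fst X, scl a (snd X))"
  unfolding multrow_mat[OF phi_carrier_mat(1), symmetric]
  using n by (intro eq_matI; auto simp: phi_entry scl_def)+

lemma hconn_Gk_2:
  assumes n: "2 \<le> n" and q: "2 < CARD('a)"
  shows "hconn E (Gk 2)"
proof -
  have EI: "E (phi X) (phi Y)" if "X \<in> GL2" "Y \<in> GL2" "s \<in> S" "s * phi X = phi Y" for X Y s
    using phi_G[OF n that(1)] phi_G[OF n that(2)] that(3) that(4)[symmetric] unfolding G.cayley_def mult_G by blast
  have "hconn E (phi ` GL2)"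
  proof (rule hconn_image[OF hconn_GL2[OF q]])
    show "inj_on phi GL2" using phi_inj[OF n] by (rule inj_on_subset) simp
    fix X Y :: "('a \<times> 'a) \<times> ('a \<times> 'a)" assume X: "X \<in> GL2" and Y: "Y \<in> GL2" and adj: "radj X Y"
    \<comment> \<open>Since \<open>E\<close> is symmetric, it is enough to treat row additions and
      scalings by \<alpha>; subtractions and divisions are the reversed edges.\<close>
    have main: "E (phi X) (phi Y)" if "X \<in> GL2" "Y \<in> GL2" and
      "fst Y = fst X \<and> snd Y = snd X + fst X \<or> snd Y = snd X \<and> fst Y = fst X + snd X \<or>
       snd Y = snd X \<and> fst Y = scl \<alpha> (fst X) \<or> fst Y = fst X \<and> snd Y = scl \<alpha> (snd X)" for X Y
    proof -
      from that(3) have "Y = (fst X, snd X + fst X) \<or> Y = (fst X + snd X, snd X) \<or>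
          Y = (scl \<alpha> (fst X), snd X) \<or> Y = (fst X, scl \<alpha> (snd X))" by (auto simp: prod_eq_iff)
      then show ?thesis
      proof (elim disjE)
        assume Y: "Y = (fst X, snd X + fst X)"
        show ?thesis by (rule EI[OF that(1,2) arc_S[OF arc01(1)[OF n]]]) (unfold Y, rule phi_addrow(1)[OF n])
      next
        assume Y: "Y = (fst X + snd X, snd X)"
        show ?thesis by (rule EI[OF that(1,2) arc_S[OF arc01(2)[OF n]]]) (unfold Y, rule phi_addrow(2)[OF n])
      next
        assume Y: "Y = (scl \<alpha> (fst X), snd X)"
        show ?thesis by (rule EI[OF that(1,2) mult_S[OF q, of 0]]) (use n in \<open>simp_all add: phi_multrow[OF n] Y\<close>)
      next
        assume Y: "Y = (fst X, scl \<alpha> (snd X))"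
        show ?thesis by (rule EI[OF that(1,2) mult_S[OF q, of 1]]) (use n in \<open>simp_all add: phi_multrow[OF n, simplified] Y\<close>)
      qed
    qed
    have "snd X = snd Y + fst Y" if "fst Y = fst X" "snd Y = snd X - fst X" using that by simp
    moreover have "fst X = fst Y + snd Y" if "snd Y = snd X" "fst Y = fst X - snd X" using that by simp
    ultimately show "E (phi X) (phi Y)"
      using adj main[OF X Y] sympD[OF symp_E main[OF Y X]] unfolding radj_def by metis
  qed
  then show ?thesis unfolding phi_image[OF n] .
qed

lemma hconn_large:
  assumes n: "2 \<le> n" and q: "2 < CARD('a)"
  shows "hconn E (carrier G)"
  using hconn_Gk_induct[OF hconn_Gk_2[OF n q] _ n] q by simp

definition bit_mat :: "affine_bits \<Rightarrow> 'a mat" where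
  "bit_mat s = mat n n (\<lambda>(i, j). if i < 2 \<and> j < 3 then
     of_bool ((if j = 0 then fst else if j = 1 then fst \<circ> snd else snd \<circ> snd) (if i = 0 then fst s else snd s))
     else of_bool (i = j))"

lemma bit_mat_carrier [simp]: "bit_mat s \<in> carrier_mat n n" "dim_row (bit_mat s) = n" "dim_col (bit_mat s) = n"
  by (simp_all add: bit_mat_def)

lemma bit_mat_entry: "i < n \<Longrightarrow> j < n \<Longrightarrow> bit_mat s $$ (i, j) = (if i < 2 \<and> j < 3 then
     of_bool ((if j = 0 then fst else if j = 1 then fst \<circ> snd else snd \<circ> snd) (if i = 0 then fst s else snd s))
     else of_bool (i = j))"
  by (simp add: bit_mat_def)

lemma two_elements:
  assumes "CARD('a) = 2"
  shows "x = 0 \<or> x = (1 :: 'a)"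
proof (rule ccontr)
  assume "\<not> ?thesis"
  then have "card {0, 1, x} = 3" by auto
  then show False using assms card_mono[of "UNIV :: 'a set" "{0, 1, x}"] by simp
qed

lemma two_zero:
  assumes "CARD('a) = 2"
  shows "(2 :: 'a) = 0"
proof -
  have "(1 :: 'a) + 1 \<noteq> 1 + 0" by (metis add_left_cancel zero_neq_one)
  then show ?thesis using two_elements[OF assms, of "1 + 1"] by simp
qed

lemma of_bool_add:
  assumes "CARD('a) = 2"
  shows "(of_bool (a \<noteq> b) :: 'a) = of_bool a + of_bool b"
  using two_zero[OF assms] by auto

lemma ex_bit_cert: "\<exists>ws. bit_cert 2 ws" "\<exists>ws. bit_cert 3 ws"
  by (rule exI, rule bit_cert_2) (rule exI, rule bit_cert_3)

lemma bit_mat_op: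
  assumes n: "3 \<le> n" and q: "CARD('a) = 2"
  shows "bit_mat (bit_op 0 s) = addrow_mat n 1 1 0 * bit_mat s"
    "bit_mat (bit_op 1 s) = addrow_mat n 1 0 1 * bit_mat s"
    "bit_mat (bit_op 2 s) = addrow_mat n 1 0 2 * bit_mat s"
    "bit_mat (bit_op 3 s) = addrow_mat n 1 1 2 * bit_mat s"
proof -
  obtain a b x c d y where s: "s = ((a, b, x), (c, d, y))" by (metis prod.collapse)
  have n': "0 < n" "1 < n" "2 < n" using n by simp_all
  have j: "j = 0 \<or> j = 1 \<or> j = 2 \<or> 3 \<le> j" for j :: nat by linarith
  have neg: "(of_bool (\<not> p) :: 'a) = 1 + of_bool p" for p using of_bool_add[OF q, of True p] by simp
  show "bit_mat (bit_op 0 s) = addrow_mat n 1 1 0 * bit_mat s"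
    unfolding addrow_mat[OF bit_mat_carrier(1) n'(1), symmetric]
    by (rule eq_matI) (use n in \<open>auto simp: bit_mat_entry s of_bool_add[OF q] two_zero[OF q] add.commute less_2_cases_iff\<close>)
  show "bit_mat (bit_op 1 s) = addrow_mat n 1 0 1 * bit_mat s"
    unfolding addrow_mat[OF bit_mat_carrier(1) n'(2), symmetric]
    by (rule eq_matI) (use n in \<open>auto simp: bit_mat_entry s of_bool_add[OF q] two_zero[OF q] add.commute less_2_cases_iff\<close>)
  show "bit_mat (bit_op 2 s) = addrow_mat n 1 0 2 * bit_mat s"
    unfolding addrow_mat[OF bit_mat_carrier(1) n'(3), symmetric]
    by (rule eq_matI) (use n j in \<open>auto simp: bit_mat_entry s neg two_zero[OF q] less_2_cases_iff numeral_3_eq_3 less_Suc_eq\<close>)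
  show "bit_mat (bit_op 3 s) = addrow_mat n 1 1 2 * bit_mat s"
    unfolding addrow_mat[OF bit_mat_carrier(1) n'(3), symmetric]
    by (rule eq_matI) (use n j in \<open>auto simp: bit_mat_entry s neg two_zero[OF q] less_2_cases_iff numeral_3_eq_3 less_Suc_eq\<close>)
qed

lemma bit_mat_inj: "3 \<le> n \<Longrightarrow> inj bit_mat"
proof (rule injI)
  fix s t assume n: "3 \<le> n" and eq: "bit_mat s = bit_mat t"
  have "bit_mat s $$ (i, j) = bit_mat t $$ (i, j)" for i j using eq by simp
  from this[of 0 0] this[of 0 1] this[of 0 2] this[of 1 0] this[of 1 1] this[of 1 2]
  show "s = t" using n by (auto simp: bit_mat_entry prod_eq_iff)
qed

lemma bit_mat_one: "3 \<le> n \<Longrightarrow> bit_mat bit_one = 1\<^sub>m n"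
  by (rule eq_matI) (auto simp: bit_mat_entry bit_one_def less_2_cases_iff numeral_3_eq_3 less_Suc_eq)

lemma ex_bit_mat:
  assumes n: "3 \<le> n" and q: "CARD('a) = 2" and g: "g \<in> Pk 2"
  shows "\<exists>s. bit_valid s \<and> g = bit_mat s"
proof -
  have r: "2 < n" using n by simp
  have gG: "g \<in> carrier G" using g by (simp add: Pk_def Gk_def)
  have iP: "inv\<^bsub>G\<^esub> g \<in> Pk 2" using subgroup.m_inv_closed[OF subgroup_Pk[OF r] g] .
  have gm: "g \<in> carrier_mat n n" "inv\<^bsub>G\<^esub> g \<in> carrier_mat n n" using carrier_G_mat gG by auto
  have "g * inv\<^bsub>G\<^esub> g = 1\<^sub>m n" using G.r_inv[OF gG] by simp
  moreover have "(inv\<^bsub>G\<^esub> g) $$ (l, j) = 0" if "j < 2" "2 \<le> l" "l < n" for l j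
    using Pk_row[OF iP r, of j] GkD[OF Pk_Gk[OF iP], of l j] that n by (cases "l = 2") auto
  ultimately have det: "g $$ (0, 0) * g $$ (1, 1) - g $$ (0, 1) * g $$ (1, 0) \<noteq> 0"
    using corner_det[of g "inv\<^bsub>G\<^esub> g"] n gm by simp
  have b: "of_bool (g $$ (i, j) = 1) = g $$ (i, j)" for i j using two_elements[OF q, of "g $$ (i, j)"] by auto
  let ?s = "((g $$ (0, 0) = 1, g $$ (0, 1) = 1, g $$ (0, 2) = 1), (g $$ (1, 0) = 1, g $$ (1, 1) = 1, g $$ (1, 2) = 1))"
  have "g = bit_mat ?s"
  proof (rule eq_matI)
    fix i j assume "i < dim_row (bit_mat ?s)" "j < dim_col (bit_mat ?s)"
    then have ij: "i < n" "j < n" by simp_all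
    consider "i < 2" "j < 3" | "3 \<le> i \<or> 3 \<le> j" | "i = 2" "j \<noteq> 2" "j < 3" | "i = 2" "j = 2" by linarith
    then show "g $$ (i, j) = bit_mat ?s $$ (i, j)"
    proof cases
      case 1
      have "j = 0 \<or> j = 1 \<or> j = 2" "i = 0 \<or> i = 1" using 1 by auto
      then show ?thesis using ij by (auto simp: bit_mat_entry b)
    next
      case 2
      then show ?thesis using GkD[OF Pk_Gk[OF g] ij] ij by (auto simp: bit_mat_entry numeral_3_eq_3)
    next
      case 3
      then show ?thesis using Pk_row[OF g r, of j] ij by (simp add: bit_mat_entry)
    next
      case 4
      then show ?thesis
        using two_elements[OF q, of "g $$ (2, 2)"] Pk_diag_nz[OF g r] ij by (simp add: bit_mat_entry)
    qed
  qed (use gm in auto)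
  moreover have "bit_valid ?s"
    using det two_elements[OF q, of "g $$ (0, 0)"] two_elements[OF q, of "g $$ (0, 1)"]
      two_elements[OF q, of "g $$ (1, 0)"] two_elements[OF q, of "g $$ (1, 1)"] by auto
  ultimately show ?thesis by blast
qed

lemma hconn_Pk_2:
  assumes n: "3 \<le> n" and q: "CARD('a) = 2"
  shows "hconn E (Pk 2)"
proof -
  have r: "2 < n" "2 \<le> n" using n by simp_all
  obtain j where j: "j < 2" "(2, j) \<in> parcs T" using down[of 2] r by auto
  obtain J where J: "j = 0 \<and> J = (2 :: nat) \<or> j = 1 \<and> J = 3" using j(1) by (auto simp: less_2_cases_iff)
  obtain ws where ws: "bit_cert J ws" using J ex_bit_cert by blast
  let ?P = "\<lambda>i. i = 0 \<or> i = 1 \<or> i = J"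
  have op: "\<exists>s\<in>S \<inter> Pk 2. bit_mat (bit_op i t) = s * bit_mat t" if "?P i" for i t
  proof -
    have S: "addrow_mat n 1 1 0 \<in> S" "addrow_mat n 1 0 1 \<in> S" "addrow_mat n 1 j 2 \<in> S"
      using arc_S[OF arc01(1)[OF r(2)]] arc_S[OF arc01(2)[OF r(2)]] arc_S[OF j(2)] by simp_all
    have P: "addrow_mat n 1 1 0 \<in> Pk 2" "addrow_mat n 1 0 1 \<in> Pk 2" "addrow_mat n 1 j 2 \<in> Pk 2"
      using addrow_Pk[of 1 2 0 1] addrow_Pk[of 0 2 1 1] addrow_Pk[of j 2 2 1] r j by simp_all
    have "bit_mat (bit_op J t) = addrow_mat n 1 j 2 * bit_mat t"
      using J bit_mat_op(3,4)[OF n q, of t] by blast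
    then show ?thesis using that bit_mat_op(1,2)[OF n q, of t] S P by blast
  qed
  have run: "\<forall>t\<in>set (bit_run w s). bit_mat t \<in> Pk 2" if "list_all ?P w" "bit_mat s \<in> Pk 2" for w s
    using that
  proof (induction w arbitrary: s)
    case (Cons i w)
    obtain g where g: "g \<in> Pk 2" "bit_mat (bit_op i s) = g * bit_mat s" using op[of i s] Cons.prems(1) by auto
    have "bit_mat (bit_op i s) \<in> Pk 2"
      using subgroup.m_closed[OF subgroup_Pk[OF r(1)] g(1) Cons.prems(2)] g(2) by simp
    then show ?case using Cons by simp
  qed simp
  have one: "bit_mat bit_one \<in> Pk 2"
    using subgroup.one_closed[OF subgroup_Pk[OF r(1)]] by (simp add: bit_mat_one[OF n])
  \<comment> \<open>That these matrices are invertible is not computed: each valid state lies on a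
    certified path from the identity, and every step multiplies by an element of
    \<open>Pk 2\<close>.\<close>
  have valid_P: "bit_mat s \<in> Pk 2" if sv: "bit_valid s" for s
  proof (cases "s = bit_one")
    case False
    obtain w where w: "list_all ?P w"
      "hpath (\<lambda>s t. \<exists>i. ?P i \<and> t = bit_op i s) {s. bit_valid s} bit_one (bit_run w bit_one) s"
      using bit_cert_hpath[OF ws sv False] by blast
    then have "s \<in> set (bit_run w bit_one)" using that by (simp add: hpath_def)
    then show ?thesis using run[OF w(1) one] by blast
  qed (use one in simp)
  have im: "bit_mat ` {s. bit_valid s} = Pk 2" using valid_P ex_bit_mat[OF n q] by blast
  show ?thesis
  proof (rule G.hconn_from_one[OF S_G subgroup_Pk[OF r(1)]])
    fix v assume "v \<in> Pk 2" "v \<noteq> \<one>\<^bsub>G\<^esub>"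
    then obtain s where s: "bit_valid s" "v = bit_mat s" using ex_bit_mat[OF n q] by blast
    then have s1: "s \<noteq> bit_one" using \<open>v \<noteq> \<one>\<^bsub>G\<^esub>\<close> bit_mat_one[OF n] by auto
    obtain w where w: "hpath (\<lambda>s t. \<exists>i. ?P i \<and> t = bit_op i s) {s. bit_valid s} bit_one (bit_run w bit_one) s"
      using bit_cert_hpath[OF ws s(1) s1] by blast
    have "hpath E (bit_mat ` {s. bit_valid s}) (bit_mat bit_one) (map bit_mat (bit_run w bit_one)) (bit_mat s)"
    proof (rule hpath_image[OF w])
      show "inj_on bit_mat {s. bit_valid s}" using bit_mat_inj[OF n] by (rule inj_on_subset) simp
      fix x y assume x: "x \<in> {s. bit_valid s}" and y: "y \<in> {s. bit_valid s}" and xy: "\<exists>i. ?P i \<and> y = bit_op i x"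
      then obtain g where "g \<in> S" "bit_mat y = g * bit_mat x" using op by blast
      moreover have "bit_mat x \<in> carrier G" "bit_mat y \<in> carrier G"
        using valid_P x y by (auto simp: Pk_def Gk_def)
      ultimately show "E (bit_mat x) (bit_mat y)" by (auto simp: G.cayley_def)
    qed
    then show "\<exists>p. hpath E (Pk 2) \<one>\<^bsub>G\<^esub> p v" unfolding im bit_mat_one[OF n] s(2) one_G by blast
  qed
qed

lemma hconn_two:
  assumes n: "3 \<le> n" and q: "CARD('a) = 2"
  shows "hconn E (carrier G)"
proof -
  have "hconn E (Gk 3)" using hconn_Gk_Suc[OF hconn_Pk_2[OF n q]] n by (simp add: numeral_3_eq_3)
  then show ?thesis using hconn_Gk_induct[of 3] n by simp
qed

section \<open>The graphs that are cycles\<close>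

lemma arcs_GL_graph: "(X, Y) \<in> parcs (GL_graph n \<alpha> T) \<longleftrightarrow> E X Y"
proof
  assume "(X, Y) \<in> parcs (GL_graph n \<alpha> T)"
  then obtain Z s where Z: "Z \<in> carrier G" "s \<in> S" "(X, Y) = (Z, s * Z) \<or> (X, Y) = (s * Z, Z)"
    by (auto simp: GL_graph_def)
  have "E Z (s * Z)"
    using Z S_G G.m_closed[of s Z] by (auto simp: G.cayley_def subset_iff)
  then show "E X Y" using Z(3) sympD[OF symp_E] by auto
next
  assume "E X Y"
  then show "(X, Y) \<in> parcs (GL_graph n \<alpha> T)" by (auto simp: GL_graph_def G.cayley_def)
qed

lemma verts_GL_graph: "pverts (GL_graph n \<alpha> T) = carrier G"
  by (simp add: GL_graph_def)

lemma Hamilton_connected_GL_graph: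
  assumes "hconn E (carrier G)"
  shows "Hamilton_connected (GL_graph n \<alpha> T)"
  unfolding Hamilton_connected_def verts_GL_graph
proof (intro ballI impI)
  fix u v assume "u \<in> carrier G" "v \<in> carrier G" "u \<noteq> v"
  then obtain p where p: "hpath E (carrier G) u p v" using hconnD[OF assms] by blast
  have "set (vwalk_arcs p) \<subseteq> parcs (GL_graph n \<alpha> T)" if "successively E p" for p
    using that by (induction p rule: vwalk_arcs.induct) (auto simp: arcs_GL_graph)
  then show "\<exists>p. Hamilton_path (GL_graph n \<alpha> T) u p v"
    using p by (auto simp: Hamilton_path_def hpath_def vpath_def vwalk_def verts_GL_graph)
qed

lemma set_vwalk_arcs: "set (vwalk_arcs xs) = {(xs ! i, xs ! Suc i) | i. Suc i < length xs}"
proof (induction xs rule: vwalk_arcs.induct)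
  case (3 x y xs)
  have "{(((x # y # xs) ! i), (x # y # xs) ! Suc i) | i. Suc i < length (x # y # xs)} =
    insert (x, y) {((y # xs) ! i, (y # xs) ! Suc i) | i. Suc i < length (y # xs)}" (is "?L = ?R")
  proof
    show "?L \<subseteq> ?R"
    proof
      fix z assume "z \<in> ?L"
      then obtain i where "z = ((x # y # xs) ! i, (x # y # xs) ! Suc i)" "Suc i < length (x # y # xs)" by blast
      then show "z \<in> ?R" by (cases i) auto
    qed
    show "?R \<subseteq> ?L"
    proof
      fix z assume "z \<in> ?R"
      then consider "z = (x, y)" | i where "z = ((y # xs) ! i, (y # xs) ! Suc i)" "Suc i < length (y # xs)" by blast
      then show "z \<in> ?L"
      proof cases
        case 1
        then show ?thesis by (intro CollectI exI[of _ 0]) simp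
      next
        case (2 i)
        then show ?thesis by (intro CollectI exI[of _ "Suc i"]) simp
      qed
    qed
  qed
  then show ?case using 3 by simp
qed simp_all

text \<open>GL_1 is cyclic of order \<open>m\<close>, and the only generators present are \<alpha>
  and its inverse \<alpha>^(m-1).\<close>

lemma cycle_dim_1:
  assumes n: "n = 1" and m: "3 \<le> m"
  shows "is_cycle_graph (GL_graph n \<alpha> T)"
proof -
  let ?V = "\<lambda>i. multrow_mat n 0 (\<alpha> ^ i)"
  have q: "2 < CARD('a)" using m m_def by simp
  have V0: "?V i $$ (0, 0) = \<alpha> ^ i" for i using n by simp
  have eqI: "A = B" if "A \<in> carrier_mat n n" "B \<in> carrier_mat n n" "A $$ (0, 0) = B $$ (0, 0)" for A B :: "'a mat"
    using that n by (intro eq_matI) auto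
  have per: "?V i = ?V (i mod m)" for i by (simp add: pow_mod)
  have parcs0: "parcs T = {}" using arcs n by force
  have MG: "?V i \<in> carrier G" for i using multrow_G n alpha_nz by simp
  have invM: "inv\<^bsub>G\<^esub> (?V 1) = ?V (m - 1)"
  proof (rule G.inv_equality)
    have "\<alpha> ^ (m - 1) * \<alpha> ^ 1 = 1" using pow_m m by (metis le_add_diff_inverse2 one_le_numeral order_trans power_add)
    then have "?V (m - 1) * ?V 1 = multrow_mat n 0 1" using multrow_mult[of 0 "\<alpha> ^ (m - 1)" "\<alpha> ^ 1"] n by simp
    also have "\<dots> = 1\<^sub>m n" using n by (intro eqI) auto
    finally show "?V (m - 1) \<otimes>\<^bsub>G\<^esub> ?V 1 = \<one>\<^bsub>G\<^esub>" by simp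
  qed (use MG[of 1] MG[of "m - 1"] in simp_all)
  have og: "op_gens n \<alpha> T = {?V 1}" using q n parcs0 by (auto simp: op_gens_def M_mat_def)
  have S: "S = {?V 1, ?V (m - 1)}" unfolding ops_def og using invM by auto
  have mult: "?V i * ?V j = ?V (i + j)" for i j using multrow_mult[of 0 "\<alpha> ^ i" "\<alpha> ^ j"] n by (simp add: power_add)
  have carr: "carrier G = ?V ` {..<m}"
  proof
    show "?V ` {..<m} \<subseteq> carrier G" using MG by auto
    show "carrier G \<subseteq> ?V ` {..<m}"
    proof
      fix X assume X: "X \<in> carrier G"
      have "X $$ (0, 0) \<noteq> 0"
      proof
        assume 0: "X $$ (0, 0) = 0"
        have c: "X \<in> carrier_mat n n" "inv\<^bsub>G\<^esub> X \<in> carrier_mat n n" using X carrier_G_mat by auto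
        have "X * inv\<^bsub>G\<^esub> X = 1\<^sub>m n" using G.r_inv[OF X] by simp
        moreover have "(X * inv\<^bsub>G\<^esub> X) $$ (0, 0) = 0" using mat_mult_entry[OF c, of 0 0] n 0 by simp
        ultimately show False using n by simp
      qed
      then obtain i where "i < m" "X $$ (0, 0) = \<alpha> ^ i" using ex_pow by blast
      then show "X \<in> ?V ` {..<m}" using eqI[OF carrier_G_mat[OF X] _ , of "?V i"] V0 by auto
    qed
  qed
  have inj: "?V i = ?V j \<longleftrightarrow> i mod m = j mod m" for i j
  proof
    assume "?V i = ?V j"
    then have "\<alpha> ^ i = \<alpha> ^ j" using V0 by metis
    then show "i mod m = j mod m" by (simp add: pow_eq_iff)
  next
    assume "i mod m = j mod m"
    then show "?V i = ?V j" using per by metis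
  qed
  let ?vs = "map ?V [0..<m]"
  have E1: "E X Y \<longleftrightarrow> (\<exists>i<m. (X, Y) = (?V i, ?V (Suc i)) \<or> (Y, X) = (?V i, ?V (Suc i)))" for X Y
  proof
    assume "E X Y"
    then obtain s where s: "X \<in> carrier G" "Y \<in> carrier G" "s \<in> S" "Y = s * X" by (auto simp: G.cayley_def)
    then obtain i where i: "i < m" "X = ?V i" using carr by auto
    consider "s = ?V 1" | "s = ?V (m - 1)" using s(3) S by blast
    then show "\<exists>i<m. (X, Y) = (?V i, ?V (Suc i)) \<or> (Y, X) = (?V i, ?V (Suc i))"
    proof cases
      case 1
      then have "Y = ?V (Suc i)" using s i mult[of 1 i] by simp
      then show ?thesis using i by blast
    next
      case 2
      then have Y: "Y = ?V (m - 1 + i)" using s i mult[of "m - 1" i] by simp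
      \<comment> \<open>The predecessor of \<open>i\<close> modulo \<open>m\<close>.\<close>
      let ?j = "(m - 1 + i) mod m"
      have "Suc ?j mod m = i mod m"
      proof -
        have "Suc ?j mod m = Suc (m - 1 + i) mod m" by (simp add: mod_Suc_eq)
        also have "Suc (m - 1 + i) = m + i" using m by simp
        finally show ?thesis by simp
      qed
      then have "?V (Suc ?j) = ?V i" unfolding inj .
      then have "X = ?V (Suc ?j)" using i(2) by metis
      moreover have "Y = ?V ?j" using Y per by simp
      moreover have "?j < m" using m by simp
      ultimately show ?thesis by blast
    qed
  next
    assume "\<exists>i<m. (X, Y) = (?V i, ?V (Suc i)) \<or> (Y, X) = (?V i, ?V (Suc i))"
    then obtain i where i: "(X, Y) = (?V i, ?V (Suc i)) \<or> (Y, X) = (?V i, ?V (Suc i))" by blast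
    have "E (?V i) (?V (Suc i))"
      unfolding G.cayley_def mult_G S
      by (intro conjI MG bexI[of _ "?V 1"]) (auto simp only: mult plus_1_eq_Suc)
    then show "E X Y" using i sympD[OF symp_E] by auto
  qed
  have len: "length (?vs @ [hd ?vs]) = Suc m" by simp
  have nth: "(?vs @ [hd ?vs]) ! i = ?V i" if "i \<le> m" for i
  proof (cases "i = m")
    case True
    have "?V m = ?V 0" unfolding inj by simp
    then show ?thesis using True m by (simp add: nth_append hd_map)
  qed (use that in \<open>simp add: nth_append\<close>)
  let ?L = "?vs @ [hd ?vs]"
  have va: "set (vwalk_arcs ?L) = (\<lambda>i. (?V i, ?V (Suc i))) ` {..<m}"
  proof -
    have "set (vwalk_arcs ?L) = (\<lambda>i. (?L ! i, ?L ! Suc i)) ` {..<m}"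
      unfolding set_vwalk_arcs len Suc_less_eq by blast
    also have "\<dots> = (\<lambda>i. (?V i, ?V (Suc i))) ` {..<m}"
    proof (rule image_cong[OF refl])
      fix i assume "i \<in> {..<m}"
      then have "i \<le> m" "Suc i \<le> m" by auto
      then show "(?L ! i, ?L ! Suc i) = (?V i, ?V (Suc i))" by (simp only: nth)
    qed
    finally show ?thesis .
  qed
  have "parcs (GL_graph n \<alpha> T) = set (vwalk_arcs (?vs @ [hd ?vs])) \<union> (set (vwalk_arcs (?vs @ [hd ?vs])))\<inverse>"
  proof (rule Set.set_eqI)
    fix z :: "'a mat \<times> 'a mat"
    obtain X Y where z: "z = (X, Y)" by (cases z)
    show "z \<in> parcs (GL_graph n \<alpha> T) \<longleftrightarrow>
        z \<in> set (vwalk_arcs (?vs @ [hd ?vs])) \<union> (set (vwalk_arcs (?vs @ [hd ?vs])))\<inverse>"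
      unfolding va z arcs_GL_graph E1 by blast
  qed
  moreover have "distinct ?vs" using inj by (auto simp: distinct_map inj_on_def)
  moreover have "pverts (GL_graph n \<alpha> T) = set ?vs" unfolding verts_GL_graph carr by auto
  ultimately show ?thesis unfolding is_cycle_graph_def using m by (intro exI[of _ ?vs]) simp
qed

text \<open>There are at most two vertices; if there are two, multiplication by \<alpha> exchanges
  them.\<close>

lemma hconn_dim_1:
  assumes n: "n = 1" and m: "m < 3"
  shows "hconn E (carrier G)"
  unfolding hconn_def
proof (intro ballI impI)
  fix u v assume u: "u \<in> carrier G" and v: "v \<in> carrier G" and uv: "u \<noteq> v"
  have nz: "X $$ (0, 0) \<noteq> 0" if X: "X \<in> carrier G" for X
  proof
    assume 0: "X $$ (0, 0) = 0"
    have c: "X \<in> carrier_mat n n" "inv\<^bsub>G\<^esub> X \<in> carrier_mat n n" using X carrier_G_mat by auto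
    have "X * inv\<^bsub>G\<^esub> X = 1\<^sub>m n" using G.r_inv[OF X] by simp
    moreover have "(X * inv\<^bsub>G\<^esub> X) $$ (0, 0) = 0" using mat_mult_entry[OF c, of 0 0] n 0 by simp
    ultimately show False using n by simp
  qed
  have eqI: "A = B" if "A \<in> carrier G" "B \<in> carrier G" "A $$ (0, 0) = B $$ (0, 0)" for A B :: "'a mat"
    using that n carrier_G_mat[of A] carrier_G_mat[of B] by (intro eq_matI) auto
  obtain i j where ij: "i < m" "j < m" "u $$ (0, 0) = \<alpha> ^ i" "v $$ (0, 0) = \<alpha> ^ j"
    using ex_pow[OF nz[OF u]] ex_pow[OF nz[OF v]] by blast
  have "i \<noteq> j" using eqI[OF u v] uv ij by auto
  then have m2: "m = 2" using ij m by linarith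
  then have sq: "\<alpha> * \<alpha> = 1" using pow_m by (simp add: power2_eq_square)
  have q: "2 < CARD('a)" using m2 m_def by simp
  have "i = 0 \<and> j = 1 \<or> i = 1 \<and> j = 0" using ij m2 \<open>i \<noteq> j\<close> by auto
  then have e: "v $$ (0, 0) = \<alpha> * u $$ (0, 0)" using ij sq by auto
  have um: "u \<in> carrier_mat n n" using carrier_G_mat[OF u] .
  have M: "multrow_mat n 0 \<alpha> \<in> S" using mult_S[OF q, of 0] n by simp
  have "v = multrow_mat n 0 \<alpha> * u"
  proof (rule eqI[OF v])
    show "multrow_mat n 0 \<alpha> * u \<in> carrier G" using G.m_closed[of "multrow_mat n 0 \<alpha>" u] u M S_G by auto
    show "v $$ (0, 0) = (multrow_mat n 0 \<alpha> * u) $$ (0, 0)"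
      unfolding multrow_mat[OF um, symmetric] using um n e by simp
  qed
  then have E: "E u v" using u v M by (auto simp: G.cayley_def)
  have "carrier G = {u, v}"
  proof
    show "carrier G \<subseteq> {u, v}"
    proof
      fix X assume X: "X \<in> carrier G"
      obtain k where k: "k < m" "X $$ (0, 0) = \<alpha> ^ k" using ex_pow[OF nz[OF X]] by blast
      then have "k = i \<or> k = j" using ij m2 \<open>i \<noteq> j\<close> by auto
      then show "X \<in> {u, v}" using eqI[OF X u] eqI[OF X v] k ij by auto
    qed
  qed (use u v in auto)
  then have "hpath E (carrier G) u [u, v] v" using E uv by (auto simp: hpath_def)
  then show "\<exists>p. hpath E (carrier G) u p v" by blast
qed

text \<open>The group GL_2(2) has order 6 and the generators are two involutions, so the graph is a
  hexagon.\<close>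

lemma cycle_dim_2:
  assumes n: "n = 2" and q: "CARD('a) = 2"
  shows "is_cycle_graph (GL_graph n \<alpha> T)"
proof -
  have n2: "2 \<le> n" using n by simp
  have "(1 + 1 :: 'a) = 0" using two_zero[OF q] by simp
  then have neg: "(- 1 :: 'a) = 1" by (metis add_eq_0_iff)
  \<comment> \<open>The hexagon in cyclic order: the first row is added to the second and the second
    to the first in turn.\<close>
  define L :: "(('a \<times> 'a) \<times> ('a \<times> 'a)) list" where
    "L = [((1, 0), (0, 1)), ((1, 0), (1, 1)), ((0, 1), (1, 1)), ((0, 1), (1, 0)), ((1, 1), (1, 0)), ((1, 1), (0, 1))]"
  have GL: "GL2 = set L"
  proof (rule Set.set_eqI)
    fix X :: "('a \<times> 'a) \<times> ('a \<times> 'a)"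
    obtain a b c d where X: "X = ((a, b), (c, d))" by (metis prod.collapse)
    show "X \<in> GL2 \<longleftrightarrow> X \<in> set L"
      using two_elements[OF q, of a] two_elements[OF q, of b] two_elements[OF q, of c] two_elements[OF q, of d]
      unfolding X by (elim disjE) (simp_all add: GL2_def det2_def L_def)
  qed
  have carr: "carrier G = phi ` set L" using phi_image[OF n2] GL Gk_n n by simp
  let ?A = "addrow_mat n 1 1 0 :: 'a mat" and ?B = "addrow_mat n 1 0 1 :: 'a mat"
  have T: "parcs T = {(0, 1), (1, 0)}"
  proof
    show "parcs T \<subseteq> {(0, 1), (1, 0)}"
    proof
      fix e assume e: "e \<in> parcs T"
      obtain i j where ij: "e = (i, j)" by (cases e)
      then have "i < 2 \<and> j < 2 \<and> i \<noteq> j" using arcs e n by blast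
      then show "e \<in> {(0, 1), (1, 0)}" unfolding ij by auto
    qed
  qed (use arc01[OF n2] in auto)
  have invs: "inv\<^bsub>G\<^esub> ?A = ?A" "inv\<^bsub>G\<^esub> ?B = ?B" using inv_addrow[of 1 0 1] inv_addrow[of 0 1 1] n neg by simp_all
  have S: "S = {?A, ?B}"
  proof -
    have "op_gens n \<alpha> T = {?A, ?B}" using q T by (auto simp: op_gens_def A_mat_def)
    then show ?thesis using invs by (auto simp: ops_def)
  qed
  have ABphi: "?A * phi X = phi (fst X, snd X + fst X)" "?B * phi X = phi (fst X + snd X, snd X)" for X
    by (rule phi_addrow[OF n2])+
  have "parcs (GL_graph n \<alpha> T) =
    (\<Union>X\<in>set L. {(phi X, phi (fst X, snd X + fst X)), (phi (fst X, snd X + fst X), phi X),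
      (phi X, phi (fst X + snd X, snd X)), (phi (fst X + snd X, snd X), phi X)})"
    unfolding GL_graph_def carr S by (simp add: ABphi[simplified] insert_commute)
  also have "\<dots> = set (vwalk_arcs (map phi L @ [hd (map phi L)])) \<union> (set (vwalk_arcs (map phi L @ [hd (map phi L)])))\<inverse>"
    by (simp add: L_def two_zero[OF q]) (auto simp: insert_commute)
  finally have "parcs (GL_graph n \<alpha> T) =
    set (vwalk_arcs (map phi L @ [hd (map phi L)])) \<union> (set (vwalk_arcs (map phi L @ [hd (map phi L)])))\<inverse>" .
  moreover have "distinct (map phi L)"
    by (simp add: L_def inj_eq[OF phi_inj[OF n2]])
  moreover have "3 \<le> length (map phi L)" by (simp add: L_def)
  moreover have "pverts (GL_graph n \<alpha> T) = set (map phi L)" unfolding verts_GL_graph carr by simp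
  ultimately show ?thesis unfolding is_cycle_graph_def by blast
qed

end

text \<open>Deleting the top vertex removes only arcs at that vertex, so arcs found at a deeper
  level of the recursion are arcs of \<open>T\<close>.\<close>

lemma bypass_arcs:
  "bypass_transition_graph n T \<Longrightarrow> 1 \<le> r \<Longrightarrow> r < n \<Longrightarrow>
    (\<exists>i<r. (i, r) \<in> parcs T) \<and> (\<exists>j<r. (r, j) \<in> parcs T)"
proof (induction n T rule: bypass_transition_graph.induct)
  case (3 k T)
  show ?case
  proof (cases "r = Suc k")
    case True
    then show ?thesis using 3 by auto
  next
    case False
    then have "r < Suc k" using 3 by simp
    then have "(\<exists>i<r. (i, r) \<in> parcs (pair_del_vert T (Suc k))) \<and> (\<exists>j<r. (r, j) \<in> parcs (pair_del_vert T (Suc k)))"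
      using 3 by auto
    then show ?thesis by (auto simp: pair_del_vert_def)
  qed
qed auto

lemma bypass_transition_graph: "bypass_transition_graph n T \<Longrightarrow> transition_graph n T"
  by (cases "(n, T)" rule: bypass_transition_graph.cases) auto

theorem corollary2:
  fixes n :: nat
    and \<alpha> :: "'a::{field,finite}"
    and T :: "nat pair_pre_digraph"
  assumes "n \<ge> 1"
    and "mult_generator \<alpha>"
    and "bypass_transition_graph n T"
    and "\<not> is_cycle_graph (GL_graph n \<alpha> T)"
  shows "Hamilton_connected (GL_graph n \<alpha> T)"
proof -
  have T: "pair_digraph T" "pverts T = {..<n}"
    using bypass_transition_graph[OF assms(3)] by (auto simp: transition_graph_def)
  interpret gl_setup \<alpha> "CARD('a) - 1" n T
  proof
    fix i j assume ij: "(i, j) \<in> parcs T"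
    interpret pair_digraph T by (rule T(1))
    show "i < n \<and> j < n \<and> i \<noteq> j" using ij in_arcsD1[OF ij] in_arcsD2[OF ij] no_loops[OF ij] T(2) by auto
  qed (use assms(2) bypass_arcs[OF assms(3)] in auto)
  have "2 \<le> CARD('a)"
    using m_pos by simp
  \<comment> \<open>Cycles arise only for n = 1 and for n = q = 2, so these are the cases that
    appeal to the last assumption.\<close>
  then consider "n = 1" | "2 \<le> n" "2 < CARD('a)" | "n = 2" "CARD('a) = 2" | "3 \<le> n" "CARD('a) = 2"
    using assms(1) by linarith
  then have "hconn E (carrier G)"
  proof cases
    case 1
    then show ?thesis using hconn_dim_1[OF 1] cycle_dim_1[OF 1] assms(4) by (cases "CARD('a) - 1 < 3") simp_all
  next
    case 2
    then show ?thesis by (rule hconn_large)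
  next
    case 3
    then show ?thesis using cycle_dim_2 assms(4) by blast
  next
    case 4
    then show ?thesis by (rule hconn_two)
  qed
  then show ?thesis by (rule Hamilton_connected_GL_graph)
qed

end
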